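(* Let $\Omega\subset\mathbb{R}^d$ be a bounded Lipschitz domain and let $\Phi:\mathbb{R}^d\to\mathbb{R}$ be a continuous strictly positive definite kernel such that, for some $\sigma>d/2$ and constants $0<c_\Phi\le C_\Phi<\infty$, $$c_\Phi(1+\|\omega\|_2^2)^{-\sigma}\le\widehat\Phi(\omega)\le C_\Phi(1+\|\omega\|_2^2)^{-\sigma},\qquad \omega\in\mathbb{R}^d.$$ Assume that $0\le\tau\le\sigma$ and fix $c_0>0$. Then there exists a constant $C>0$, depending only on $d,\sigma,\tau,\Phi,\Omega,c_0$ (in particular independent of both $\delta$ and $X$), such that for every $0<\delta\le1$, every finite set $X\subset\Omega$ satisfying $q_X\le c_0\delta$, and every $v\in V_{\Phi_\delta,X}$, $$\|v\|_{H^\tau(\Omega)}\le C\,q_X^{-\tau}\,\|v\|_{L^2(\Omega)}.$$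
   Context: The Fourier transform is $\widehat f(\omega)=(2\pi)^{-d/2}\int_{\mathbb{R}^d}f(x)e^{-ix^T\omega}\,dx$, extended to $L^2(\mathbb{R}^d)$ in the usual way; $\Phi$ is integrable so that $\widehat\Phi$ is given by this integral. $\|\cdot\|_2$ is the Euclidean norm on $\mathbb{R}^d$. For $0<\delta\le1$, the scaled kernel is $\Phi_\delta(x)=\delta^{-d}\Phi(x/\delta)$. For a finite set $X=\{x_1,\dots,x_N\}$ of (at least two) distinct points, the separation distance is $q_X=\frac12\min_{j\ne k}\|x_j-x_k\|_2$, and $V_{\Phi_\delta,X}=\operatorname{span}\{\Phi_\delta(\cdot-x_j):x_j\in X\}$. For $s\ge0$, the Sobolev space $H^s(\mathbb{R}^d)$ consists of all $w\in L^2(\mathbb{R}^d)$ with finite norm $\|w\|_{H^s(\mathbb{R}^d)}^2=(2\pi)^{-d/2}\int_{\mathbb{R}^d}(1+\|\omega\|_2^2)^s|\widehat w(\omega)|^2\,d\omega$, and $H^s(\Omega)=\{w|_\Omega:w\in H^s(\mathbb{R}^d)\}$ carries the quotient norm $\|v\|_{H^s(\Omega)}=\inf\{\|w\|_{H^s(\mathbb{R}^d)}:w\in H^s(\mathbb{R}^d),\ w|_\Omega=v\}$. For $v\in V_{\Phi_\delta,X}$, norms over $\Omega$ are those of the restriction $v|_\Omega$. *)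

theory Defs
  imports "HOL-Analysis.Analysis" "HOL-Library.Function_Algebras"
begin

definition fourier :: "('a::euclidean_space \<Rightarrow> complex) \<Rightarrow> 'a \<Rightarrow> complex" where
  "fourier f \<omega> = complex_of_real ((2 * pi) powr (- real DIM('a) / 2)) *
     (LINT x|lborel. f x * exp (- (\<i> * complex_of_real (x \<bullet> \<omega>))))"

definition L2 :: "('a::euclidean_space \<Rightarrow> complex) set" where
  "L2 = {f \<in> borel_measurable lborel. integrable lborel (\<lambda>x. (norm (f x))\<^sup>2)}"

text \<open>The extension to square integrable functions: continuous extension in the
  \<open>L\<^sup>2\<close>-norm from the dense subspace \<open>L\<^sup>1 \<inter> L\<^sup>2\<close>.
  Convergence is expressed with the nonnegative integral, so that no integrability of the
  differences is presupposed.\<close>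

definition has_fourier_L2 ::
    "('a::euclidean_space \<Rightarrow> complex) \<Rightarrow> ('a \<Rightarrow> complex) \<Rightarrow> bool" where
  "has_fourier_L2 f g \<longleftrightarrow> f \<in> L2 \<and> g \<in> L2 \<and>
     (\<exists>h. (\<forall>n::nat. h n \<in> L2 \<and> integrable lborel (h n)) \<and>
       (\<lambda>n. \<integral>\<^sup>+x. ennreal ((norm (h n x - f x))\<^sup>2) \<partial>lborel) \<longlonglongrightarrow> 0 \<and>
       (\<lambda>n. \<integral>\<^sup>+\<omega>. ennreal ((norm (fourier (h n) \<omega> - g \<omega>))\<^sup>2) \<partial>lborel) \<longlonglongrightarrow> 0)"

text \<open>By Plancherel's theorem such a \<open>g\<close> exists for every \<open>f \<in> L2\<close> and is unique up to
  null sets; \<open>fourier_L2 f\<close> is a representative.\<close>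

definition fourier_L2 :: "('a::euclidean_space \<Rightarrow> complex) \<Rightarrow> 'a \<Rightarrow> complex" where
  "fourier_L2 f = (SOME g. has_fourier_L2 f g)"

definition sobolev_space :: "real \<Rightarrow> ('a::euclidean_space \<Rightarrow> complex) set" where
  "sobolev_space s = {w \<in> L2.
     integrable lborel (\<lambda>\<omega>. (1 + (norm \<omega>)\<^sup>2) powr s * (norm (fourier_L2 w \<omega>))\<^sup>2)}"

definition sobolev_norm :: "real \<Rightarrow> ('a::euclidean_space \<Rightarrow> complex) \<Rightarrow> real" where
  "sobolev_norm s w = sqrt ((2 * pi) powr (- real DIM('a) / 2) *
     (LINT \<omega>|lborel. (1 + (norm \<omega>)\<^sup>2) powr s * (norm (fourier_L2 w \<omega>))\<^sup>2))"

text \<open>Functions are representatives of \<open>L\<^sup>2\<close>-classes, hence \<open>w|\<^sub>\<Omega> = v\<close> means equality almost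
  everywhere on \<open>\<Omega>\<close>.\<close>

definition sobolev_extensions ::
    "'a::euclidean_space set \<Rightarrow> real \<Rightarrow> ('a \<Rightarrow> complex) \<Rightarrow> ('a \<Rightarrow> complex) set" where
  "sobolev_extensions \<Omega> s v =
     {w \<in> sobolev_space s. AE x in lborel. x \<in> \<Omega> \<longrightarrow> w x = v x}"

definition sobolev_space_on :: "'a::euclidean_space set \<Rightarrow> real \<Rightarrow> ('a \<Rightarrow> complex) set" where
  "sobolev_space_on \<Omega> s = {v. sobolev_extensions \<Omega> s v \<noteq> {}}"

text \<open>Only meaningful for \<open>v \<in> sobolev_space_on \<Omega> s\<close>, as the infimum is taken in the reals.\<close>

definition sobolev_norm_on :: "'a::euclidean_space set \<Rightarrow> real \<Rightarrow> ('a \<Rightarrow> complex) \<Rightarrow> real" where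
  "sobolev_norm_on \<Omega> s v = (INF w\<in>sobolev_extensions \<Omega> s v. sobolev_norm s w)"

definition L2_norm_on :: "'a::euclidean_space set \<Rightarrow> ('a \<Rightarrow> complex) \<Rightarrow> real" where
  "L2_norm_on \<Omega> v = sqrt (LINT x:\<Omega>|lborel. (norm (v x))\<^sup>2)"

text \<open>Near each boundary point, \<open>\<Omega>\<close> is the part lying strictly above the graph of a Lipschitz
  function, in a Cartesian coordinate system whose last axis is the unit vector \<open>e\<close>.
  The first coordinates of \<open>y\<close> are represented by its projection \<open>y - (y \<bullet> e) e\<close> onto the
  hyperplane orthogonal to \<open>e\<close>, which also makes sense in dimension one.\<close>

definition lipschitz_boundary :: "'a::euclidean_space set \<Rightarrow> bool" where
  "lipschitz_boundary \<Omega> \<longleftrightarrow>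
     (\<forall>p\<in>frontier \<Omega>. \<exists>r>0. \<exists>e L. \<exists>\<gamma> :: 'a \<Rightarrow> real.
        norm e = 1 \<and> L-lipschitz_on {z. z \<bullet> e = 0} \<gamma> \<and>
        \<Omega> \<inter> ball p r = {y \<in> ball p r. y \<bullet> e > \<gamma> (y - (y \<bullet> e) *\<^sub>R e)})"

definition bounded_lipschitz_domain :: "'a::euclidean_space set \<Rightarrow> bool" where
  "bounded_lipschitz_domain \<Omega> \<longleftrightarrow>
     \<Omega> \<noteq> {} \<and> open \<Omega> \<and> connected \<Omega> \<and> bounded \<Omega> \<and> lipschitz_boundary \<Omega>"

definition strictly_positive_definite :: "('a::euclidean_space \<Rightarrow> real) \<Rightarrow> bool" where
  "strictly_positive_definite \<Phi> \<longleftrightarrow>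
     (\<forall>X (\<alpha> :: 'a \<Rightarrow> real). finite X \<longrightarrow> (\<exists>x\<in>X. \<alpha> x \<noteq> 0) \<longrightarrow>
        (\<Sum>x\<in>X. \<Sum>y\<in>X. \<alpha> x * \<alpha> y * \<Phi> (x - y)) > 0)"

definition scaled_kernel :: "real \<Rightarrow> ('a::euclidean_space \<Rightarrow> real) \<Rightarrow> 'a \<Rightarrow> real" where
  "scaled_kernel \<delta> \<Phi> x = \<Phi> (x /\<^sub>R \<delta>) / \<delta> ^ DIM('a)"

definition separation_distance :: "'a::euclidean_space set \<Rightarrow> real" where
  "separation_distance X = Min {norm (x - y) | x y. x \<in> X \<and> y \<in> X \<and> x \<noteq> y} / 2"

text \<open>\<open>module.span\<close> is the span with respect to an explicit scalar multiplication, here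
  the pointwise one on real-valued functions.\<close>

definition trial_space :: "('a::euclidean_space \<Rightarrow> real) \<Rightarrow> 'a set \<Rightarrow> ('a \<Rightarrow> real) set" where
  "trial_space \<Psi> X =
     module.span (\<lambda>(c::real) f x. c * f x) ((\<lambda>y x. \<Psi> (x - y)) ` X)"

end

theory Submission
  imports Defs "HOL-Probability.Characteristic_Functions" "HOL-Probability.Sinc_Integral"
begin

text \<open>
  Write \<open>v = (\<Sum>y\<in>X. \<alpha> y * \<Phi>\<^sub>\<delta> (\<cdot> - y))\<close> and let \<open>q\<close> be the separation distance of \<open>X\<close>. Then
  \<open>v\<close> has the transform \<open>\<Phi>^(\<delta> \<omega>) A(\<omega>)\<close>, where \<open>A\<close> is the exponential sum with frequencies \<open>X\<close> and
  coefficients \<open>\<alpha>\<close>. The proof is governed by the squared seminorm \<open>energy \<sigma> v\<close>, the integral of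
  \<open>|v^|\<^sup>2 |\<omega>|\<^bsup>2\<sigma>\<^esup>\<close>, and by differences \<open>\<Delta>\<^sub>h = fdiff m h\<close> of an order \<open>m \<ge> \<sigma>\<close>: they satisfy
  \<open>v x = \<Delta>\<^sub>h v x - (a combination of v (x + h), \<dots>, v (x + m h))\<close>, and the square of \<open>\<Delta>\<^sub>h v\<close> has an
  integral of at most \<open>C |h|\<^bsup>2\<sigma>\<^esup>\<close> times the energy. Since the step \<open>h\<close> can be chosen inside a cone that points into
  \<open>\<Omega>\<close>, values of \<open>v\<close> at or near the boundary are controlled by values in \<open>\<Omega>\<close> and the energy.

  Step 1, samples control the energy (\<open>energy_le_samples\<close>). Exponential sums with
  \<open>q\<close>-separated frequencies are almost orthogonal with respect to the weights
  \<open>(1 + q\<^sup>2 |\<omega>|\<^sup>2)\<^bsup>-\<sigma>\<^esup>\<close> (\<open>sum_le_integral_expsum\<close>, \<open>integral_expsum_le_sum\<close>). The lower estimate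
  bounds \<open>\<Sum>\<alpha>\<^sup>2\<close> by the squared native space norm of \<open>v\<close>, which equals \<open>\<Sum>x\<in>X. \<alpha> x * v x\<close> up to
  a constant; so that norm is bounded by the samples of \<open>v\<close> on \<open>X\<close>, and the
  powers of \<open>\<delta>\<close> cancel: \<open>energy \<sigma> v \<le> C q\<^bsup>d - 2\<sigma>\<^esup> (\<Sum>x\<in>X. v(x)\<^sup>2)\<close>.

  Step 2, the case \<open>\<tau> = \<sigma>\<close> (\<open>energy_le_mass\<close>). Averaging the difference identity at the points
  of \<open>X\<close> over steps of size \<open>\<rho> = \<epsilon> q\<close> in a cone gives
  \<open>(\<Sum>x\<in>X. v(x)\<^sup>2) \<le> C (\<rho>\<^bsup>2\<sigma> - d\<^esup> energy \<sigma> v + \<rho>\<^bsup>-d\<^esup> \<integral>\<^sub>\<Omega> v\<^sup>2)\<close> (\<open>sampling_in_cones\<close>).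
  Inserted into Step 1, the energy comes with the factor \<open>C \<epsilon>\<^bsup>2\<sigma> - d\<^esup>\<close>, and \<open>\<sigma> > d/2\<close> lets a
  small \<open>\<epsilon>\<close> absorb it. The result is \<open>energy \<sigma> v \<le> C q\<^bsup>-2\<sigma>\<^esup> \<integral>\<^sub>\<Omega> v\<^sup>2\<close>.

  Step 3, all \<open>\<tau>\<close>. The same difference identity bounds \<open>\<integral>\<^sub>S v\<^sup>2\<close> by \<open>C \<integral>\<^sub>\<Omega> v\<^sup>2\<close> for a neighbourhood
  \<open>S\<close> of \<open>\<Omega>\<close> of width comparable to \<open>q\<close> (\<open>mass_on_neighbourhood\<close>). If \<open>K\<close> is a compactly supported
  mollifier of high order at scale \<open>q\<close>, then \<open>w = v - K * (v 1\<^bsub>-S\<^esub>)\<close> agrees with \<open>v\<close> on \<open>\<Omega>\<close>, and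
  its transform is \<open>(1 - K^) v^ + K^ (v 1\<^sub>S)^\<close>. Here \<open>1 - K^\<close> vanishes to high order at the origin, so
  that the first term is controlled by the energy, and \<open>K^\<close> decays at the scale \<open>1/q\<close>, so that the
  second is controlled by \<open>\<integral>\<^sub>S v\<^sup>2\<close> (\<open>local_extension\<close>). Hence \<open>w\<close> is an extension with
  \<open>H\<^bsup>\<tau>\<^esup>\<close>-norm at most \<open>C q\<^bsup>-\<tau>\<^esup>\<close> times the norm of \<open>v\<close> in \<open>L\<^sup>2(\<Omega>)\<close>.

  All functions that occur are in \<open>L\<^sup>1 \<inter> L\<^sup>2\<close>; there, Fourier inversion and Plancherel's theorem
  follow from summation with Gaussian damping (\<open>damped_inversion\<close>, \<open>gauss_delta_limit\<close>).
\<close>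

section \<open>Integration over Euclidean space\<close>

lemma
  fixes f :: "'a::euclidean_space \<Rightarrow> 'b::{banach, second_countable_topology}"
  assumes c: "c \<noteq> 0"
  shows integrable_lborel_affine_iff: "integrable lborel (\<lambda>x. f (t + c *\<^sub>R x)) \<longleftrightarrow> integrable lborel f"
    and integral_lborel_affine: "(LINT x|lborel. f (t + c *\<^sub>R x)) = (LINT x|lborel. f x) /\<^sub>R \<bar>c\<bar> ^ DIM('a)"
proof -
  have imp: "integrable lborel (\<lambda>x. f (t + c *\<^sub>R x)) \<and>
      (LINT x|lborel. f (t + c *\<^sub>R x)) = (LINT x|lborel. f x) /\<^sub>R \<bar>c\<bar> ^ DIM('a)"
    if f: "integrable lborel f" and c: "c \<noteq> 0" for f :: "'a \<Rightarrow> 'b" and c t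
  proof -
    have [measurable]: "f \<in> borel_measurable borel"
      using borel_measurable_integrable[OF f] by simp
    have i: "integrable (density (distr lborel borel (\<lambda>x. t + c *\<^sub>R x)) (\<lambda>_. \<bar>c\<bar> ^ DIM('a))) f"
      using f lborel_affine[OF c, of t] by simp
    have "integrable lborel (\<lambda>x. (\<bar>c\<bar> ^ DIM('a)) *\<^sub>R f (t + c *\<^sub>R x))"
      using i c by (subst (asm) integrable_density) (auto simp: integrable_distr_eq)
    from integrable_scaleR_right[OF this, of "1 / \<bar>c\<bar> ^ DIM('a)"]
    have 1: "integrable lborel (\<lambda>x. f (t + c *\<^sub>R x))"
      using c by simp
    have "(LINT x|lborel. f x) = (LINT x|density (distr lborel borel (\<lambda>x. t + c *\<^sub>R x)) (\<lambda>_. \<bar>c\<bar> ^ DIM('a)). f x)"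
      using lborel_affine[OF c, of t] by simp
    also have "\<dots> = (\<bar>c\<bar> ^ DIM('a)) *\<^sub>R (LINT x|lborel. f (t + c *\<^sub>R x))"
      by (subst integral_density) (auto simp: integral_distr)
    finally show ?thesis using 1 c by simp
  qed
  have iff: "integrable lborel (\<lambda>x. f (t + c *\<^sub>R x)) \<longleftrightarrow> integrable lborel f"
  proof
    assume a: "integrable lborel (\<lambda>x. f (t + c *\<^sub>R x))"
    have "integrable lborel (\<lambda>x. f (t + c *\<^sub>R (- (t /\<^sub>R c) + (1/c) *\<^sub>R x)))"
      using imp[OF a, of "1/c" "- (t /\<^sub>R c)"] c by simp
    then show "integrable lborel f"
      using c by (simp add: algebra_simps)
  qed (use imp c in blast)
  show "integrable lborel (\<lambda>x. f (t + c *\<^sub>R x)) \<longleftrightarrow> integrable lborel f" by (rule iff)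
  show "(LINT x|lborel. f (t + c *\<^sub>R x)) = (LINT x|lborel. f x) /\<^sub>R \<bar>c\<bar> ^ DIM('a)"
    using imp[of f c t] iff c by (cases "integrable lborel f") (auto simp: not_integrable_integral_eq)
qed

lemma
  fixes f :: "'a::euclidean_space \<Rightarrow> 'b::{banach, second_countable_topology}"
  shows integrable_lborel_shift_iff: "integrable lborel (\<lambda>x. f (x + t)) \<longleftrightarrow> integrable lborel f"
    and integral_lborel_shift: "(LINT x|lborel. f (x + t)) = (LINT x|lborel. f x)"
    and integrable_lborel_reflect_iff: "integrable lborel (\<lambda>x. f (t - x)) \<longleftrightarrow> integrable lborel f"
    and integral_lborel_reflect: "(LINT x|lborel. f (t - x)) = (LINT x|lborel. f x)"
  using integrable_lborel_affine_iff[of 1 f t] integral_lborel_affine[of 1 f t]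
    integrable_lborel_affine_iff[of "-1" f t] integral_lborel_affine[of "-1" f t]
  by (simp_all add: add.commute)

lemma
  fixes f :: "'a::euclidean_space \<Rightarrow> real \<Rightarrow> 'b::{real_normed_field, banach, second_countable_topology}"
  assumes f: "\<And>b. b \<in> Basis \<Longrightarrow> integrable lborel (f b)"
  shows integrable_lborel_prod: "integrable lborel (\<lambda>x. \<Prod>b\<in>Basis. f b (x \<bullet> b))"
    and integral_lborel_prod: "(LINT x|lborel. (\<Prod>b\<in>Basis. f b (x \<bullet> b))) = (\<Prod>b\<in>Basis. (LINT t|lborel. f b t))"
proof -
  interpret p: product_sigma_finite "\<lambda>_::'a. lborel :: real measure"
    by standard
  have [measurable]: "f b \<in> borel_measurable borel" if "b \<in> Basis" for b
    using borel_measurable_integrable[OF f[OF that]] by simp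
  have eq: "(\<Prod>b\<in>Basis. f b ((\<Sum>b\<in>Basis. g b *\<^sub>R b) \<bullet> b)) = (\<Prod>b\<in>Basis. f b (g b))" for g
    by (rule prod.cong) (simp_all add: inner_sum_left inner_Basis if_distrib cong: if_cong)
  have m: "(\<lambda>x. \<Prod>b\<in>Basis. f b (x \<bullet> b)) \<in> borel_measurable borel"
    by measurable
  show "integrable lborel (\<lambda>x. \<Prod>b\<in>Basis. f b (x \<bullet> b))"
    by (subst lborel_eq, subst integrable_distr_eq)
       (use m p.product_integrable_prod[of Basis f] f in \<open>simp_all add: eq\<close>)
  show "(LINT x|lborel. (\<Prod>b\<in>Basis. f b (x \<bullet> b))) = (\<Prod>b\<in>Basis. (LINT t|lborel. f b t))"
    by (subst lborel_eq, subst integral_distr)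
       (use m p.product_integral_prod[of Basis f] f in \<open>simp_all add: eq\<close>)
qed

section \<open>Fourier integrals\<close>

definition wave :: "'a::euclidean_space \<Rightarrow> 'a \<Rightarrow> complex" where
  "wave \<omega> x = exp (- (\<i> * complex_of_real (x \<bullet> \<omega>)))"

lemma wave_measurable [measurable (raw)]:
  "f \<in> borel_measurable M \<Longrightarrow> g \<in> borel_measurable M \<Longrightarrow> (\<lambda>x. wave (f x) (g x)) \<in> borel_measurable M"
  unfolding wave_def by measurable

text \<open>The unnormalised transform. Without the factor \<open>(2\<pi>)\<^bsup>-d/2\<^esup>\<close> convolutions become products and
  probability densities have value \<open>1\<close> at the origin.\<close>

definition ft :: "('a::euclidean_space \<Rightarrow> complex) \<Rightarrow> 'a \<Rightarrow> complex" where
  "ft f \<omega> = (LINT x|lborel. f x * wave \<omega> x)"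

lemma fourier_eq_ft: "fourier (f::'a::euclidean_space \<Rightarrow> complex) \<omega> = complex_of_real ((2 * pi) powr (- real DIM('a) / 2)) * ft f \<omega>"
  by (simp add: fourier_def ft_def wave_def)

lemma norm_wave [simp]: "norm (wave \<omega> x) = 1"
  by (simp add: wave_def norm_exp_eq_Re)

lemma wave_mult: "wave \<omega> x * wave \<omega> y = wave \<omega> (x + y)"
  by (simp add: wave_def exp_add[symmetric] inner_add_left algebra_simps)

lemma wave_0 [simp]: "wave 0 x = 1" "wave \<omega> 0 = 1"
  by (simp_all add: wave_def)

lemma wave_scaleR: "wave (c *\<^sub>R \<omega>) x = wave \<omega> (c *\<^sub>R x)"
  by (simp add: wave_def)

lemma cnj_wave: "cnj (wave \<omega> x) = wave \<omega> (- x)" "cnj (wave \<omega> x) = wave (- \<omega>) x"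
  by (simp_all add: wave_def exp_cnj)

lemma integrable_mult_wave [simp]:
  fixes f :: "'a::euclidean_space \<Rightarrow> complex"
  shows "integrable lborel (\<lambda>x. f x * wave \<omega> x) \<longleftrightarrow> integrable lborel f"
proof
  assume f: "integrable lborel f"
  then have [measurable]: "f \<in> borel_measurable borel"
    using borel_measurable_integrable[OF f] by simp
  show "integrable lborel (\<lambda>x. f x * wave \<omega> x)"
    by (rule Bochner_Integration.integrable_bound[OF f]) (auto simp: norm_mult)
next
  assume f: "integrable lborel (\<lambda>x. f x * wave \<omega> x)"
  then have [measurable]: "(\<lambda>x. f x * wave \<omega> x) \<in> borel_measurable borel"
    using borel_measurable_integrable[OF f] by simp
  have eq: "f = (\<lambda>x. (f x * wave \<omega> x) * wave \<omega> (-x))"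
    by (simp only: mult.assoc wave_mult) simp
  have "(\<lambda>x. (f x * wave \<omega> x) * wave \<omega> (-x)) \<in> borel_measurable borel"
    by measurable
  then have [measurable]: "f \<in> borel_measurable borel" using eq by simp
  show "integrable lborel f"
    by (rule Bochner_Integration.integrable_bound[OF f]) (auto simp: norm_mult)
qed

lemma ft_measurable [measurable]:
  fixes f :: "'a::euclidean_space \<Rightarrow> complex"
  assumes [measurable]: "f \<in> borel_measurable borel"
  shows "ft f \<in> borel_measurable borel"
proof -
  have "(\<lambda>\<omega>. LINT x|lborel. f x * wave \<omega> x) \<in> borel_measurable borel"
    by measurable
  then show ?thesis by (simp add: ft_def[abs_def])
qed

lemma norm_ft_le:
  "norm (ft f \<omega>) \<le> (LINT x|lborel. norm (f x))"
  unfolding ft_def using integral_norm_bound[of lborel "\<lambda>x. f x * wave \<omega> x"] by (simp add: norm_mult)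

lemma ft_diff: "integrable lborel f \<Longrightarrow> integrable lborel g \<Longrightarrow> ft (\<lambda>x. f x - g x) \<omega> = ft f \<omega> - ft g \<omega>"
  by (simp add: ft_def ring_distribs)

lemma ft_cmult: "ft (\<lambda>x. c * f x) \<omega> = c * ft f \<omega>"
  by (simp add: ft_def mult.assoc)

lemma ft_sum:
  "(\<And>i. i \<in> I \<Longrightarrow> integrable lborel (f i)) \<Longrightarrow> ft (\<lambda>x. \<Sum>i\<in>I. f i x) \<omega> = (\<Sum>i\<in>I. ft (f i) \<omega>)"
  by (simp add: ft_def sum_distrib_right)

lemma ft_shift: "ft (\<lambda>x. f (x + h)) \<omega> = wave \<omega> (- h) * ft f \<omega>"
proof -
  have "ft (\<lambda>x. f (x + h)) \<omega> = (LINT x|lborel. (\<lambda>x. wave \<omega> (-h) * (f x * wave \<omega> x)) (x + h))"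
    unfolding ft_def
    by (intro Bochner_Integration.integral_cong refl)
       (simp add: mult.left_commute[of "wave \<omega> (-h)" for h] wave_mult)
  also have "\<dots> = wave \<omega> (- h) * ft f \<omega>"
    by (subst integral_lborel_shift) (simp add: ft_def)
  finally show ?thesis .
qed

lemma ft_scale:
  fixes f :: "'a::euclidean_space \<Rightarrow> complex"
  assumes c: "c > 0"
  shows "ft (\<lambda>x. f (x /\<^sub>R c) / complex_of_real (c ^ DIM('a))) \<omega> = ft f (c *\<^sub>R \<omega>)"
proof -
  have "ft (\<lambda>x. f (x /\<^sub>R c) / complex_of_real (c ^ DIM('a))) \<omega> =
     (LINT x|lborel. (\<lambda>x. f x * wave (c *\<^sub>R \<omega>) x / complex_of_real (c ^ DIM('a))) (0 + (1/c) *\<^sub>R x))"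
    unfolding ft_def using c
    by (intro Bochner_Integration.integral_cong refl) (simp add: divide_inverse mult_ac wave_scaleR)
  also have "\<dots> = ft f (c *\<^sub>R \<omega>)"
    using c by (subst integral_lborel_affine) (auto simp: ft_def scaleR_conv_of_real power_divide)
  finally show ?thesis .
qed

lemma ft_cnj_reflect: "ft (\<lambda>x. cnj (f (- x))) \<omega> = cnj (ft f \<omega>)"
proof -
  have "ft (\<lambda>x. cnj (f (- x))) \<omega> = (LINT x|lborel. (\<lambda>x. cnj (f x * wave \<omega> x)) (0 - x))"
    unfolding ft_def by (intro Bochner_Integration.integral_cong refl) (simp add: cnj_wave(1))
  also have "\<dots> = cnj (ft f \<omega>)"
    by (subst integral_lborel_reflect) (simp add: ft_def del: complex_cnj_mult)
  finally show ?thesis .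
qed

definition conv :: "('a::euclidean_space \<Rightarrow> complex) \<Rightarrow> ('a \<Rightarrow> complex) \<Rightarrow> 'a \<Rightarrow> complex" where
  "conv f g x = (LINT u|lborel. f u * g (x - u))"

lemma conv_measurable [measurable]:
  assumes [measurable]: "f \<in> borel_measurable borel" "g \<in> borel_measurable borel"
  shows "conv f g \<in> borel_measurable borel"
proof -
  have "(\<lambda>x. LINT u|lborel. f u * g (x - u)) \<in> borel_measurable borel"
    by measurable
  then show ?thesis by (simp add: conv_def[abs_def])
qed

text \<open>Both statements are Fubini's theorem for \<open>f(u) g(x - u)\<close>, in the second case multiplied by a
  unimodular factor; the auxiliary fact \<open>i\<close> covers both.\<close>

lemma
  fixes f g :: "'a::euclidean_space \<Rightarrow> complex"
  assumes f: "integrable lborel f" and g: "integrable lborel g"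
  shows integrable_conv: "integrable lborel (conv f g)"
    and ft_conv: "ft (conv f g) \<omega> = ft f \<omega> * ft g \<omega>"
proof -
  have [measurable]: "f \<in> borel_measurable borel" "g \<in> borel_measurable borel"
    using f g borel_measurable_integrable by auto
  have i: "integrable (lborel \<Otimes>\<^sub>M lborel) (\<lambda>(u, x). f u * h u x * g (x - u))"
    if [measurable]: "(\<lambda>(u, x). h u x) \<in> borel_measurable (borel \<Otimes>\<^sub>M borel)" and h: "\<And>u x. norm (h u x) = 1"
    for h :: "'a \<Rightarrow> 'a \<Rightarrow> complex"
  proof (rule lborel_pair.Fubini_integrable)
    show "(\<lambda>(u, x). f u * h u x * g (x - u)) \<in> borel_measurable (lborel \<Otimes>\<^sub>M lborel)"
      by measurable
    have "(LINT x|lborel. norm (f u * h u x * g (x - u))) = norm (f u) * (LINT x|lborel. norm (g x))" for u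
      using integral_lborel_shift[of "\<lambda>x. norm (g x)" "-u"] by (simp add: norm_mult h)
    then show "integrable lborel (\<lambda>u. LINT x|lborel. norm (case (u, x) of (u, x) \<Rightarrow> f u * h u x * g (x - u)))"
      using f by simp
    show "AE u in lborel. integrable lborel (\<lambda>x. case (u, x) of (u, x) \<Rightarrow> f u * h u x * g (x - u))"
    proof (rule AE_I2)
      fix u :: 'a
      have "integrable lborel (\<lambda>x. norm (f u) * norm (g (x - u)))"
        using integrable_lborel_shift_iff[of g "-u"] g by simp
      then show "integrable lborel (\<lambda>x. case (u, x) of (u, x) \<Rightarrow> f u * h u x * g (x - u))"
        by (rule Bochner_Integration.integrable_bound) (auto simp: norm_mult h)
    qed
  qed
  have "integrable lborel (\<lambda>x. LINT u|lborel. f u * 1 * g (x - u))"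
    by (rule lborel_pair.integrable_snd[of "\<lambda>u x. f u * 1 * g (x - u)"]) (rule i, auto)
  then show "integrable lborel (conv f g)"
    by (simp add: conv_def[abs_def])
  have "ft (conv f g) \<omega> = (LINT x|lborel. LINT u|lborel. f u * wave \<omega> x * g (x - u))"
    unfolding ft_def conv_def
    by (intro Bochner_Integration.integral_cong refl, subst integral_mult_left_zero[symmetric]) (simp add: mult_ac)
  also have "\<dots> = (LINT u|lborel. LINT x|lborel. f u * wave \<omega> x * g (x - u))"
    by (rule lborel_pair.Fubini_integral) (rule i, auto)
  also have "\<dots> = (LINT u|lborel. f u * ft (\<lambda>x. g (x + (-u))) \<omega>)"
    by (simp add: ft_def mult.assoc mult.commute[of "wave \<omega> x" for x])
  also have "\<dots> = (LINT u|lborel. f u * wave \<omega> u * ft g \<omega>)"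
    by (subst ft_shift) (simp add: mult.assoc)
  also have "\<dots> = ft f \<omega> * ft g \<omega>"
    by (simp add: ft_def)
  finally show "ft (conv f g) \<omega> = ft f \<omega> * ft g \<omega>" .
qed

section \<open>Gaussian summability\<close>

text \<open>The form in which integrations in space and in frequency are exchanged below: \<open>k\<close> is a wave,
  \<open>f\<close> lives in space and \<open>g\<close> in frequency.\<close>

lemma Fubini_bounded_kernel:
  fixes f g :: "'a::euclidean_space \<Rightarrow> complex"
  assumes f: "integrable lborel f" and g: "integrable lborel g"
    and k[measurable]: "(\<lambda>(y, x). k y x) \<in> borel_measurable (borel \<Otimes>\<^sub>M borel)" and le: "\<And>x y. norm (k y x) \<le> 1"
  shows "(LINT x|lborel. LINT y|lborel. f y * k y x * g x) = (LINT y|lborel. LINT x|lborel. f y * k y x * g x)"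
proof -
  have [measurable]: "f \<in> borel_measurable borel" "g \<in> borel_measurable borel"
    using f g borel_measurable_integrable by auto
  have le': "norm (f y * k y x * g x) \<le> norm (f y) * norm (g x)" for x y
    using mult_right_mono[OF mult_left_mono[OF le norm_ge_zero], of "norm (g x)" "f y" y x] by (simp add: norm_mult)
  have "integrable (lborel \<Otimes>\<^sub>M lborel) (\<lambda>(y, x). norm (f y) * norm (g x))"
  proof (rule lborel_pair.Fubini_integrable)
    show "(\<lambda>(y, x). norm (f y) * norm (g x)) \<in> borel_measurable (lborel \<Otimes>\<^sub>M lborel)" by measurable
  qed (use f g in \<open>auto simp: abs_mult\<close>)
  then have "integrable (lborel \<Otimes>\<^sub>M lborel) (\<lambda>(y, x). f y * k y x * g x)"
    by (rule Bochner_Integration.integrable_bound) (auto intro!: AE_I2 le')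
  then show "(LINT x|lborel. LINT y|lborel. f y * k y x * g x) = (LINT y|lborel. LINT x|lborel. f y * k y x * g x)"
    by (rule lborel_pair.Fubini_integral)
qed

lemma wave_commute: "wave \<omega> x = wave x \<omega>"
  by (simp add: wave_def inner_commute)

definition gauss :: "'a::euclidean_space \<Rightarrow> real" where
  "gauss x = (2 * pi) powr (- real DIM('a) / 2) * exp (- (norm x)\<^sup>2 / 2)"

lemma gauss_measurable [measurable]: "gauss \<in> borel_measurable borel"
  unfolding gauss_def[abs_def] by measurable

lemma gauss_nonneg [simp]: "gauss x \<ge> 0"
  by (simp add: gauss_def)

lemma gauss_eq_prod: "gauss (x::'a::euclidean_space) = (\<Prod>b\<in>Basis. std_normal_density (x \<bullet> b))"
proof -
  have "(\<Prod>b\<in>(Basis::'a set). std_normal_density (x \<bullet> b))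
      = (1 / sqrt (2 * pi)) ^ DIM('a) * exp (- (\<Sum>b\<in>Basis. (x \<bullet> b)\<^sup>2) / 2)"
    unfolding std_normal_density_def prod.distrib prod_constant exp_sum[OF finite_Basis, symmetric]
    by (simp add: sum_negf sum_divide_distrib)
  also have "(\<Sum>b\<in>Basis. (x \<bullet> b)\<^sup>2) = (norm x)\<^sup>2"
    by (subst power2_norm_eq_inner, subst euclidean_inner) (simp add: power2_eq_square)
  also have "(1 / sqrt (2 * pi)) ^ DIM('a) = (2 * pi) powr (- real DIM('a) / 2)"
  proof -
    have "(1 / sqrt (2 * pi)) ^ DIM('a) = ((2 * pi) powr (-1/2)) powr (real DIM('a))"
      by (subst powr_realpow) (auto simp: powr_minus_divide powr_half_sqrt)
    then show ?thesis by (simp only: powr_powr) simp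
  qed
  finally show ?thesis by (simp add: gauss_def)
qed

lemma gauss_le: "gauss x \<le> exp (- (norm x)\<^sup>2 / 2)"
  using powr_mono[of "- real DIM('a) / 2" 0 "2 * pi"] pi_ge_two
  by (simp add: gauss_def mult_left_le_one_le del: powr_mult)

lemma integrable_gauss: "integrable lborel (gauss :: 'a::euclidean_space \<Rightarrow> real)"
  using integrable_lborel_prod[of "\<lambda>_::'a. std_normal_density"]
  by (simp add: gauss_eq_prod[abs_def])

lemma integral_gauss: "(LINT x|lborel. gauss (x::'a::euclidean_space)) = 1"
  using integral_lborel_prod[of "\<lambda>_::'a. std_normal_density"]
  by (simp add: gauss_eq_prod[abs_def])

lemma ft_gauss: "ft (\<lambda>x. complex_of_real (gauss x)) (\<omega>::'a::euclidean_space) = complex_of_real (exp (- (norm \<omega>)\<^sup>2 / 2))"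
proof -
  have 1: "(LINT t|lborel. complex_of_real (std_normal_density t) * exp (- (\<i> * complex_of_real (t * c))))
      = complex_of_real (exp (- c\<^sup>2 / 2))" for c
  proof -
    have "char std_normal_distribution (- c) = (LINT t|density lborel std_normal_density. iexp (- c * t))"
      by (simp add: char_def)
    also have "\<dots> = (LINT t|lborel. std_normal_density t *\<^sub>R iexp (- c * t))"
      by (subst integral_density) auto
    finally show ?thesis
      by (simp add: char_std_normal_distribution scaleR_conv_of_real mult_ac)
  qed
  have int: "integrable lborel (\<lambda>t. complex_of_real (std_normal_density t) * exp (- (\<i> * complex_of_real (t * c))))" for c
    by (rule Bochner_Integration.integrable_bound[OF integrable_normal_moment[of 1 0 0]])
       (auto simp: norm_mult norm_exp_eq_Re)
  have "ft (\<lambda>x. complex_of_real (gauss x)) \<omega> = (LINT x|lborel. (\<Prod>b\<in>Basis.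
      complex_of_real (std_normal_density (x \<bullet> b)) * exp (- (\<i> * complex_of_real ((x \<bullet> b) * (\<omega> \<bullet> b))))))"
    unfolding ft_def wave_def
    by (intro Bochner_Integration.integral_cong refl)
       (simp add: gauss_eq_prod prod.distrib exp_sum[symmetric] euclidean_inner[of _ \<omega>] sum_distrib_left sum_negf)
  also have "\<dots> = (\<Prod>b\<in>Basis. complex_of_real (exp (- (\<omega> \<bullet> b)\<^sup>2 / 2)))"
    by (subst integral_lborel_prod[where f = "\<lambda>b t. complex_of_real (std_normal_density t) * exp (- (\<i> * complex_of_real (t * (\<omega> \<bullet> b))))"])
       (simp_all add: int 1 del: of_real_mult of_real_exp)
  also have "\<dots> = complex_of_real (exp (- (\<Sum>b\<in>Basis. (\<omega> \<bullet> b)\<^sup>2) / 2))"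
    unfolding of_real_prod[symmetric] exp_sum[OF finite_Basis, symmetric]
    by (simp add: sum_divide_distrib sum_negf)
  also have "(\<Sum>b\<in>Basis. (\<omega> \<bullet> b)\<^sup>2) = (norm \<omega>)\<^sup>2"
    by (subst power2_norm_eq_inner, subst euclidean_inner) (simp add: power2_eq_square)
  finally show ?thesis .
qed

text \<open>The Gaussian damping factor \<open>exp (- |\<omega>|\<^sup>2 / (2 n\<^sup>2))\<close>, written through \<open>\<omega> /\<^sub>R n\<close> so that it is visibly a
  dilated Gaussian. It increases to \<open>1\<close> as \<open>n\<close> grows.\<close>

definition damp :: "real \<Rightarrow> 'a::euclidean_space \<Rightarrow> real" where
  "damp n \<omega> = exp (- (norm (\<omega> /\<^sub>R n))\<^sup>2 / 2)"

lemma damp_measurable [measurable]: "damp n \<in> borel_measurable borel"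
  unfolding damp_def[abs_def] by measurable

lemma damp_bounds [simp]: "0 \<le> damp n \<omega>" "damp n \<omega> \<le> 1"
  by (auto simp: damp_def)

lemma two_pi_powr_half: "(2 * pi) powr (real d / 2) * (2 * pi) powr (real d / 2) = (2 * pi) ^ d"
proof -
  have "(2 * pi) powr (real d / 2) * (2 * pi) powr (real d / 2) = (2 * pi) powr (real d / 2 + real d / 2)"
    by (rule powr_add[symmetric])
  also have "real d / 2 + real d / 2 = real d" by simp
  also have "(2 * pi) powr real d = (2 * pi) ^ d" by (rule powr_realpow) simp
  finally show ?thesis .
qed

lemma two_pi_powr_half_minus: "(2 * pi) powr (real d / 2) * (2 * pi) powr (- real d / 2) = 1"
proof -
  have "(2 * pi) powr (real d / 2) * (2 * pi) powr (- real d / 2) = (2 * pi) powr (real d / 2 + - real d / 2)"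
    by (rule powr_add[symmetric])
  also have "real d / 2 + - real d / 2 = 0" by simp
  finally show ?thesis by simp
qed

lemma damp_eq_gauss: "damp n (\<omega>::'a::euclidean_space) = (2 * pi) powr (real DIM('a) / 2) * gauss (0 + (1/n) *\<^sub>R \<omega>)"
  unfolding damp_def gauss_def mult.assoc[symmetric] two_pi_powr_half_minus by (simp add: inverse_eq_divide)

lemma integrable_damp:
  assumes "n > 0" shows "integrable lborel (damp n :: 'a::euclidean_space \<Rightarrow> real)"
  unfolding damp_eq_gauss[abs_def] using assms
  by (intro integrable_mult_right) (subst integrable_lborel_affine_iff, auto simp: integrable_gauss)

lemma ft_damp:
  fixes x :: "'a::euclidean_space"
  assumes n: "n > 0"
  shows "ft (\<lambda>\<omega>. complex_of_real (damp n \<omega>)) x = complex_of_real ((2 * pi) ^ DIM('a) * n ^ DIM('a) * gauss (n *\<^sub>R x))"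
proof -
  define c where "c = (2 * pi) powr (real DIM('a) / 2)"
  have feq: "(\<lambda>\<omega>. complex_of_real (damp n \<omega>)) = (\<lambda>\<omega>::'a. complex_of_real (c * n ^ DIM('a)) *
        (complex_of_real (gauss (\<omega> /\<^sub>R n)) / complex_of_real (n ^ DIM('a))))"
  proof (rule ext)
    fix \<omega> :: 'a
    have "damp n \<omega> = c * gauss (\<omega> /\<^sub>R n)"
      unfolding damp_eq_gauss c_def by (simp add: inverse_eq_divide)
    with n show "complex_of_real (damp n \<omega>) = complex_of_real (c * n ^ DIM('a)) *
        (complex_of_real (gauss (\<omega> /\<^sub>R n)) / complex_of_real (n ^ DIM('a)))"
      by simp
  qed
  have "ft (\<lambda>\<omega>. complex_of_real (damp n \<omega>)) x = complex_of_real (c * n ^ DIM('a)) *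
        ft (\<lambda>\<omega>. complex_of_real (gauss (\<omega> /\<^sub>R n)) / complex_of_real (n ^ DIM('a))) x"
    unfolding feq by (rule ft_cmult)
  also have "\<dots> = complex_of_real (c * n ^ DIM('a) * exp (- (norm (n *\<^sub>R x))\<^sup>2 / 2))"
    using ft_scale[OF n, of "\<lambda>x. complex_of_real (gauss x)" x] by (simp add: ft_gauss)
  also have "c * n ^ DIM('a) * exp (- (norm (n *\<^sub>R x))\<^sup>2 / 2)
    = (2 * pi) ^ DIM('a) * n ^ DIM('a) * gauss (n *\<^sub>R x)"
  proof -
    have "c = (2 * pi) ^ DIM('a) * (2 * pi) powr (- real DIM('a) / 2)"
      unfolding two_pi_powr_half[symmetric] mult.assoc two_pi_powr_half_minus c_def by simp
    then show ?thesis by (simp only: gauss_def mult_ac)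
  qed
  finally show ?thesis .
qed

text \<open>Undamped inversion would need \<open>ft f\<close> to be integrable. With the damping factor the order of
  integration can be exchanged for every integrable \<open>f\<close>, and the transform of the factor is a Gaussian
  density of width \<open>1/n\<close> by \<open>ft_damp\<close>.\<close>

lemma damped_inversion:
  fixes f :: "'a::euclidean_space \<Rightarrow> complex"
  assumes f: "integrable lborel f" and n: "n > 0"
  shows "(LINT \<omega>|lborel. ft f \<omega> * wave \<omega> (- x) * complex_of_real (damp n \<omega>))
    = (2 * pi) ^ DIM('a) * (LINT y|lborel. f y * complex_of_real (n ^ DIM('a) * gauss (n *\<^sub>R (y - x))))"
proof -
  have [measurable]: "f \<in> borel_measurable borel"
    using borel_measurable_integrable[OF f] by simp
  have d: "integrable lborel (damp n :: 'a \<Rightarrow> real)" by (rule integrable_damp[OF n])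
  have "(LINT \<omega>|lborel. ft f \<omega> * wave \<omega> (- x) * complex_of_real (damp n \<omega>))
      = (LINT \<omega>|lborel. LINT y|lborel. f y * wave \<omega> (y - x) * complex_of_real (damp n \<omega>))"
    unfolding ft_def
    by (intro Bochner_Integration.integral_cong refl, subst integral_mult_left_zero[symmetric],
        subst integral_mult_left_zero[symmetric]) (simp add: mult.assoc wave_mult)
  also have "\<dots> = (LINT y|lborel. LINT \<omega>|lborel. f y * wave \<omega> (y - x) * complex_of_real (damp n \<omega>))"
  using f d by (intro Fubini_bounded_kernel) auto
  also have "\<dots> = (LINT y|lborel. f y * ft (\<lambda>\<omega>. complex_of_real (damp n \<omega>)) (y - x))"
    unfolding ft_def
    by (intro Bochner_Integration.integral_cong refl, subst integral_mult_right_zero[symmetric])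
       (simp add: mult_ac wave_commute[of "_ - x"])
  also have "\<dots> = (LINT y|lborel. complex_of_real ((2 * pi) ^ DIM('a)) * (f y * complex_of_real (n ^ DIM('a) * gauss (n *\<^sub>R (y - x)))))"
    by (simp add: ft_damp[OF n] mult_ac)
  also have "\<dots> = complex_of_real ((2 * pi) ^ DIM('a)) * (LINT y|lborel. f y * complex_of_real (n ^ DIM('a) * gauss (n *\<^sub>R (y - x))))"
    by (rule integral_mult_right_zero)
  finally show ?thesis by simp
qed

lemma damp_limit: "(\<lambda>n. damp (real (Suc n)) \<omega>) \<longlonglongrightarrow> 1"
proof -
  have "(\<lambda>n. inverse (real (Suc n))) \<longlonglongrightarrow> 0"
    by (rule LIMSEQ_inverse_real_of_nat)
  from tendsto_scaleR[OF this tendsto_const[of \<omega>]]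
  have t: "(\<lambda>n. \<omega> /\<^sub>R real (Suc n)) \<longlonglongrightarrow> 0 *\<^sub>R \<omega>" .
  have "(\<lambda>n. exp (- (norm (\<omega> /\<^sub>R real (Suc n)))\<^sup>2 / 2)) \<longlonglongrightarrow> exp (- (norm (0 *\<^sub>R \<omega>))\<^sup>2 / 2)"
    by (intro tendsto_intros t) auto
  then show ?thesis by (simp add: damp_def)
qed

text \<open>The Gaussian densities concentrate at \<open>x\<close>. Near \<open>x\<close> the function is bounded by continuity, and dominated convergence applies after a dilation (\<open>f1\<close>); away from \<open>x\<close> the densities
  themselves tend to \<open>0\<close> uniformly, and integrability of \<open>f\<close> suffices (\<open>f2\<close>).\<close>

lemma gauss_delta_limit:
  fixes f :: "'a::euclidean_space \<Rightarrow> complex"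
  assumes f: "integrable lborel f" and cont: "isCont f x"
  shows "(\<lambda>n. LINT y|lborel. f y * complex_of_real (real (Suc n) ^ DIM('a) * gauss (real (Suc n) *\<^sub>R (y - x)))) \<longlonglongrightarrow> f x"
proof -
  have [measurable]: "f \<in> borel_measurable borel"
    using borel_measurable_integrable[OF f] by simp
  let ?g = "\<lambda>n y. complex_of_real (real (Suc n) ^ DIM('a) * gauss (real (Suc n) *\<^sub>R (y - x)))"
  obtain \<eta> where \<eta>: "\<eta> > 0" "\<And>y. dist y x < \<eta> \<Longrightarrow> dist (f y) (f x) < 1"
    using cont unfolding continuous_at_eps_delta by (metis zero_less_one)
  define f1 where "f1 y = (if dist y x < \<eta> then f y else 0)" for y
  define f2 where "f2 y = (if dist y x < \<eta> then 0 else f y)" for y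
  have [measurable]: "f1 \<in> borel_measurable borel" "f2 \<in> borel_measurable borel"
    unfolding f1_def[abs_def] f2_def[abs_def] by measurable
  have f1: "integrable lborel f1" and f2: "integrable lborel f2"
    by (auto intro!: Bochner_Integration.integrable_bound[OF f] simp: f1_def f2_def)
  have split: "f y = f1 y + f2 y" for y by (simp add: f1_def f2_def)
  have f1_bound: "norm (f1 y) \<le> norm (f x) + 1" for y
    using \<eta>(2)[of y] norm_triangle_ineq2[of "f y" "f x"] by (auto simp: f1_def dist_norm)
  have c1: "isCont f1 x"
  proof -
    have "\<forall>\<^sub>F y in nhds x. f1 y = f y"
      unfolding eventually_nhds_metric using \<eta>(1) by (auto simp: f1_def)
    with cont show ?thesis by (simp add: isCont_cong)
  qed
  have gb: "gauss z \<le> 1" for z :: 'a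
    using gauss_le[of z] by (rule order_trans) simp
  have ig: "integrable lborel (\<lambda>y. h y * ?g n y)" if h: "integrable lborel h" for h n
  proof -
    have [measurable]: "h \<in> borel_measurable borel"
      using borel_measurable_integrable[OF h] by simp
    have "integrable lborel (\<lambda>y. norm (h y) * real (Suc n) ^ DIM('a))"
      using h by (intro integrable_mult_left integrable_norm)
    then show ?thesis
      by (rule Bochner_Integration.integrable_bound)
         (auto simp: norm_mult norm_power gb mult_left_le intro!: mult_left_mono simp del: of_nat_Suc)
  qed
  have lim1: "(\<lambda>n. LINT y|lborel. f1 y * ?g n y) \<longlonglongrightarrow> f x"
  proof -
    have eq: "(LINT y|lborel. f1 y * ?g n y) = (LINT z|lborel. f1 (x + z /\<^sub>R real (Suc n)) * complex_of_real (gauss z))" for n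
    proof -
      define N where "N = real (Suc n)"
      have N: "N > 0" by (simp add: N_def)
      have "(LINT z|lborel. f1 (x + z /\<^sub>R N) * complex_of_real (N ^ DIM('a) * gauss z)) = N ^ DIM('a) *\<^sub>R (LINT y|lborel. f1 y * complex_of_real (N ^ DIM('a) * gauss (N *\<^sub>R (y - x))))"
        using integral_lborel_affine[of "inverse N" "\<lambda>y. f1 y * complex_of_real (N ^ DIM('a) * gauss (N *\<^sub>R (y - x)))" x] N
        by (simp add: power_inverse)
      moreover have "(LINT z|lborel. f1 (x + z /\<^sub>R N) * complex_of_real (N ^ DIM('a) * gauss z)) = N ^ DIM('a) *\<^sub>R (LINT z|lborel. f1 (x + z /\<^sub>R N) * complex_of_real (gauss z))"
        by (simp add: scaleR_conv_of_real mult.left_commute)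
      ultimately have "(LINT y|lborel. f1 y * complex_of_real (N ^ DIM('a) * gauss (N *\<^sub>R (y - x)))) = (LINT z|lborel. f1 (x + z /\<^sub>R N) * complex_of_real (gauss z))"
        using N by simp
      then show ?thesis by (simp only: N_def)
    qed
    have "(\<lambda>n. LINT z|lborel. f1 (x + z /\<^sub>R real (Suc n)) * complex_of_real (gauss z)) \<longlonglongrightarrow>
        (LINT z|lborel. f x * complex_of_real (gauss (z::'a)))"
    proof (rule integral_dominated_convergence[where w = "\<lambda>z::'a. (norm (f x) + 1) * gauss z"])
      show "integrable lborel (\<lambda>z. (norm (f x) + 1) * gauss (z::'a))"
        by (simp add: integrable_gauss)
      show "AE z in lborel. (\<lambda>n. f1 (x + z /\<^sub>R real (Suc n)) * complex_of_real (gauss z)) \<longlonglongrightarrow> f x * complex_of_real (gauss z)"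
      proof (rule AE_I2)
        fix z :: 'a
        have "(\<lambda>n. x + z /\<^sub>R real (Suc n)) \<longlonglongrightarrow> x + 0 *\<^sub>R z"
          by (intro tendsto_intros LIMSEQ_inverse_real_of_nat)
        then have "(\<lambda>n. f1 (x + z /\<^sub>R real (Suc n))) \<longlonglongrightarrow> f1 x"
          using isCont_tendsto_compose[OF c1] by simp
        then have "(\<lambda>n. f1 (x + z /\<^sub>R real (Suc n))) \<longlonglongrightarrow> f x"
          using \<eta>(1) by (simp add: f1_def)
        then show "(\<lambda>n. f1 (x + z /\<^sub>R real (Suc n)) * complex_of_real (gauss z)) \<longlonglongrightarrow> f x * complex_of_real (gauss z)"
          by (intro tendsto_intros)
      qed
    qed (auto simp: norm_mult intro!: mult_right_mono f1_bound AE_I2)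
    also have "(LINT z|lborel. f x * complex_of_real (gauss (z::'a))) = f x"
      by (simp add: integral_gauss)
    finally show ?thesis unfolding eq .
  qed
  have lim2: "(\<lambda>n. LINT y|lborel. f2 y * ?g n y) \<longlonglongrightarrow> 0"
  proof (rule Lim_null_comparison)
    let ?b = "\<lambda>n. real (Suc n) ^ DIM('a) * exp (- (real (Suc n) * \<eta>)\<^sup>2 / 2)"
    have b: "norm (f2 y * ?g n y) \<le> norm (f y) * ?b n" for y n
    proof (cases "dist y x < \<eta>")
      case False
      have "gauss (real (Suc n) *\<^sub>R (y - x)) \<le> exp (- (norm (real (Suc n) *\<^sub>R (y - x)))\<^sup>2 / 2)"
        by (rule gauss_le)
      also have "\<dots> \<le> exp (- (real (Suc n) * \<eta>)\<^sup>2 / 2)"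
        using False \<eta>(1) by (auto intro!: power_mono mult_left_mono simp: dist_norm simp del: of_nat_Suc)
      finally show ?thesis using False
        by (auto simp: f2_def norm_mult norm_power intro!: mult_left_mono simp del: of_nat_Suc)
    qed (simp add: f2_def)
    have "norm (LINT y|lborel. f2 y * ?g n y) \<le> (LINT y|lborel. norm (f y)) * ?b n" for n
    proof -
      have "norm (LINT y|lborel. f2 y * ?g n y) \<le> (LINT y|lborel. norm (f y) * ?b n)"
        by (rule Bochner_Integration.integral_norm_bound_integral) (use ig[OF f2] f b in auto)
      then show ?thesis by simp
    qed
    then show "\<forall>\<^sub>F n in sequentially. norm (LINT y|lborel. f2 y * ?g n y) \<le> (LINT y|lborel. norm (f y)) * ?b n"
      by simp
    have "?b \<longlonglongrightarrow> 0"
    proof (rule Lim_null_comparison)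
      have "filterlim (\<lambda>n. real (Suc n)) at_top sequentially"
        using filterlim_Suc filterlim_real_sequentially filterlim_compose by blast
      then have "filterlim (\<lambda>n. (\<eta>\<^sup>2/2) * (real (Suc n) ^ 2)) at_top sequentially"
        using \<eta>(1) by (intro filterlim_tendsto_pos_mult_at_top[OF tendsto_const] filterlim_pow_at_top) auto
      from filterlim_compose[OF tendsto_power_div_exp_0[of "DIM('a)"] this]
      show "(\<lambda>n. (2/\<eta>\<^sup>2) ^ DIM('a) * (((\<eta>\<^sup>2/2) * (real (Suc n) ^ 2)) ^ DIM('a) / exp ((\<eta>\<^sup>2/2) * (real (Suc n) ^ 2)))) \<longlonglongrightarrow> 0"
        by (intro tendsto_mult_right_zero)
      have "norm (?b n) \<le> (2/\<eta>\<^sup>2) ^ DIM('a) * (((\<eta>\<^sup>2/2) * (real (Suc n) ^ 2)) ^ DIM('a) / exp ((\<eta>\<^sup>2/2) * (real (Suc n) ^ 2)))" for n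
      proof -
        define N X where "N = real (Suc n)" and "X = (\<eta>\<^sup>2/2) * N\<^sup>2"
        have N: "N \<ge> 1" and NX: "(2/\<eta>\<^sup>2) * X = N\<^sup>2"
          using \<eta>(1) by (auto simp: N_def X_def)
        have e: "- (N * \<eta>)\<^sup>2 / 2 = - X" by (simp add: X_def power_mult_distrib)
        have "N ^ DIM('a) \<le> (N\<^sup>2) ^ DIM('a)"
          using N by (intro power_mono) (auto simp: power2_eq_square)
        then have "N ^ DIM('a) * exp (- X) \<le> ((2/\<eta>\<^sup>2) * X) ^ DIM('a) * exp (- X)"
          unfolding NX by (rule mult_right_mono) simp
        also have "\<dots> = (2/\<eta>\<^sup>2) ^ DIM('a) * (X ^ DIM('a) / exp X)"
          unfolding power_mult_distrib exp_minus by (simp add: field_simps)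
        finally have "norm (N ^ DIM('a) * exp (- (N * \<eta>)\<^sup>2 / 2)) \<le> (2/\<eta>\<^sup>2) ^ DIM('a) * (X ^ DIM('a) / exp X)"
          using N by (simp only: e) (simp add: abs_mult)
        then show ?thesis by (simp only: N_def X_def)
      qed
      then show "\<forall>\<^sub>F n in sequentially. norm (?b n) \<le> (2/\<eta>\<^sup>2) ^ DIM('a) * (((\<eta>\<^sup>2/2) * (real (Suc n) ^ 2)) ^ DIM('a) / exp ((\<eta>\<^sup>2/2) * (real (Suc n) ^ 2)))"
        by simp
    qed
    then show "(\<lambda>n. (LINT y|lborel. norm (f y)) * ?b n) \<longlonglongrightarrow> 0"
      by (rule tendsto_mult_right_zero)
  qed
  have "(\<lambda>n. (LINT y|lborel. f1 y * ?g n y) + (LINT y|lborel. f2 y * ?g n y)) \<longlonglongrightarrow> f x + 0"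
    by (intro tendsto_add lim1 lim2)
  moreover have "(LINT y|lborel. f y * ?g n y) = (LINT y|lborel. f1 y * ?g n y) + (LINT y|lborel. f2 y * ?g n y)" for n
    unfolding split distrib_right using ig[OF f1] ig[OF f2] by (intro Bochner_Integration.integral_add)
  ultimately show ?thesis by simp
qed

section \<open>Inversion and Plancherel's theorem\<close>

lemma cnj_measurable [measurable]: "cnj \<in> borel_measurable borel"
  by (intro borel_measurable_continuous_onI continuous_intros)

lemma ft_times_damp_integrable:
  fixes f :: "'a::euclidean_space \<Rightarrow> complex"
  assumes f: "integrable lborel f" and n: "n > 0"
  shows "integrable lborel (\<lambda>\<omega>. ft f \<omega> * complex_of_real (damp n \<omega>))"
proof -
  have [measurable]: "f \<in> borel_measurable borel"
    using borel_measurable_integrable[OF f] by simp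
  have "integrable lborel (\<lambda>\<omega>::'a. (LINT x|lborel. norm (f x)) * damp n \<omega>)"
    by (intro integrable_mult_right integrable_damp n)
  then show ?thesis
    by (rule Bochner_Integration.integrable_bound)
       (auto simp: norm_mult intro!: AE_I2 mult_mono norm_ft_le order_trans[OF norm_ft_le])
qed

theorem fourier_inversion:
  fixes f :: "'a::euclidean_space \<Rightarrow> complex"
  assumes f: "integrable lborel f" and cont: "isCont f x" and F: "integrable lborel (ft f)"
  shows "(LINT \<omega>|lborel. ft f \<omega> * wave \<omega> (- x)) = (2 * pi) ^ DIM('a) * f x"
proof (rule LIMSEQ_unique)
  have [measurable]: "ft f \<in> borel_measurable borel"
    using borel_measurable_integrable[OF F] by simp
  show "(\<lambda>n. LINT \<omega>|lborel. ft f \<omega> * wave \<omega> (- x) * complex_of_real (damp (real (Suc n)) \<omega>)) \<longlonglongrightarrow>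
     (LINT \<omega>|lborel. ft f \<omega> * wave \<omega> (- x))"
  proof (rule integral_dominated_convergence[where w = "\<lambda>\<omega>. norm (ft f \<omega>)"])
    show "AE \<omega> in lborel. (\<lambda>n. ft f \<omega> * wave \<omega> (- x) * complex_of_real (damp (real (Suc n)) \<omega>)) \<longlonglongrightarrow> ft f \<omega> * wave \<omega> (- x)"
    proof (rule AE_I2)
      fix \<omega> :: 'a
      have "(\<lambda>n. ft f \<omega> * wave \<omega> (- x) * complex_of_real (damp (real (Suc n)) \<omega>)) \<longlonglongrightarrow> ft f \<omega> * wave \<omega> (- x) * complex_of_real 1"
        by (intro tendsto_intros damp_limit)
      then show "(\<lambda>n. ft f \<omega> * wave \<omega> (- x) * complex_of_real (damp (real (Suc n)) \<omega>)) \<longlonglongrightarrow> ft f \<omega> * wave \<omega> (- x)"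
        by simp
    qed
  qed (use F in \<open>auto simp: norm_mult mult_left_le\<close>)
  have "(LINT \<omega>|lborel. ft f \<omega> * wave \<omega> (- x) * complex_of_real (damp (real (Suc n)) \<omega>))
    = (2 * pi) ^ DIM('a) * (LINT y|lborel. f y * complex_of_real (real (Suc n) ^ DIM('a) * gauss (real (Suc n) *\<^sub>R (y - x))))" for n
    by (rule damped_inversion[OF f]) simp
  then show "(\<lambda>n. LINT \<omega>|lborel. ft f \<omega> * wave \<omega> (- x) * complex_of_real (damp (real (Suc n)) \<omega>)) \<longlonglongrightarrow> (2 * pi) ^ DIM('a) * f x"
    using tendsto_mult[OF tendsto_const gauss_delta_limit[OF f cont]] by presburger
qed

text \<open>Fatou's lemma along the damping factors.\<close>

lemma
  fixes F :: "'a::euclidean_space \<Rightarrow> real"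
  assumes [measurable]: "F \<in> borel_measurable borel" and F: "\<And>\<omega>. F \<omega> \<ge> 0"
    and int: "\<And>n. integrable lborel (\<lambda>\<omega>. F \<omega> * damp (real (Suc n)) \<omega>)"
    and M: "\<And>n. (LINT \<omega>|lborel. F \<omega> * damp (real (Suc n)) \<omega>) \<le> M"
  shows integrable_of_damped_bound: "integrable lborel F" and integral_le_damped_bound: "(LINT \<omega>|lborel. F \<omega>) \<le> M"
proof -
  have M0: "M \<ge> 0"
    by (rule order_trans[OF integral_nonneg_AE M[of 0]]) (simp add: F)
  have "(\<integral>\<^sup>+\<omega>. ennreal (F \<omega>) \<partial>lborel) = (\<integral>\<^sup>+\<omega>. liminf (\<lambda>n. ennreal (F \<omega> * damp (real (Suc n)) \<omega>)) \<partial>lborel)"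
  proof (rule nn_integral_cong)
    fix \<omega> :: 'a
    have "(\<lambda>n. ennreal (F \<omega> * damp (real (Suc n)) \<omega>)) \<longlonglongrightarrow> ennreal (F \<omega> * 1)"
      by (intro tendsto_intros damp_limit)
    then show "ennreal (F \<omega>) = liminf (\<lambda>n. ennreal (F \<omega> * damp (real (Suc n)) \<omega>))"
      by (simp add: lim_imp_Liminf)
  qed
  also have "\<dots> \<le> liminf (\<lambda>n. \<integral>\<^sup>+\<omega>. ennreal (F \<omega> * damp (real (Suc n)) \<omega>) \<partial>lborel)"
    by (rule nn_integral_liminf) measurable
  also have "\<dots> \<le> liminf (\<lambda>n. ennreal M)"
    by (intro Liminf_mono always_eventually allI, subst nn_integral_eq_integral[OF int])
       (use M F in \<open>auto intro: ennreal_leI\<close>)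
  also have "\<dots> = ennreal M" by (simp add: Liminf_const)
  finally have le: "(\<integral>\<^sup>+\<omega>. ennreal (F \<omega>) \<partial>lborel) \<le> ennreal M" .
  then have "(\<integral>\<^sup>+\<omega>. ennreal (F \<omega>) \<partial>lborel) < \<infinity>"
    using le_less_trans ennreal_less_top by (metis infinity_ennreal_def)
  then show i: "integrable lborel F"
    using F by (intro integrableI_nonneg) auto
  show "(LINT \<omega>|lborel. F \<omega>) \<le> M"
    using le F M0 by (subst (asm) nn_integral_eq_integral[OF i]) (auto simp: ennreal_le_iff)
qed

text \<open>A nonnegative transform of a function continuous at \<open>0\<close> is integrable, because its damped integrals
  converge to a multiple of the value at \<open>0\<close>. Applied to the kernel, this also yields the integrability
  of \<open>(1 + |\<omega>|\<^sup>2)\<^bsup>-\<sigma>\<^esup>\<close>.\<close>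

lemma integrable_ft_of_nonneg:
  fixes f :: "'a::euclidean_space \<Rightarrow> complex"
  assumes f: "integrable lborel f" and cont: "isCont f 0"
    and eq: "\<And>\<omega>. ft f \<omega> = complex_of_real (F \<omega>)" and F: "\<And>\<omega>. F \<omega> \<ge> 0"
  shows "integrable lborel F"
proof -
  have [measurable]: "f \<in> borel_measurable borel"
    using borel_measurable_integrable[OF f] by simp
  have F_eq: "F = (\<lambda>\<omega>. Re (ft f \<omega>))" by (simp add: eq)
  have m: "F \<in> borel_measurable borel" unfolding F_eq by measurable
  have i: "integrable lborel (\<lambda>\<omega>. F \<omega> * damp (real (Suc n)) \<omega>)" for n
    using integrable_Re[OF ft_times_damp_integrable[OF f, of "real (Suc n)"]] by (simp add: eq)
  have conv: "(\<lambda>n. (2 * pi) ^ DIM('a) * (LINT y|lborel. f y * complex_of_real (real (Suc n) ^ DIM('a) * gauss (real (Suc n) *\<^sub>R (y - 0))))) \<longlonglongrightarrow> (2 * pi) ^ DIM('a) * f 0"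
    by (intro tendsto_intros gauss_delta_limit f cont)
  obtain M where M: "\<And>n. norm ((2 * pi) ^ DIM('a) * (LINT y|lborel. f y * complex_of_real (real (Suc n) ^ DIM('a) * gauss (real (Suc n) *\<^sub>R (y - 0))))) \<le> M"
    using convergent_imp_Bseq[OF convergentI[OF conv]] unfolding Bseq_def by blast
  have "(LINT \<omega>|lborel. F \<omega> * damp (real (Suc n)) \<omega>) \<le> M" for n
  proof -
    have "complex_of_real (LINT \<omega>|lborel. F \<omega> * damp (real (Suc n)) \<omega>) = (LINT \<omega>|lborel. ft f \<omega> * wave \<omega> (- 0) * complex_of_real (damp (real (Suc n)) \<omega>))"
      unfolding integral_complex_of_real[symmetric] by (simp add: eq del: of_nat_Suc)
    also have "\<dots> = (2 * pi) ^ DIM('a) * (LINT y|lborel. f y * complex_of_real (real (Suc n) ^ DIM('a) * gauss (real (Suc n) *\<^sub>R (y - 0))))"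
      by (rule damped_inversion[OF f]) simp
    finally have "norm (complex_of_real (LINT \<omega>|lborel. F \<omega> * damp (real (Suc n)) \<omega>)) \<le> M"
      using M[of n] by presburger
    then show ?thesis by (simp del: of_nat_Suc)
  qed
  then show ?thesis
    by (rule integrable_of_damped_bound[OF m F i])
qed

text \<open>The squared modulus of \<open>ft f\<close> is the transform of the autocorrelation \<open>k\<close> of \<open>f\<close>, which is bounded
  by the squared \<open>L\<^sup>2\<close>-norm of \<open>f\<close>. Hence, by \<open>damped_inversion\<close> for \<open>k\<close> at the
  origin, the damped integrals are bounded by it.\<close>

lemma
  fixes f :: "'a::euclidean_space \<Rightarrow> complex"
  assumes f: "integrable lborel f" and f2: "integrable lborel (\<lambda>x. (norm (f x))\<^sup>2)"
  shows plancherel_integrable: "integrable lborel (\<lambda>\<omega>. (norm (ft f \<omega>))\<^sup>2)"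
    and plancherel_le: "(LINT \<omega>|lborel. (norm (ft f \<omega>))\<^sup>2) \<le> (2 * pi) ^ DIM('a) * (LINT x|lborel. (norm (f x))\<^sup>2)"
proof -
  have [measurable]: "f \<in> borel_measurable borel"
    using borel_measurable_integrable[OF f] by simp
  define g where "g x = cnj (f (- x))" for x
  have [measurable]: "g \<in> borel_measurable borel"
    unfolding g_def by measurable
  define k where "k = conv f g"
  define S where "S = (LINT x|lborel. (norm (f x))\<^sup>2)"
  have g: "integrable lborel g"
    unfolding g_def using integrable_lborel_reflect_iff[of f 0] f by simp
  have k: "integrable lborel k"
    unfolding k_def by (rule integrable_conv[OF f g])
  have ftk: "ft k \<omega> = complex_of_real ((norm (ft f \<omega>))\<^sup>2)" for \<omega>
    unfolding k_def ft_conv[OF f g] unfolding g_def ft_cnj_reflect complex_norm_square ..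
  have kS: "norm (k x) \<le> S" for x
  proof -
    have i2: "integrable lborel (\<lambda>u. (norm (f (u + (- x))))\<^sup>2)"
      using integrable_lborel_shift_iff[of "\<lambda>u. (norm (f u))\<^sup>2" "-x"] f2 by simp
    have le: "norm (f u * g (x - u)) \<le> (norm (f u))\<^sup>2 / 2 + (norm (f (u + (- x))))\<^sup>2 / 2" for u
      using sum_squares_bound[of "norm (f u)" "norm (f (u - x))"] by (simp add: g_def norm_mult)
    have i3: "integrable lborel (\<lambda>u. f u * g (x - u))"
      by (rule Bochner_Integration.integrable_bound[where f = "\<lambda>u. (norm (f u))\<^sup>2 / 2 + (norm (f (u + (- x))))\<^sup>2 / 2"])
         (use i2 f2 le in \<open>auto intro!: AE_I2 order_trans[OF le] simp: g_def\<close>)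
    have "norm (k x) \<le> (LINT u|lborel. (norm (f u))\<^sup>2 / 2 + (norm (f (u + (- x))))\<^sup>2 / 2)"
      unfolding k_def conv_def
      by (rule Bochner_Integration.integral_norm_bound_integral[OF i3]) (use i2 f2 le in auto)
    also have "\<dots> = S / 2 + S / 2"
      using i2 f2 integral_lborel_shift[of "\<lambda>u. (norm (f u))\<^sup>2" "-x"] by (simp add: S_def)
    finally show ?thesis by simp
  qed
  have i: "integrable lborel (\<lambda>\<omega>. (norm (ft f \<omega>))\<^sup>2 * damp (real (Suc n)) \<omega>)" for n
    using integrable_Re[OF ft_times_damp_integrable[OF k, of "real (Suc n)"]] by (simp add: ftk flip: of_real_mult of_real_power)
  have le: "(LINT \<omega>|lborel. (norm (ft f \<omega>))\<^sup>2 * damp (real (Suc n)) \<omega>) \<le> (2 * pi) ^ DIM('a) * S" for n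
  proof -
    define N where "N = real (Suc n)"
    have N: "N > 0" by (simp add: N_def)
    have ig: "integrable lborel (\<lambda>y::'a. N ^ DIM('a) * gauss (N *\<^sub>R y))"
      using integrable_lborel_affine_iff[of N "gauss :: 'a \<Rightarrow> real" 0] N by (simp add: integrable_gauss)
    have one: "(LINT y::'a|lborel. N ^ DIM('a) * gauss (N *\<^sub>R y)) = 1"
      using integral_lborel_affine[of N "gauss :: 'a \<Rightarrow> real" 0] N by (simp add: integral_gauss)
    have "complex_of_real (LINT \<omega>|lborel. (norm (ft f \<omega>))\<^sup>2 * damp N \<omega>) = (LINT \<omega>|lborel. ft k \<omega> * wave \<omega> (- 0) * complex_of_real (damp N \<omega>))"
      unfolding integral_complex_of_real[symmetric] by (simp add: ftk)
    also have "\<dots> = (2 * pi) ^ DIM('a) * (LINT y|lborel. k y * complex_of_real (N ^ DIM('a) * gauss (N *\<^sub>R (y - 0))))"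
      by (rule damped_inversion[OF k N])
    finally have "norm (complex_of_real (LINT \<omega>|lborel. (norm (ft f \<omega>))\<^sup>2 * damp N \<omega>))
        = (2 * pi) ^ DIM('a) * norm (LINT y|lborel. k y * complex_of_real (N ^ DIM('a) * gauss (N *\<^sub>R (y - 0))))"
      by (simp only: norm_mult norm_of_real) simp
    moreover have "norm (LINT y|lborel. k y * complex_of_real (N ^ DIM('a) * gauss (N *\<^sub>R (y - 0)))) \<le> 
      (LINT y|lborel. S * (N ^ DIM('a) * gauss (N *\<^sub>R (y::'a))))"
    proof (rule Bochner_Integration.integral_norm_bound_integral)
      show "norm (k y * complex_of_real (N ^ DIM('a) * gauss (N *\<^sub>R (y - 0)))) \<le> S * (N ^ DIM('a) * gauss (N *\<^sub>R y))" for y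
        unfolding norm_mult norm_of_real using N order_trans[OF norm_ge_zero kS] by (intro mult_mono kS) auto
      show iSg: "integrable lborel (\<lambda>y::'a. S * (N ^ DIM('a) * gauss (N *\<^sub>R y)))"
        using ig by simp
      show "integrable lborel (\<lambda>y. k y * complex_of_real (N ^ DIM('a) * gauss (N *\<^sub>R (y - 0))))"
      proof (rule Bochner_Integration.integrable_bound[OF iSg])
        show "AE y in lborel. norm (k y * complex_of_real (N ^ DIM('a) * gauss (N *\<^sub>R (y - 0)))) \<le> norm (S * (N ^ DIM('a) * gauss (N *\<^sub>R y)))"
          unfolding norm_mult norm_of_real using N order_trans[OF kS abs_ge_self] by (intro AE_I2 mult_mono) auto
      qed (use k in measurable)
    qed
    moreover have "(LINT y|lborel. S * (N ^ DIM('a) * gauss (N *\<^sub>R (y::'a)))) = S"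
      by (subst integral_mult_right_zero[where c = S], subst one) simp
    ultimately have "\<bar>LINT \<omega>|lborel. (norm (ft f \<omega>))\<^sup>2 * damp N \<omega>\<bar> \<le> (2 * pi) ^ DIM('a) * S"
      by (simp only: norm_of_real) (rule mult_left_mono, simp_all)
    then show ?thesis
      unfolding N_def[symmetric] by linarith
  qed
  show "integrable lborel (\<lambda>\<omega>. (norm (ft f \<omega>))\<^sup>2)"
    by (rule integrable_of_damped_bound[OF _ _ i le]) auto
  show "(LINT \<omega>|lborel. (norm (ft f \<omega>))\<^sup>2) \<le> (2 * pi) ^ DIM('a) * (LINT x|lborel. (norm (f x))\<^sup>2)"
    unfolding S_def[symmetric] by (rule integral_le_damped_bound[OF _ _ i le]) auto
qed

text \<open>For functions with integrable transform, inversion holds pointwise and Plancherel's identity is an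
  exchange of integrations.\<close>

lemma
  fixes f :: "'a::euclidean_space \<Rightarrow> complex"
  assumes f: "integrable lborel f" and cont: "continuous_on UNIV f" and F: "integrable lborel (ft f)"
  shows norm_le_integral_ft: "(2 * pi) ^ DIM('a) * norm (f x) \<le> (LINT \<omega>|lborel. norm (ft f \<omega>))"
    and integrable_square_of_integrable_ft: "integrable lborel (\<lambda>x. (norm (f x))\<^sup>2)"
    and plancherel_eq: "(LINT x|lborel. (norm (f x))\<^sup>2) = (LINT \<omega>|lborel. (norm (ft f \<omega>))\<^sup>2) / (2 * pi) ^ DIM('a)"
proof -
  have [measurable]: "f \<in> borel_measurable borel"
    using borel_measurable_integrable[OF f] by simp
  have inv: "(LINT \<omega>|lborel. ft f \<omega> * wave \<omega> (- x)) = (2 * pi) ^ DIM('a) * f x" for x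
    using cont by (intro fourier_inversion f F) (simp add: continuous_on_eq_continuous_at)
  show bd: "(2 * pi) ^ DIM('a) * norm (f x) \<le> (LINT \<omega>|lborel. norm (ft f \<omega>))" for x
  proof -
    have "norm (LINT \<omega>|lborel. ft f \<omega> * wave \<omega> (- x)) \<le> (LINT \<omega>|lborel. norm (ft f \<omega> * wave \<omega> (- x)))"
      by (rule integral_norm_bound)
    then show ?thesis by (simp only: inv) (simp add: norm_mult norm_power)
  qed
  define M where "M = (LINT \<omega>|lborel. norm (ft f \<omega>)) / (2 * pi) ^ DIM('a)"
  have M: "norm (f x) \<le> M" for x
    using bd[of x] by (simp add: M_def field_simps)
  have "integrable lborel (\<lambda>x. M * norm (f x))" using f by simp
  then show i2: "integrable lborel (\<lambda>x. (norm (f x))\<^sup>2)"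
    by (rule Bochner_Integration.integrable_bound)
       (auto intro!: AE_I2 mult_right_mono order_trans[OF M] simp: power2_eq_square abs_mult)
  have "complex_of_real ((2 * pi) ^ DIM('a) * (LINT x|lborel. (norm (f x))\<^sup>2)) = (LINT x|lborel. cnj (f x) * ((2 * pi) ^ DIM('a) * f x))"
    unfolding integral_mult_right_zero[symmetric] integral_complex_of_real[symmetric] of_real_mult complex_norm_square
    by (simp add: mult_ac)
  also have "\<dots> = (LINT x|lborel. LINT \<omega>|lborel. cnj (f x) * wave \<omega> (- x) * ft f \<omega>)"
    by (subst inv[symmetric], subst integral_mult_right_zero[symmetric]) (simp add: mult_ac)
  also have "\<dots> = (LINT \<omega>|lborel. LINT x|lborel. cnj (f x) * wave \<omega> (- x) * ft f \<omega>)"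
    by (rule Fubini_bounded_kernel[symmetric]) (use f F in auto)
  also have "\<dots> = (LINT \<omega>|lborel. cnj (ft f \<omega>) * ft f \<omega>)"
    by (subst integral_mult_left_zero) (simp add: cnj_wave(1)[symmetric] ft_def flip: complex_cnj_mult)
  also have "\<dots> = complex_of_real (LINT \<omega>|lborel. (norm (ft f \<omega>))\<^sup>2)"
    unfolding integral_complex_of_real[symmetric] complex_norm_square by (simp add: mult.commute)
  finally have "(2 * pi) ^ DIM('a) * (LINT x|lborel. (norm (f x))\<^sup>2) = (LINT \<omega>|lborel. (norm (ft f \<omega>))\<^sup>2)"
    by (simp only: of_real_eq_iff)
  then show "(LINT x|lborel. (norm (f x))\<^sup>2) = (LINT \<omega>|lborel. (norm (ft f \<omega>))\<^sup>2) / (2 * pi) ^ DIM('a)"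
    by (simp add: field_simps)
qed

lemma power2_norm_triangle:
  fixes a b :: "'a::real_normed_vector"
  shows "(norm (a + b))\<^sup>2 \<le> 2 * (norm a)\<^sup>2 + 2 * (norm b)\<^sup>2"
proof -
  have "(norm (a + b))\<^sup>2 \<le> (norm a + norm b)\<^sup>2"
    by (intro power_mono norm_triangle_ineq) simp
  also have "\<dots> \<le> 2 * (norm a)\<^sup>2 + 2 * (norm b)\<^sup>2"
    using sum_squares_bound[of "norm a" "norm b"] by (simp add: power2_sum)
  finally show ?thesis .
qed

lemma norm_fourier_square:
  fixes f :: "'a::euclidean_space \<Rightarrow> complex"
  shows "(norm (fourier f \<omega>))\<^sup>2 = (norm (ft f \<omega>))\<^sup>2 / (2 * pi) ^ DIM('a)"
proof -
  have "((2 * pi) powr (- real DIM('a) / 2))\<^sup>2 = (2 * pi) powr (- real DIM('a))"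
    by (simp only: power2_eq_square powr_add[symmetric]) simp
  also have "\<dots> = 1 / (2 * pi) ^ DIM('a)"
    by (simp only: powr_minus_divide) (simp add: powr_realpow del: powr_mult)
  finally show ?thesis
    by (simp only: fourier_eq_ft norm_mult power_mult_distrib norm_of_real power2_abs) simp
qed

lemma
  fixes f :: "'a::euclidean_space \<Rightarrow> complex"
  assumes f: "integrable lborel f" and f2: "integrable lborel (\<lambda>x. (norm (f x))\<^sup>2)"
  shows fourier_square_integrable: "integrable lborel (\<lambda>\<omega>. (norm (fourier f \<omega>))\<^sup>2)"
    and fourier_plancherel_le: "(LINT \<omega>|lborel. (norm (fourier f \<omega>))\<^sup>2) \<le> (LINT x|lborel. (norm (f x))\<^sup>2)"
  using plancherel_integrable[OF f f2] plancherel_le[OF f f2]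
  by (simp_all add: norm_fourier_square pos_divide_le_eq mult.commute)

text \<open>On \<open>L\<^sup>1 \<inter> L\<^sup>2\<close> the chosen representative agrees with the integral. The constant sequence shows that
  \<open>fourier f\<close> is a possible choice, and \<open>fourier_plancherel_le\<close>, applied to \<open>h n - f\<close>, shows that any
  two choices agree almost everywhere.\<close>

theorem fourier_L2_eq_fourier:
  fixes f :: "'a::euclidean_space \<Rightarrow> complex"
  assumes f: "integrable lborel f" and f2: "integrable lborel (\<lambda>x. (norm (f x))\<^sup>2)"
  shows "AE \<omega> in lborel. fourier_L2 f \<omega> = fourier f \<omega>" and "fourier_L2 f \<in> borel_measurable borel"
proof -
  have f_m [measurable]: "f \<in> borel_measurable borel"
    using borel_measurable_integrable[OF f] by simp
  have m: "fourier h \<in> borel_measurable borel" if [measurable]: "h \<in> borel_measurable borel" for h :: "'a \<Rightarrow> complex"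
    unfolding fourier_eq_ft[abs_def] by measurable
  note [measurable] = m[OF f_m]
  have "f \<in> L2" using f2 by (simp add: L2_def)
  moreover have "fourier f \<in> L2"
    using fourier_square_integrable[OF f f2] by (simp add: L2_def)
  ultimately have "has_fourier_L2 f (fourier f)"
    unfolding has_fourier_L2_def using f by (auto intro!: exI[of _ "\<lambda>_. f"])
  then have "has_fourier_L2 f (fourier_L2 f)"
    unfolding fourier_L2_def by (rule someI[of "has_fourier_L2 f"])
  then obtain h where gL: "fourier_L2 f \<in> L2" and h: "\<And>n. h n \<in> L2" "\<And>n. integrable lborel (h n)"
    and l1: "(\<lambda>n. \<integral>\<^sup>+x. ennreal ((norm (h n x - f x))\<^sup>2) \<partial>lborel) \<longlonglongrightarrow> 0"
    and l2: "(\<lambda>n. \<integral>\<^sup>+\<omega>. ennreal ((norm (fourier (h n) \<omega> - fourier_L2 f \<omega>))\<^sup>2) \<partial>lborel) \<longlonglongrightarrow> 0"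
    unfolding has_fourier_L2_def by blast
  show [measurable]: "fourier_L2 f \<in> borel_measurable borel"
    using gL by (simp add: L2_def)
  have hm [measurable]: "h n \<in> borel_measurable borel" for n
    using h(1)[of n] by (simp add: L2_def)
  note [measurable] = m[OF hm]
  have bound: "(\<integral>\<^sup>+\<omega>. ennreal ((norm (fourier_L2 f \<omega> - fourier f \<omega>))\<^sup>2) \<partial>lborel) \<le>
     2 * (\<integral>\<^sup>+\<omega>. ennreal ((norm (fourier (h n) \<omega> - fourier_L2 f \<omega>))\<^sup>2) \<partial>lborel) +
     2 * (\<integral>\<^sup>+x. ennreal ((norm (h n x - f x))\<^sup>2) \<partial>lborel)" for n
  proof -
    have d: "integrable lborel (\<lambda>x. h n x - f x)" using h f by simp
    have d2: "integrable lborel (\<lambda>x. (norm (h n x - f x))\<^sup>2)"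
    proof (rule Bochner_Integration.integrable_bound)
      show "integrable lborel (\<lambda>x. 2 * (norm (h n x))\<^sup>2 + 2 * (norm (f x))\<^sup>2)"
        using f2 h(1)[of n] by (simp add: L2_def)
      show "AE x in lborel. norm ((norm (h n x - f x))\<^sup>2) \<le> norm (2 * (norm (h n x))\<^sup>2 + 2 * (norm (f x))\<^sup>2)"
        using power2_norm_triangle[of "h n x" "- f x" for x] by (intro AE_I2) (simp add: power2_norm_triangle)
    qed measurable
    have "(\<integral>\<^sup>+\<omega>. ennreal ((norm (fourier_L2 f \<omega> - fourier f \<omega>))\<^sup>2) \<partial>lborel) \<le>
       (\<integral>\<^sup>+\<omega>. 2 * ennreal ((norm (fourier (h n) \<omega> - fourier_L2 f \<omega>))\<^sup>2) + 2 * ennreal ((norm (fourier (\<lambda>x. h n x - f x) \<omega>))\<^sup>2) \<partial>lborel)"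
    proof (rule nn_integral_mono)
      fix \<omega> :: 'a
      have e: "fourier (\<lambda>x. h n x - f x) \<omega> = fourier (h n) \<omega> - fourier f \<omega>"
        by (simp add: fourier_eq_ft ft_diff h f right_diff_distrib)
      have le: "(norm (fourier_L2 f \<omega> - fourier f \<omega>))\<^sup>2 \<le> 2 * (norm (fourier (h n) \<omega> - fourier_L2 f \<omega>))\<^sup>2 + 2 * (norm (fourier (h n) \<omega> - fourier f \<omega>))\<^sup>2"
        using power2_norm_triangle[of "fourier_L2 f \<omega> - fourier (h n) \<omega>" "fourier (h n) \<omega> - fourier f \<omega>"]
        by (simp add: norm_minus_commute)
      have split: "ennreal (2 * a + 2 * b) = 2 * ennreal a + 2 * ennreal b" if "a \<ge> 0" "b \<ge> 0" for a b :: real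
        using that by (simp add: ennreal_plus ennreal_mult)
      show "ennreal ((norm (fourier_L2 f \<omega> - fourier f \<omega>))\<^sup>2) \<le> 2 * ennreal ((norm (fourier (h n) \<omega> - fourier_L2 f \<omega>))\<^sup>2) + 2 * ennreal ((norm (fourier (\<lambda>x. h n x - f x) \<omega>))\<^sup>2)"
        unfolding e split[OF zero_le_power2 zero_le_power2, symmetric] by (rule ennreal_leI[OF le])
    qed
    also have "\<dots> = 2 * (\<integral>\<^sup>+\<omega>. ennreal ((norm (fourier (h n) \<omega> - fourier_L2 f \<omega>))\<^sup>2) \<partial>lborel) +
       2 * (\<integral>\<^sup>+\<omega>. ennreal ((norm (fourier (\<lambda>x. h n x - f x) \<omega>))\<^sup>2) \<partial>lborel)"
    proof -
      have [measurable]: "fourier (\<lambda>x. h n x - f x) \<in> borel_measurable borel" by (rule m) measurable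
      show ?thesis by (simp add: nn_integral_add nn_integral_cmult)
    qed
    also have "(\<integral>\<^sup>+\<omega>. ennreal ((norm (fourier (\<lambda>x. h n x - f x) \<omega>))\<^sup>2) \<partial>lborel) \<le> (\<integral>\<^sup>+x. ennreal ((norm (h n x - f x))\<^sup>2) \<partial>lborel)"
      using fourier_plancherel_le[OF d d2]
      by (subst nn_integral_eq_integral[OF fourier_square_integrable[OF d d2]], simp,
          subst nn_integral_eq_integral[OF d2], simp) (rule ennreal_leI)
    finally show ?thesis by (simp add: mult_left_mono add_left_mono)
  qed
  have lim: "(\<lambda>n. 2 * (\<integral>\<^sup>+\<omega>. ennreal ((norm (fourier (h n) \<omega> - fourier_L2 f \<omega>))\<^sup>2) \<partial>lborel) +
     2 * (\<integral>\<^sup>+x. ennreal ((norm (h n x - f x))\<^sup>2) \<partial>lborel)) \<longlonglongrightarrow> 2 * 0 + 2 * 0"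
    by (intro tendsto_add ennreal_tendsto_cmult l1 l2) auto
  have "(\<integral>\<^sup>+\<omega>. ennreal ((norm (fourier_L2 f \<omega> - fourier f \<omega>))\<^sup>2) \<partial>lborel) \<le> 2 * 0 + 2 * 0"
    by (rule LIMSEQ_le_const[OF lim]) (use bound in auto)
  then have "AE \<omega> in lborel. ennreal ((norm (fourier_L2 f \<omega> - fourier f \<omega>))\<^sup>2) = 0"
    by (subst nn_integral_0_iff_AE[symmetric]) auto
  then show "AE \<omega> in lborel. fourier_L2 f \<omega> = fourier f \<omega>"
    by eventually_elim (simp add: ennreal_eq_0_iff)
qed

section \<open>Cardinal B-splines\<close>

definition cube_density :: "'a::euclidean_space \<Rightarrow> complex" where
  "cube_density x = (\<Prod>b\<in>Basis. complex_of_real (indicator {-1..1} (x \<bullet> b) / 2))"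

text \<open>Convolution powers of the uniform density on a cube: compactly supported densities whose transforms
  decay as fast as required. They serve twice, as frequency windows with compactly supported inverse
  transform and as building blocks of the mollifier.\<close>

primrec spline :: "nat \<Rightarrow> 'a::euclidean_space \<Rightarrow> complex" where
  "spline 0 = cube_density"
| "spline (Suc n) = conv cube_density (spline n)"

definition sinc_prod :: "'a::euclidean_space \<Rightarrow> real" where
  "sinc_prod \<omega> = (\<Prod>b\<in>Basis. sinc (\<omega> \<bullet> b))"

lemma cube_density_measurable [measurable]: "cube_density \<in> borel_measurable borel"
  unfolding cube_density_def[abs_def] by measurable

lemma spline_measurable [measurable]: "spline n \<in> borel_measurable borel"
  by (induction n) simp_all

lemma interval_fourier:
  "integrable lborel (\<lambda>t. complex_of_real (indicator {-1..1::real} t / 2) * exp (- (\<i> * complex_of_real (t * c))))"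
  "(LINT t|lborel. complex_of_real (indicator {-1..1::real} t / 2) * exp (- (\<i> * complex_of_real (t * c)))) = complex_of_real (sinc c)"
proof -
  let ?f = "\<lambda>t. exp (- (\<i> * complex_of_real (t * c))) / 2"
  have c: "continuous_on {-1..1::real} ?f" by (intro continuous_intros) auto
  have eq: "(\<lambda>t. complex_of_real (indicator {-1..1::real} t / 2) * exp (- (\<i> * complex_of_real (t * c)))) = (\<lambda>t. indicator {-1..1} t *\<^sub>R ?f t)"
    by (auto simp: indicator_def)
  show "integrable lborel (\<lambda>t. complex_of_real (indicator {-1..1::real} t / 2) * exp (- (\<i> * complex_of_real (t * c))))"
    unfolding eq using borel_integrable_atLeastAtMost'[OF c] by (simp add: set_integrable_def)
  define F where "F t = (if c = 0 then complex_of_real t / 2 else \<i> * exp (- (\<i> * complex_of_real (t * c))) / (2 * complex_of_real c))" for t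
  have "(LINT t|lborel. indicator {-1..1} t *\<^sub>R ?f t) = F 1 - F (- 1)"
  proof (rule integral_FTC_Icc)
    fix t :: real
    show "(F has_vector_derivative ?f t) (at t within {- 1..1})"
    proof (cases "c = 0")
      case True
      then show ?thesis unfolding F_def by (auto intro!: derivative_eq_intros)
    next
      case False
      then show ?thesis unfolding F_def
        by (auto intro!: derivative_eq_intros has_vector_derivative_real_field simp: field_simps)
    qed
  qed (use c in auto)
  also have "\<dots> = complex_of_real (sinc c)"
    by (auto simp: F_def exp_eq_polar field_simps complex_eq_iff Re_divide Im_divide Re_exp Im_exp power2_eq_square)
  finally show "(LINT t|lborel. complex_of_real (indicator {-1..1::real} t / 2) * exp (- (\<i> * complex_of_real (t * c)))) = complex_of_real (sinc c)"
    unfolding eq .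
qed

lemma integrable_cube_density: "integrable lborel (cube_density :: 'a::euclidean_space \<Rightarrow> complex)"
  unfolding cube_density_def[abs_def]
  using integrable_lborel_prod[of "\<lambda>_::'a. \<lambda>t. complex_of_real (indicator {-1..1} t / 2)"] interval_fourier(1)[of 0] by simp

lemma ft_cube_density: "ft cube_density (\<omega>::'a::euclidean_space) = complex_of_real (sinc_prod \<omega>)"
proof -
  have "ft cube_density \<omega> = (LINT x|lborel. (\<Prod>b\<in>Basis.
      complex_of_real (indicator {-1..1} (x \<bullet> b) / 2) * exp (- (\<i> * complex_of_real ((x \<bullet> b) * (\<omega> \<bullet> b))))))"
    unfolding ft_def wave_def cube_density_def
    by (intro Bochner_Integration.integral_cong refl)
       (simp only: prod.distrib exp_sum[OF finite_Basis, symmetric] euclidean_inner[of _ \<omega>] sum_distrib_left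
          sum_negf of_real_sum)
  also have "\<dots> = (\<Prod>b\<in>Basis. complex_of_real (sinc (\<omega> \<bullet> b)))"
    by (subst integral_lborel_prod[where f = "\<lambda>b t. complex_of_real (indicator {-1..1} t / 2) * exp (- (\<i> * complex_of_real (t * (\<omega> \<bullet> b))))"])
       (use interval_fourier in auto)
  finally show ?thesis by (simp add: sinc_prod_def)
qed

lemma integrable_spline: "integrable lborel (spline n :: 'a::euclidean_space \<Rightarrow> complex)"
  by (induction n) (auto intro: integrable_cube_density integrable_conv)

lemma ft_spline: "ft (spline n) (\<omega>::'a::euclidean_space) = complex_of_real (sinc_prod \<omega> ^ Suc n)"
  by (induction n) (auto simp: ft_cube_density ft_conv integrable_cube_density integrable_spline)

lemma cube_density_support: "cube_density x \<noteq> 0 \<Longrightarrow> b \<in> Basis \<Longrightarrow> \<bar>x \<bullet> b\<bar> \<le> 1"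
  by (auto simp: cube_density_def indicator_def abs_le_iff split: if_splits)

lemma spline_support: "spline n x \<noteq> 0 \<Longrightarrow> b \<in> Basis \<Longrightarrow> \<bar>x \<bullet> b\<bar> \<le> real (Suc n)"
proof (induction n arbitrary: x)
  case (Suc n)
  show ?case
  proof (rule ccontr)
    assume far: "\<not> \<bar>x \<bullet> b\<bar> \<le> real (Suc (Suc n))"
    have "(\<lambda>u. cube_density u * spline n (x - u)) = (\<lambda>_. 0)"
    proof (rule ext, rule ccontr)
      fix u assume "cube_density u * spline n (x - u) \<noteq> 0"
      then have "\<bar>u \<bullet> b\<bar> \<le> 1" "\<bar>(x - u) \<bullet> b\<bar> \<le> real (Suc n)"
        using cube_density_support[of u b] Suc.IH[of "x - u"] Suc.prems(2) by auto
      with far show False by (auto simp: inner_diff_left)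
    qed
    then have "spline (Suc n) x = 0" unfolding spline.simps conv_def by simp
    with Suc.prems show False by simp
  qed
qed (use cube_density_support in auto)

lemma abs_sinc_le: "\<bar>sinc t\<bar> \<le> 1" "\<bar>sinc t * t\<bar> \<le> 1"
  using abs_sin_x_le_abs_x[of t] by (auto simp: divide_simps abs_mult)

lemma sinc_prod_le_factor:
  assumes b: "b \<in> Basis" shows "\<bar>sinc_prod \<omega>\<bar> \<le> \<bar>sinc (\<omega> \<bullet> b)\<bar>"
proof -
  have "\<bar>sinc_prod \<omega>\<bar> = \<bar>sinc (\<omega> \<bullet> b)\<bar> * (\<Prod>b\<in>Basis - {b}. \<bar>sinc (\<omega> \<bullet> b)\<bar>)"
    unfolding sinc_prod_def abs_prod using prod.remove[OF finite_Basis b] by blast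
  also have "\<dots> \<le> \<bar>sinc (\<omega> \<bullet> b)\<bar> * 1"
    by (intro mult_left_mono prod_le_1) (use abs_sinc_le(1) in auto)
  finally show ?thesis by simp
qed

lemma exists_large_coordinate:
  "\<exists>b\<in>Basis. norm (x::'a::euclidean_space) \<le> real DIM('a) * \<bar>x \<bullet> b\<bar>"
proof (rule ccontr)
  assume "\<not> ?thesis"
  then have "\<And>b. b \<in> Basis \<Longrightarrow> \<bar>x \<bullet> b\<bar> < norm x / real DIM('a)"
    by (auto simp: field_simps)
  then have "(\<Sum>b\<in>(Basis::'a set). \<bar>x \<bullet> b\<bar>) < (\<Sum>b\<in>(Basis::'a set). norm x / real DIM('a))"
    by (intro sum_strict_mono) auto
  then show False using norm_le_l1[of x] by simp
qed

definition weight :: "real \<Rightarrow> 'a::euclidean_space \<Rightarrow> real" where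
  "weight s \<omega> = (1 + (norm \<omega>)\<^sup>2) powr s"

lemma weight_measurable [measurable]: "weight s \<in> borel_measurable borel"
  unfolding weight_def[abs_def] by measurable

lemma one_le_one_plus_square [simp]: "1 \<le> 1 + (x::real)\<^sup>2" "0 < 1 + x\<^sup>2"
  by (auto intro: add_pos_nonneg)

lemma weight_pos [simp]: "weight s \<omega> > 0"
  using one_le_one_plus_square(2)[of "norm \<omega>"] unfolding weight_def powr_gt_zero by linarith

lemma weight_nonneg [simp]: "weight s \<omega> \<ge> 0"
  by (rule less_imp_le) (rule weight_pos)

text \<open>Some coordinate of \<open>\<omega>\<close> has modulus at least \<open>|\<omega>| / d\<close>, and its factor alone provides decay of order
  one.\<close>

lemma sinc_prod_decay:
  fixes \<omega> :: "'a::euclidean_space"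
  assumes "real p \<ge> s"
  shows "sinc_prod \<omega> ^ (2 * p) \<le> (1 + (real DIM('a))\<^sup>2) ^ p * weight (- s) \<omega>"
proof -
  obtain b where b: "b \<in> Basis" "norm \<omega> \<le> real DIM('a) * \<bar>\<omega> \<bullet> b\<bar>"
    using exists_large_coordinate by blast
  have 1: "\<bar>sinc_prod \<omega>\<bar> \<le> 1" using sinc_prod_le_factor[OF b(1)] abs_sinc_le(1) order_trans by blast
  have 2: "\<bar>sinc_prod \<omega>\<bar> * norm \<omega> \<le> real DIM('a)"
  proof -
    have "\<bar>sinc_prod \<omega>\<bar> * norm \<omega> \<le> \<bar>sinc (\<omega> \<bullet> b)\<bar> * (real DIM('a) * \<bar>\<omega> \<bullet> b\<bar>)"
      by (intro mult_mono sinc_prod_le_factor b) auto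
    also have "\<dots> = real DIM('a) * \<bar>sinc (\<omega> \<bullet> b) * (\<omega> \<bullet> b)\<bar>"
      by (simp only: abs_mult mult_ac)
    also have "\<dots> \<le> real DIM('a) * 1"
      by (intro mult_left_mono abs_sinc_le) auto
    finally show ?thesis by simp
  qed
  have "(sinc_prod \<omega>)\<^sup>2 * (1 + (norm \<omega>)\<^sup>2) = \<bar>sinc_prod \<omega>\<bar>\<^sup>2 + (\<bar>sinc_prod \<omega>\<bar> * norm \<omega>)\<^sup>2"
    by (simp add: power_mult_distrib algebra_simps)
  also have "\<dots> \<le> 1\<^sup>2 + (real DIM('a))\<^sup>2"
    using 1 2 by (intro add_mono power_mono) auto
  finally have "((sinc_prod \<omega>)\<^sup>2 * (1 + (norm \<omega>)\<^sup>2)) ^ p \<le> (1 + (real DIM('a))\<^sup>2) ^ p"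
    by (intro power_mono) auto
  then have "sinc_prod \<omega> ^ (2 * p) * (1 + (norm \<omega>)\<^sup>2) ^ p \<le> (1 + (real DIM('a))\<^sup>2) ^ p"
    by (simp add: power_mult_distrib power_mult)
  moreover have "(1 + (norm \<omega>)\<^sup>2) powr s \<le> (1 + (norm \<omega>)\<^sup>2) ^ p"
    using assms by (subst powr_realpow[symmetric]) (auto intro!: powr_mono)
  moreover have "sinc_prod \<omega> ^ (2 * p) \<ge> 0" by (simp add: power_mult)
  ultimately have "sinc_prod \<omega> ^ (2 * p) * (1 + (norm \<omega>)\<^sup>2) powr s \<le> (1 + (real DIM('a))\<^sup>2) ^ p"
    using mult_left_mono order_trans by blast
  then show ?thesis
    using weight_pos[of s \<omega>] by (simp add: weight_def powr_minus_divide pos_le_divide_eq)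
qed

lemma sinc_prod_near_0: "\<exists>r>0. r \<le> 1 \<and> (\<forall>\<omega>::'a::euclidean_space. norm \<omega> < r \<longrightarrow> sinc_prod \<omega> \<ge> 1/2)"
proof -
  have "isCont (\<lambda>\<omega>::'a. \<Prod>b\<in>Basis. sinc (\<omega> \<bullet> b)) 0"
    by (intro continuous_prod isCont_o2[OF _ isCont_sinc] continuous_intros)
  then have "isCont (sinc_prod :: 'a \<Rightarrow> real) 0"
    by (simp add: sinc_prod_def[abs_def])
  then obtain r where r: "r > 0" "\<And>\<omega>::'a. dist \<omega> 0 < r \<Longrightarrow> dist (sinc_prod \<omega>) (sinc_prod (0::'a)) < 1/2"
    unfolding continuous_at_eps_delta by (metis half_gt_zero_iff zero_less_one)
  have "sinc_prod \<omega> \<ge> 1/2" if "norm \<omega> < r" for \<omega> :: 'a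
    using r(2)[of \<omega>] that by (simp add: sinc_prod_def[of 0] dist_real_def abs_if split: if_splits)
  then show ?thesis
    using r(1) by (intro exI[of _ "min r 1"]) auto
qed

section \<open>Exponential sums with separated frequencies\<close>

text \<open>For the window \<open>B = sinc_prod\<^bsup>2p\<^esup>\<close>, a nonnegative function with inverse transform supported in a cube,
  the waves with separated frequencies are orthogonal with respect to \<open>B\<close> at the matching scale
  (\<open>expsum_square_sinc\<close>). The Bessel weights are compared with \<open>B\<close>: the weight dominates \<open>B\<close>, and it is
  dominated by an average of translates of \<open>B\<close>.\<close>

definition expsum :: "'a::euclidean_space set \<Rightarrow> ('a \<Rightarrow> complex) \<Rightarrow> 'a \<Rightarrow> complex" where
  "expsum X \<alpha> \<omega> = (\<Sum>x\<in>X. \<alpha> x * wave \<omega> x)"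

lemma expsum_measurable [measurable]: "expsum X \<alpha> \<in> borel_measurable borel"
  unfolding expsum_def[abs_def] by measurable

lemma norm_expsum_le: "norm (expsum X \<alpha> \<omega>) \<le> (\<Sum>x\<in>X. norm (\<alpha> x))"
  unfolding expsum_def by (rule order_trans[OF norm_sum]) (simp add: norm_mult)

lemma integrable_expsum_square:
  assumes "integrable lborel g"
  shows "integrable lborel (\<lambda>\<omega>. (norm (expsum X \<alpha> \<omega>))\<^sup>2 * g \<omega>)"
proof -
  have [measurable]: "g \<in> borel_measurable borel"
    using borel_measurable_integrable[OF assms] by simp
  have "integrable lborel (\<lambda>\<omega>. (\<Sum>x\<in>X. norm (\<alpha> x))\<^sup>2 * g \<omega>)"
    using assms by simp
  then show ?thesis
    by (rule Bochner_Integration.integrable_bound)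
       (auto simp: abs_mult intro!: AE_I2 mult_right_mono power_mono norm_expsum_le)
qed

lemma weight_scaled_integrable:
  assumes "integrable lborel (weight s :: 'a::euclidean_space \<Rightarrow> real)" "r > 0"
  shows "integrable lborel (\<lambda>\<omega>::'a. weight s (r *\<^sub>R \<omega>))"
  using integrable_lborel_affine_iff[of r "weight s :: 'a \<Rightarrow> real" 0] assms by simp

definition separated :: "real \<Rightarrow> 'a::real_normed_vector set \<Rightarrow> bool" where
  "separated s X \<longleftrightarrow> (\<forall>x\<in>X. \<forall>y\<in>X. x \<noteq> y \<longrightarrow> s \<le> norm (x - y))"

context
  fixes \<sigma> :: real and p :: nat
  assumes p: "p \<ge> 1" "real p \<ge> \<sigma>" and \<sigma>: "\<sigma> \<ge> 0"
    and W: "integrable lborel (weight (- \<sigma>) :: 'a::euclidean_space \<Rightarrow> real)"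
begin

lemma sinc_power_nonneg: "sinc_prod \<omega> ^ (2 * p) \<ge> 0"
  by (simp add: power_mult)

lemma integrable_sinc_power: "integrable lborel (\<lambda>\<omega>::'a. sinc_prod \<omega> ^ (2 * p))"
proof -
  have eq: "(\<lambda>\<omega>::'a. sinc_prod \<omega> ^ (2 * p)) = (\<lambda>\<omega>. Re (ft (spline (2 * p - 1)) \<omega>))"
    using p by (simp add: ft_spline del: power_Suc)
  have m: "(\<lambda>\<omega>::'a. sinc_prod \<omega> ^ (2 * p)) \<in> borel_measurable borel"
    unfolding eq by measurable
  have "integrable lborel (\<lambda>\<omega>::'a. (1 + (real DIM('a))\<^sup>2) ^ p * weight (- \<sigma>) \<omega>)"
    using W by simp
  then show ?thesis
    by (rule Bochner_Integration.integrable_bound)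
       (use m sinc_prod_decay[OF p(2)] sinc_power_nonneg in \<open>auto intro!: AE_I2 simp: abs_mult\<close>)
qed

text \<open>By inversion the integral is a multiple of a spline evaluated outside its support, where the spline
  is locally constant and therefore continuous.\<close>

lemma sinc_power_transform_vanishes:
  assumes "b \<in> Basis" "\<bar>x \<bullet> b\<bar> > 2 * real p"
  shows "(LINT \<omega>|lborel. complex_of_real (sinc_prod \<omega> ^ (2 * p)) * wave \<omega> (x::'a)) = 0"
proof -
  let ?g = "spline (2 * p - 1) :: 'a \<Rightarrow> complex"
  have ft: "ft ?g = (\<lambda>\<omega>. complex_of_real (sinc_prod \<omega> ^ (2 * p)))"
    using p by (simp add: fun_eq_iff ft_spline del: power_Suc)
  define U where "U = {y::'a. \<bar>y \<bullet> b\<bar> > 2 * real p}"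
  have U: "open U" "- x \<in> U" unfolding U_def
    using assms(2) by (auto intro!: open_Collect_less continuous_intros)
  have zero: "?g y = 0" if "y \<in> U" for y
    using spline_support[of "2 * p - 1" y b] that assms(1) p unfolding U_def by (fastforce simp: of_nat_diff)
  have "\<forall>\<^sub>F y in nhds (- x). ?g y = 0"
    using zero U unfolding eventually_nhds by blast
  then have "isCont ?g (- x)"
    by (subst isCont_cong[where g = "\<lambda>_. 0"]) auto
  from fourier_inversion[OF integrable_spline this]
  show ?thesis
    unfolding ft using integrable_of_real[OF integrable_sinc_power] zero[OF U(2)] by (simp del: of_real_power)
qed

text \<open>Expanding the square, the term of a pair \<open>x, y\<close> contains the inverse transform of the window at
  \<open>(x - y) / r\<close>. The separation puts it outside the support unless \<open>x = y\<close>. The translation \<open>\<xi>\<close> of the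
  window only contributes unimodular factors to the terms that vanish.\<close>

lemma expsum_square_sinc:
  fixes X :: "'a set"
  assumes X: "finite X" and r: "r > 0" and sep: "separated (r * (real DIM('a) * (2 * real p + 1))) X"
  shows "(LINT \<omega>|lborel. (norm (expsum X \<alpha> \<omega>))\<^sup>2 * sinc_prod (r *\<^sub>R \<omega> - \<xi>) ^ (2 * p))
    = (LINT \<omega>::'a|lborel. sinc_prod \<omega> ^ (2 * p)) * (\<Sum>x\<in>X. (norm (\<alpha> x))\<^sup>2) / r ^ DIM('a)"
proof -
  let ?B = "\<lambda>\<omega>::'a. complex_of_real (sinc_prod \<omega> ^ (2 * p))"
  define I where "I z = (LINT \<omega>|lborel. wave \<omega> z * ?B (r *\<^sub>R \<omega> - \<xi>))" for z
  have iB: "integrable lborel ?B"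
    using integrable_sinc_power by (rule integrable_of_real)
  have iBr: "integrable lborel (\<lambda>\<omega>. wave \<omega> z * ?B (r *\<^sub>R \<omega> - \<xi>))" for z
  proof -
    have "integrable lborel (\<lambda>\<omega>. ?B (- \<xi> + r *\<^sub>R \<omega>))"
      using iB r by (subst integrable_lborel_affine_iff) auto
    then have "integrable lborel (\<lambda>\<omega>. ?B (- \<xi> + r *\<^sub>R \<omega>) * wave z \<omega>)"
      by (subst integrable_mult_wave)
    then show ?thesis by (simp add: mult.commute wave_commute[of z])
  qed
  have I: "I z = wave (\<xi> /\<^sub>R r) z * (LINT \<omega>|lborel. ?B \<omega> * wave \<omega> (z /\<^sub>R r)) / complex_of_real (r ^ DIM('a))" for z
  proof -
    have "I z = (LINT \<omega>|lborel. (\<lambda>\<eta>. wave (\<xi> /\<^sub>R r) z * (?B \<eta> * wave \<eta> (z /\<^sub>R r))) (- \<xi> + r *\<^sub>R \<omega>))"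
      unfolding I_def
    proof (intro Bochner_Integration.integral_cong refl)
      fix \<omega> :: 'a
      have e: "z \<bullet> (\<xi> /\<^sub>R r) + (z /\<^sub>R r) \<bullet> (- \<xi> + r *\<^sub>R \<omega>) = z \<bullet> \<omega>"
        using r by (simp add: inner_diff_right right_diff_distrib)
      have "wave (\<xi> /\<^sub>R r) z * wave (- \<xi> + r *\<^sub>R \<omega>) (z /\<^sub>R r) = wave \<omega> z"
        unfolding wave_def exp_add[symmetric] e[symmetric] by (simp add: algebra_simps)
      then show "wave \<omega> z * ?B (r *\<^sub>R \<omega> - \<xi>) = wave (\<xi> /\<^sub>R r) z * (?B (- \<xi> + r *\<^sub>R \<omega>) * wave (- \<xi> + r *\<^sub>R \<omega>) (z /\<^sub>R r))"
        by (simp add: mult_ac)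
    qed
    then show ?thesis
      using r by (subst (asm) integral_lborel_affine) (auto simp: scaleR_conv_of_real divide_inverse_commute)
  qed
  have I_off: "I (x - y) = 0" if "x \<in> X" "y \<in> X" "x \<noteq> y" for x y
  proof -
    obtain b where b: "b \<in> Basis" "norm (x - y) \<le> real DIM('a) * \<bar>(x - y) \<bullet> b\<bar>"
      using exists_large_coordinate by blast
    have "r * (real DIM('a) * (2 * real p + 1)) \<le> norm (x - y)"
      using sep that unfolding separated_def by blast
    from order_trans[OF this b(2)] have "real DIM('a) * (r * (2 * real p + 1)) \<le> real DIM('a) * \<bar>(x - y) \<bullet> b\<bar>"
      by (simp only: mult.left_commute[of r])
    then have "r * (2 * real p + 1) \<le> \<bar>(x - y) \<bullet> b\<bar>"
      by (rule mult_left_le_imp_le) simp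
    moreover have "2 * real p * r < r * (2 * real p + 1)"
      using r by (simp add: distrib_left mult.commute)
    ultimately have "2 * real p < \<bar>(x - y) \<bullet> b\<bar> / r"
      using r by (simp only: pos_less_divide_eq)
    also have "\<bar>(x - y) \<bullet> b\<bar> / r = \<bar>((x - y) /\<^sub>R r) \<bullet> b\<bar>"
      using r by (simp only: inner_scaleR_left abs_mult) (simp add: divide_inverse mult.commute)
    finally have "2 * real p < \<bar>((x - y) /\<^sub>R r) \<bullet> b\<bar>" .
    from sinc_power_transform_vanishes[OF b(1) this] show ?thesis
      by (simp add: I)
  qed
  have I_0: "I 0 = complex_of_real ((LINT \<omega>::'a|lborel. sinc_prod \<omega> ^ (2 * p)) / r ^ DIM('a))"
    by (simp add: I integral_complex_of_real del: of_real_power)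
  have sq: "complex_of_real ((norm (expsum X \<alpha> \<omega>))\<^sup>2) = (\<Sum>x\<in>X. \<Sum>y\<in>X. \<alpha> x * cnj (\<alpha> y) * wave \<omega> (x - y))" for \<omega>
    unfolding complex_norm_square expsum_def cnj_sum sum_product complex_cnj_mult cnj_wave(1)
    by (intro sum.cong refl) (simp add: diff_conv_add_uminus wave_mult[symmetric] mult_ac del: add_uminus_conv_diff)
  have "complex_of_real (LINT \<omega>|lborel. (norm (expsum X \<alpha> \<omega>))\<^sup>2 * sinc_prod (r *\<^sub>R \<omega> - \<xi>) ^ (2 * p))
      = (LINT \<omega>|lborel. (\<Sum>x\<in>X. \<Sum>y\<in>X. \<alpha> x * cnj (\<alpha> y) * (wave \<omega> (x - y) * ?B (r *\<^sub>R \<omega> - \<xi>))))"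
    unfolding integral_complex_of_real[symmetric] of_real_mult sq sum_distrib_right mult.assoc ..
  also have "\<dots> = (\<Sum>x\<in>X. \<Sum>y\<in>X. \<alpha> x * cnj (\<alpha> y) * I (x - y))"
    unfolding I_def using iBr by (subst Bochner_Integration.integral_sum, auto intro!: Bochner_Integration.integrable_sum integrable_mult_right)
  also have "\<dots> = (\<Sum>x\<in>X. \<Sum>y\<in>X. if y = x then \<alpha> x * cnj (\<alpha> x) * I 0 else 0)"
    by (intro sum.cong refl) (auto simp: I_off)
  also have "\<dots> = complex_of_real ((LINT \<omega>::'a|lborel. sinc_prod \<omega> ^ (2 * p)) * (\<Sum>x\<in>X. (norm (\<alpha> x))\<^sup>2) / r ^ DIM('a))"
    using X by (simp add: I_0 complex_norm_square[symmetric] sum_distrib_right sum_distrib_left sum_divide_distrib mult_ac del: of_real_power)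
  finally show ?thesis by (simp only: of_real_eq_iff)
qed

lemma integral_sinc_power_pos: "(LINT \<omega>::'a|lborel. sinc_prod \<omega> ^ (2 * p)) > 0"
proof -
  obtain r where r: "r > 0" "\<And>\<omega>::'a. norm \<omega> < r \<Longrightarrow> sinc_prod \<omega> \<ge> 1/2"
    using sinc_prod_near_0 by blast
  have "0 < (1/2) ^ (2 * p) * measure lborel (ball (0::'a) r)"
    using r(1) by (simp add: content_ball)
  also have "\<dots> = (LINT \<omega>|lborel. (1/2) ^ (2 * p) * indicator (ball (0::'a) r) \<omega>)"
    by simp
  also have "\<dots> \<le> (LINT \<omega>::'a|lborel. sinc_prod \<omega> ^ (2 * p))"
  proof (rule integral_mono)
    show "integrable lborel (\<lambda>\<omega>. (1/2) ^ (2 * p) * indicator (ball (0::'a) r) \<omega> :: real)"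
      by (intro integrable_mult_right integrable_real_indicator) (use emeasure_lborel_ball_finite[of "0::'a" r] in auto)
    show "(1/2) ^ (2 * p) * indicator (ball (0::'a) r) \<omega> \<le> sinc_prod \<omega> ^ (2 * p)" for \<omega> :: 'a
      using r(2)[of \<omega>] sinc_power_nonneg[of \<omega>] by (auto simp: indicator_def intro!: power_mono)
  qed (rule integrable_sinc_power)
  finally show ?thesis .
qed

end

lemma weight_scale_le:
  assumes "0 \<le> \<sigma>" "0 < r" "r \<le> s"
  shows "weight (- \<sigma>) (s *\<^sub>R \<omega>) \<le> weight (- \<sigma>) (r *\<^sub>R \<omega>)"
proof -
  have "1 + (norm (r *\<^sub>R \<omega>))\<^sup>2 \<le> 1 + (norm (s *\<^sub>R \<omega>))\<^sup>2"
    using assms by (auto intro!: power_mono mult_right_mono)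
  then show ?thesis
    unfolding weight_def using assms by (intro powr_mono2') auto
qed

lemma weight_scale_ge:
  assumes "0 \<le> \<sigma>" "0 < r" "r \<le> s"
  shows "weight (- \<sigma>) (r *\<^sub>R \<omega>) \<le> (s / r) powr (2 * \<sigma>) * weight (- \<sigma>) (s *\<^sub>R \<omega>)"
proof -
  have "1 + (norm (s *\<^sub>R \<omega>))\<^sup>2 \<le> (s / r)\<^sup>2 + (s / r)\<^sup>2 * (norm (r *\<^sub>R \<omega>))\<^sup>2"
    using assms by (intro add_mono) (auto simp: power_mult_distrib power_divide)
  then have "1 + (norm (s *\<^sub>R \<omega>))\<^sup>2 \<le> (s / r)\<^sup>2 * (1 + (norm (r *\<^sub>R \<omega>))\<^sup>2)"
    by (simp add: algebra_simps)
  then have "(1 + (norm (s *\<^sub>R \<omega>))\<^sup>2) powr \<sigma> \<le> ((s / r)\<^sup>2 * (1 + (norm (r *\<^sub>R \<omega>))\<^sup>2)) powr \<sigma>"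
    using assms by (intro powr_mono2) auto
  also have "\<dots> = (s / r) powr (2 * \<sigma>) * (1 + (norm (r *\<^sub>R \<omega>))\<^sup>2) powr \<sigma>"
  proof -
    have "((s / r)\<^sup>2) powr \<sigma> = (s / r) powr (2 * \<sigma>)"
      using assms by (subst powr_powr[symmetric]) simp
    then show ?thesis by (simp add: powr_mult)
  qed
  finally have "weight \<sigma> (s *\<^sub>R \<omega>) \<le> (s / r) powr (2 * \<sigma>) * weight \<sigma> (r *\<^sub>R \<omega>)"
    by (simp add: weight_def)
  moreover have "weight (- \<sigma>) z = 1 / weight \<sigma> z" for z :: 'a
    by (simp add: weight_def powr_minus_divide)
  ultimately show ?thesis
    using weight_pos[of \<sigma> "s *\<^sub>R \<omega>"] weight_pos[of \<sigma> "r *\<^sub>R \<omega>"] by (simp add: field_simps del: weight_pos)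
qed

text \<open>This is the stability of kernel matrices in terms of the separation of the centres: the window, rescaled
  to the separation \<open>s\<close>, is dominated by the weight.\<close>

lemma sum_le_integral_expsum:
  assumes \<sigma>: "\<sigma> \<ge> 0" and W: "integrable lborel (weight (- \<sigma>) :: 'a::euclidean_space \<Rightarrow> real)"
  shows "\<exists>C>0. \<forall>s X \<alpha>. finite X \<longrightarrow> 0 < s \<longrightarrow> separated s X \<longrightarrow>
     (\<Sum>x\<in>X. (norm (\<alpha> x))\<^sup>2) \<le> C * s ^ DIM('a) * (LINT \<omega>::'a|lborel. (norm (expsum X \<alpha> \<omega>))\<^sup>2 * weight (- \<sigma>) (s *\<^sub>R \<omega>))"
proof -
  obtain p :: nat where "real p \<ge> max 1 \<sigma>" using real_arch_simple by blast
  then have p: "p \<ge> 1" "real p \<ge> \<sigma>" by auto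
  define R where "R = real DIM('a) * (2 * real p + 1)"
  have R: "R \<ge> 1"
    unfolding R_def using mult_mono[of 1 "real DIM('a)" 1 "2 * real p + 1"] by simp
  define K where "K = (1 + (real DIM('a))\<^sup>2) ^ p"
  define I where "I = (LINT \<omega>::'a|lborel. sinc_prod \<omega> ^ (2 * p))"
  have I: "I > 0" unfolding I_def by (rule integral_sinc_power_pos[OF p \<sigma> W])
  have K: "K > 0" unfolding K_def by simp
  define C where "C = K * R powr (2 * \<sigma>) / (I * R ^ DIM('a))"
  have "C > 0" using I K R by (simp add: C_def)
  moreover have "(\<Sum>x\<in>X. (norm (\<alpha> x))\<^sup>2) \<le> C * s ^ DIM('a) * (LINT \<omega>|lborel. (norm (expsum X \<alpha> \<omega>))\<^sup>2 * weight (- \<sigma>) (s *\<^sub>R \<omega>))"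
    if X: "finite X" and s: "0 < s" and sep: "separated s X" for s \<alpha> and X :: "'a set"
  proof -
    define r where "r = s / R"
    have r: "r > 0" "r \<le> s" "r * R = s" "s / r = R"
      using s R by (auto simp: r_def field_simps)
    let ?E = "\<lambda>\<omega>. (norm (expsum X \<alpha> \<omega>))\<^sup>2"
    have "I * (\<Sum>x\<in>X. (norm (\<alpha> x))\<^sup>2) / r ^ DIM('a) = (LINT \<omega>|lborel. ?E \<omega> * sinc_prod (r *\<^sub>R \<omega> - 0) ^ (2 * p))"
      unfolding I_def by (rule expsum_square_sinc[OF p \<sigma> W X r(1), symmetric]) (use sep r in \<open>simp add: R_def[symmetric]\<close>)
    also have "\<dots> \<le> (LINT \<omega>|lborel. K * R powr (2 * \<sigma>) * (?E \<omega> * weight (- \<sigma>) (s *\<^sub>R \<omega>)))"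
    proof (rule integral_mono)
      have "integrable lborel (\<lambda>\<omega>::'a. sinc_prod (0 + r *\<^sub>R \<omega>) ^ (2 * p))"
        using r by (subst integrable_lborel_affine_iff) (auto intro: integrable_sinc_power[OF p \<sigma> W])
      then show "integrable lborel (\<lambda>\<omega>. ?E \<omega> * sinc_prod (r *\<^sub>R \<omega> - 0) ^ (2 * p))"
        by (intro integrable_expsum_square) simp
      show "integrable lborel (\<lambda>\<omega>. K * R powr (2 * \<sigma>) * (?E \<omega> * weight (- \<sigma>) (s *\<^sub>R \<omega>)))"
        by (intro integrable_mult_right integrable_expsum_square weight_scaled_integrable W s)
      show "?E \<omega> * sinc_prod (r *\<^sub>R \<omega> - 0) ^ (2 * p) \<le> K * R powr (2 * \<sigma>) * (?E \<omega> * weight (- \<sigma>) (s *\<^sub>R \<omega>))" for \<omega>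
      proof -
        have "sinc_prod (r *\<^sub>R \<omega>) ^ (2 * p) \<le> K * weight (- \<sigma>) (r *\<^sub>R \<omega>)"
          unfolding K_def by (rule sinc_prod_decay[OF p(2)])
        also have "\<dots> \<le> K * (R powr (2 * \<sigma>) * weight (- \<sigma>) (s *\<^sub>R \<omega>))"
          using weight_scale_ge[OF \<sigma> r(1,2)] K by (intro mult_left_mono) (auto simp: r)
        finally have "?E \<omega> * sinc_prod (r *\<^sub>R \<omega>) ^ (2 * p) \<le> ?E \<omega> * (K * (R powr (2 * \<sigma>) * weight (- \<sigma>) (s *\<^sub>R \<omega>)))"
          by (rule mult_left_mono) simp
        then show ?thesis by (simp add: mult_ac)
      qed
    qed
    also have "\<dots> = K * R powr (2 * \<sigma>) * (LINT \<omega>|lborel. ?E \<omega> * weight (- \<sigma>) (s *\<^sub>R \<omega>))"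
      by (rule integral_mult_right_zero)
    finally show ?thesis
      using I R s by (simp add: C_def r_def power_divide field_simps)
  qed
  ultimately show ?thesis by blast
qed

text \<open>The converse inequality cannot be obtained from one window, since the window has zeros. Instead the
  weight is bounded by a superposition of translated windows, each of which has the same integral against
  the squared exponential sum.\<close>

lemma integral_expsum_le_sum:
  assumes \<sigma>: "\<sigma> \<ge> 0" and W: "integrable lborel (weight (- \<sigma>) :: 'a::euclidean_space \<Rightarrow> real)"
  shows "\<exists>C>0. \<forall>s X \<alpha>. finite X \<longrightarrow> 0 < s \<longrightarrow> separated s X \<longrightarrow>
     (LINT \<omega>::'a|lborel. (norm (expsum X \<alpha> \<omega>))\<^sup>2 * weight (- \<sigma>) (s *\<^sub>R \<omega>)) \<le> C / s ^ DIM('a) * (\<Sum>x\<in>X. (norm (\<alpha> x))\<^sup>2)"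
proof -
  obtain p :: nat where "real p \<ge> max 1 \<sigma>" using real_arch_simple by blast
  then have p: "p \<ge> 1" "real p \<ge> \<sigma>" by auto
  define R where "R = real DIM('a) * (2 * real p + 1)"
  have R: "R \<ge> 1"
    unfolding R_def using mult_mono[of 1 "real DIM('a)" 1 "2 * real p + 1"] by simp
  define I where "I = (LINT \<omega>::'a|lborel. sinc_prod \<omega> ^ (2 * p))"
  have I: "I > 0" unfolding I_def by (rule integral_sinc_power_pos[OF p \<sigma> W])
  define J where "J = (LINT \<omega>::'a|lborel. weight (- \<sigma>) \<omega>)"
  have J: "J \<ge> 0" unfolding J_def by (intro integral_nonneg_AE) simp
  let ?B = "\<lambda>\<omega>::'a. sinc_prod \<omega> ^ (2 * p)"
  have B0: "?B \<omega> \<ge> 0" for \<omega> :: 'a by (simp add: power_mult)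
  have Bm [measurable]: "sinc_prod \<in> borel_measurable (borel :: 'a measure)"
    unfolding sinc_prod_def[abs_def] by measurable
  obtain \<rho> where \<rho>: "\<rho> > 0" "\<rho> \<le> 1" "\<And>\<omega>::'a. norm \<omega> < \<rho> \<Longrightarrow> sinc_prod \<omega> \<ge> 1/2"
    using sinc_prod_near_0 by blast
  define c where "c = (1/2) ^ (2 * p) * 3 powr (- \<sigma>) * measure lborel (ball (0::'a) \<rho>)"
  have c: "c > 0" using \<rho>(1) by (simp add: c_def content_ball)
  \<comment> \<open>The weight is dominated by its own convolution with the nonnegative bump \<open>?B\<close>.\<close>
  have smear: "ennreal (c * weight (- \<sigma>) \<eta>) \<le> (\<integral>\<^sup>+\<xi>. ennreal (weight (- \<sigma>) \<xi> * ?B (\<eta> - \<xi>)) \<partial>lborel)" for \<eta>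
  proof -
    let ?k = "(1/2) ^ (2 * p) * 3 powr (- \<sigma>) * weight (- \<sigma>) \<eta>"
    have "c * weight (- \<sigma>) \<eta> = ?k * measure lborel (ball \<eta> \<rho>)"
      using \<rho>(1) by (simp add: c_def content_ball)
    then have "ennreal (c * weight (- \<sigma>) \<eta>) = ennreal ?k * emeasure lborel (ball \<eta> \<rho>)"
      using emeasure_lborel_ball_finite[of \<eta> \<rho>]
      by (simp only: ennreal_mult'' measure_nonneg emeasure_eq_ennreal_measure[OF less_imp_neq, symmetric] infinity_ennreal_def)
    also have "\<dots> = (\<integral>\<^sup>+\<xi>. ennreal ?k * indicator (ball \<eta> \<rho>) \<xi> \<partial>lborel)"
      by (simp add: nn_integral_cmult_indicator)
    also have "\<dots> \<le> (\<integral>\<^sup>+\<xi>. ennreal (weight (- \<sigma>) \<xi> * ?B (\<eta> - \<xi>)) \<partial>lborel)"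
    proof (rule nn_integral_mono)
      fix \<xi> :: 'a
      show "ennreal ?k * indicator (ball \<eta> \<rho>) \<xi> \<le> ennreal (weight (- \<sigma>) \<xi> * ?B (\<eta> - \<xi>))"
      proof (cases "\<xi> \<in> ball \<eta> \<rho>")
        case True
        then have near: "norm (\<eta> - \<xi>) < \<rho>" by (simp add: dist_norm)
        have "(1/2) ^ (2 * p) \<le> ?B (\<eta> - \<xi>)"
          using \<rho>(3)[OF near] by (intro power_mono) auto
        moreover have "3 powr (- \<sigma>) * weight (- \<sigma>) \<eta> \<le> weight (- \<sigma>) \<xi>"
        proof -
          have "(norm \<xi>)\<^sup>2 \<le> 2 * (norm \<eta>)\<^sup>2 + 2 * (norm (\<xi> - \<eta>))\<^sup>2"
            using power2_norm_triangle[of \<eta> "\<xi> - \<eta>"] by simp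
          moreover have "(norm (\<xi> - \<eta>))\<^sup>2 \<le> 1\<^sup>2"
            using near \<rho>(2) by (intro power_mono) (auto simp: norm_minus_commute)
          ultimately have "1 + (norm \<xi>)\<^sup>2 \<le> 3 * (1 + (norm \<eta>)\<^sup>2)"
            using zero_le_power2[of "norm \<eta>"] unfolding power_one by argo
          then have "(3 * (1 + (norm \<eta>)\<^sup>2)) powr (- \<sigma>) \<le> (1 + (norm \<xi>)\<^sup>2) powr (- \<sigma>)"
            using \<sigma> by (intro powr_mono2') auto
          then show ?thesis unfolding weight_def by (subst powr_mult[symmetric]) auto
        qed
        ultimately have "(3 powr (- \<sigma>) * weight (- \<sigma>) \<eta>) * (1/2) ^ (2 * p) \<le> weight (- \<sigma>) \<xi> * ?B (\<eta> - \<xi>)"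
          by (intro mult_mono) auto
        with True show ?thesis by (simp add: ennreal_leI mult_ac)
      qed simp
    qed
    finally show ?thesis .
  qed
  define C where "C = I * J * R ^ DIM('a) / c + 1"
  have C0: "I * J * R ^ DIM('a) / c \<ge> 0" using I J R c by simp
  then have "C > 0" by (simp add: C_def)
  moreover have "(LINT \<omega>|lborel. (norm (expsum X \<alpha> \<omega>))\<^sup>2 * weight (- \<sigma>) (s *\<^sub>R \<omega>)) \<le> C / s ^ DIM('a) * (\<Sum>x\<in>X. (norm (\<alpha> x))\<^sup>2)"
    if X: "finite X" and s: "0 < s" and sep: "separated s X" for s \<alpha> and X :: "'a set"
  proof -
    define r where "r = s / R"
    have r: "r > 0" "r \<le> s" "r * R = s"
      using s R by (auto simp: r_def field_simps)
    let ?E = "\<lambda>\<omega>. (norm (expsum X \<alpha> \<omega>))\<^sup>2"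
    define T where "T = I * (\<Sum>x\<in>X. (norm (\<alpha> x))\<^sup>2) / r ^ DIM('a)"
    have T0: "T \<ge> 0" unfolding T_def using I r by (auto intro!: divide_nonneg_pos mult_nonneg_nonneg sum_nonneg)
    have iW: "integrable lborel (\<lambda>\<omega>. ?E \<omega> * weight (- \<sigma>) (r *\<^sub>R \<omega>))" "integrable lborel (\<lambda>\<omega>. ?E \<omega> * weight (- \<sigma>) (s *\<^sub>R \<omega>))"
      by (intro integrable_expsum_square weight_scaled_integrable W s r)+
    have slice: "(\<integral>\<^sup>+\<omega>. ennreal (?E \<omega> * ?B (r *\<^sub>R \<omega> - \<xi>)) \<partial>lborel) = ennreal T" for \<xi>
    proof -
      have "integrable lborel (\<lambda>\<omega>::'a. sinc_prod (- \<xi> + r *\<^sub>R \<omega>) ^ (2 * p))"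
        using r by (subst integrable_lborel_affine_iff) (auto intro: integrable_sinc_power[OF p \<sigma> W])
      then have "integrable lborel (\<lambda>\<omega>. ?E \<omega> * ?B (r *\<^sub>R \<omega> - \<xi>))"
        by (intro integrable_expsum_square) simp
      moreover have "(LINT \<omega>|lborel. ?E \<omega> * ?B (r *\<^sub>R \<omega> - \<xi>)) = T"
        unfolding T_def I_def by (rule expsum_square_sinc[OF p \<sigma> W X r(1)]) (use sep r in \<open>simp add: R_def[symmetric]\<close>)
      ultimately show ?thesis
        using B0 by (subst nn_integral_eq_integral) auto
    qed
    have "ennreal (c * (LINT \<omega>|lborel. ?E \<omega> * weight (- \<sigma>) (r *\<^sub>R \<omega>))) = (\<integral>\<^sup>+\<omega>. ennreal (?E \<omega>) * ennreal (c * weight (- \<sigma>) (r *\<^sub>R \<omega>)) \<partial>lborel)"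
      using nn_integral_eq_integral[OF integrable_mult_right[OF iW(1), of c]] c
      by (simp add: ennreal_mult'[symmetric] mult_ac)
    also have "\<dots> \<le> (\<integral>\<^sup>+\<omega>. ennreal (?E \<omega>) * (\<integral>\<^sup>+\<xi>. ennreal (weight (- \<sigma>) \<xi> * ?B (r *\<^sub>R \<omega> - \<xi>)) \<partial>lborel) \<partial>lborel)"
      by (intro nn_integral_mono mult_left_mono smear) auto
    also have "\<dots> = (\<integral>\<^sup>+\<omega>. \<integral>\<^sup>+\<xi>. ennreal (weight (- \<sigma>) \<xi>) * ennreal (?E \<omega> * ?B (r *\<^sub>R \<omega> - \<xi>)) \<partial>lborel \<partial>lborel)"
      by (subst nn_integral_cmult[symmetric]) (simp_all add: ennreal_mult'[symmetric] B0 mult_ac)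
    also have "\<dots> = (\<integral>\<^sup>+\<xi>. \<integral>\<^sup>+\<omega>. ennreal (weight (- \<sigma>) \<xi>) * ennreal (?E \<omega> * ?B (r *\<^sub>R \<omega> - \<xi>)) \<partial>lborel \<partial>lborel)"
      by (rule lborel_pair.Fubini') measurable
    also have "\<dots> = (\<integral>\<^sup>+\<xi>. ennreal (weight (- \<sigma>) (\<xi>::'a)) * ennreal T \<partial>lborel)"
      by (subst nn_integral_cmult) (simp_all add: slice)
    also have "\<dots> = ennreal (J * T)"
      using nn_integral_eq_integral[OF W] J T0 by (simp add: nn_integral_multc J_def ennreal_mult)
    finally have "c * (LINT \<omega>|lborel. ?E \<omega> * weight (- \<sigma>) (r *\<^sub>R \<omega>)) \<le> J * T"
      using J T0 by (simp add: ennreal_le_iff)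
    moreover have "(LINT \<omega>|lborel. ?E \<omega> * weight (- \<sigma>) (s *\<^sub>R \<omega>)) \<le> (LINT \<omega>|lborel. ?E \<omega> * weight (- \<sigma>) (r *\<^sub>R \<omega>))"
      by (intro integral_mono iW mult_left_mono weight_scale_le \<sigma> r) auto
    ultimately have "(LINT \<omega>|lborel. ?E \<omega> * weight (- \<sigma>) (s *\<^sub>R \<omega>)) \<le> J * T / c"
      using c by (simp add: pos_le_divide_eq mult.commute[of _ c]) (meson c mult_left_mono order_trans less_imp_le)
    also have "\<dots> = I * J * R ^ DIM('a) / c / s ^ DIM('a) * (\<Sum>x\<in>X. (norm (\<alpha> x))\<^sup>2)"
      using r s R by (simp add: T_def r_def power_divide mult_ac)
    also have "\<dots> \<le> C / s ^ DIM('a) * (\<Sum>x\<in>X. (norm (\<alpha> x))\<^sup>2)"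
      using s by (intro mult_right_mono divide_right_mono) (auto simp: C_def intro: sum_nonneg)
    finally show ?thesis .
  qed
  ultimately show ?thesis by blast
qed

section \<open>The uniform interior cone property\<close>

text \<open>The truncated cone with axis \<open>e\<close> is described through its sections \<open>t *\<^sub>R e + ball 0 (\<theta> * t)\<close>; this makes it
  invariant under the multiples \<open>h, 2 h, \<dots>, m h\<close> of a step that occur in a difference.\<close>

definition cone_into :: "'a::euclidean_space set \<Rightarrow> real \<Rightarrow> real \<Rightarrow> 'a \<Rightarrow> 'a \<Rightarrow> bool" where
  "cone_into \<Omega> r \<theta> e x \<longleftrightarrow> (\<forall>t z. 0 < t \<longrightarrow> t \<le> r \<longrightarrow> norm z \<le> \<theta> * t \<longrightarrow> x + t *\<^sub>R e + z \<in> \<Omega>)"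

lemma cone_into_mono:
  fixes x :: "'a::euclidean_space"
  assumes "cone_into \<Omega> r \<theta> e x" "r' \<le> r" "\<theta>' \<le> \<theta>"
  shows "cone_into \<Omega> r' \<theta>' e x"
  unfolding cone_into_def
proof (intro allI impI)
  fix t and z :: 'a assume t: "0 < t" "t \<le> r'" and z: "norm z \<le> \<theta>' * t"
  have "norm z \<le> \<theta> * t"
    using order_trans[OF z mult_right_mono[OF assms(3)]] t by simp
  with t(1) order_trans[OF t(2) assms(2)] show "x + t *\<^sub>R e + z \<in> \<Omega>"
    using assms(1) unfolding cone_into_def by simp
qed

lemma norm_remove_component_le:
  fixes e z :: "'a::euclidean_space"
  assumes "norm e = 1"
  shows "norm (z - (z \<bullet> e) *\<^sub>R e) \<le> norm z"
proof -
  have "e \<bullet> e = 1" using assms by (simp add: norm_eq_1)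
  then have "(norm (z - (z \<bullet> e) *\<^sub>R e))\<^sup>2 = (norm z)\<^sup>2 - (z \<bullet> e)\<^sup>2"
    unfolding power2_norm_eq_inner
    by (simp add: inner_diff_left inner_diff_right power2_eq_square inner_commute )
  then have "(norm (z - (z \<bullet> e) *\<^sub>R e))\<^sup>2 \<le> (norm z)\<^sup>2" by simp
  then show ?thesis by (rule power2_le_imp_le) simp
qed

text \<open>Moving up by \<open>t\<close> and sideways by at most \<open>\<theta> t\<close> changes the graph function by at most \<open>L \<theta> t\<close>; with
  \<open>\<theta> = 1 / (2 (1 + L))\<close> the point stays above the graph.\<close>

lemma cone_into_near_graph:
  fixes e :: "'a::euclidean_space"
  assumes e: "norm e = 1" and lip: "L-lipschitz_on {z. z \<bullet> e = 0} \<gamma>" and \<rho>: "\<rho> > 0"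
    and graph: "\<Omega> \<inter> ball p \<rho> = {y \<in> ball p \<rho>. y \<bullet> e > \<gamma> (y - (y \<bullet> e) *\<^sub>R e)}"
    and x: "x \<in> \<Omega>" "x \<in> ball p (\<rho> / 2)"
  shows "cone_into \<Omega> (\<rho> / 4) (1 / (2 * (1 + L))) e x"
  unfolding cone_into_def
proof (intro allI impI)
  fix t and z :: 'a assume t: "0 < t" "t \<le> \<rho> / 4" and z: "norm z \<le> 1 / (2 * (1 + L)) * t"
  let ?P = "\<lambda>y. y - (y \<bullet> e) *\<^sub>R e"
  let ?y = "x + t *\<^sub>R e + z"
  have L: "L \<ge> 0" using lip by (rule lipschitz_on_nonneg)
  have ee: "e \<bullet> e = 1" using e by (simp add: dot_square_norm)
  have Lz: "(1 + L) * norm z \<le> t / 2"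
    using z L by (simp add: field_simps)
  have nz: "norm z \<le> t / 2"
    using Lz L mult_right_mono[of 1 "1 + L" "norm z"] by simp
  have "norm (?y - p) \<le> norm (x - p) + (norm (t *\<^sub>R e) + norm z)"
    using norm_triangle_ineq[of "x - p" "t *\<^sub>R e + z"] norm_triangle_ineq[of "t *\<^sub>R e" z] by (simp add: algebra_simps)
  also have "\<dots> < \<rho>"
    using x(2) t nz e by (simp add: dist_norm norm_minus_commute)
  finally have y: "?y \<in> ball p \<rho>" by (simp add: dist_norm norm_minus_commute)
  have "x \<in> \<Omega> \<inter> ball p \<rho>" using x \<rho> by auto
  then have gx: "x \<bullet> e > \<gamma> (?P x)" unfolding graph by simp
  have "dist (\<gamma> (?P ?y)) (\<gamma> (?P x)) \<le> L * dist (?P ?y) (?P x)"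
    by (rule lipschitz_onD[OF lip]) (auto simp: inner_diff_left ee)
  also have "dist (?P ?y) (?P x) = norm (?P z)"
  proof -
    have "?P ?y - ?P x = ?P z" by (simp add: inner_add_left ee algebra_simps)
    then show ?thesis by (simp only: dist_norm)
  qed
  also have "L * norm (?P z) \<le> L * norm z"
    using L norm_remove_component_le[OF e] by (rule mult_left_mono[rotated])
  finally have "\<gamma> (?P ?y) \<le> \<gamma> (?P x) + L * norm z" by (simp add: dist_real_def)
  also have "\<dots> < x \<bullet> e + L * norm z" using gx by simp
  also have "\<dots> \<le> x \<bullet> e + t - norm z"
    using Lz t by (simp add: algebra_simps)
  also have "\<dots> \<le> x \<bullet> e + t + z \<bullet> e"
    using Cauchy_Schwarz_ineq2[of z e] e by simp
  also have "\<dots> = ?y \<bullet> e" by (simp add: inner_add_left ee)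
  finally have "?y \<in> \<Omega> \<inter> ball p \<rho>" unfolding graph using y by simp
  then show "?y \<in> \<Omega>" by simp
qed

text \<open>Compactness of the closure reduces the directions to a finite set, so that estimates may be proved
  for one direction at a time and then added.\<close>

lemma uniform_cone:
  fixes \<Omega> :: "'a::euclidean_space set"
  assumes "bounded_lipschitz_domain \<Omega>"
  shows "\<exists>E r \<theta>. finite E \<and> (\<forall>e\<in>E. norm e = 1) \<and> 0 < r \<and> 0 < \<theta> \<and> \<theta> \<le> 1 \<and> (\<forall>x\<in>\<Omega>. \<exists>e\<in>E. cone_into \<Omega> r \<theta> e x)"
proof -
  have \<Omega>: "\<Omega> \<noteq> {}" "open \<Omega>" "bounded \<Omega>" "lipschitz_boundary \<Omega>"
    using assms by (auto simp: bounded_lipschitz_domain_def)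
  have "\<forall>p\<in>closure \<Omega>. \<exists>e r \<theta> s. norm e = 1 \<and> 0 < r \<and> 0 < \<theta> \<and> \<theta> \<le> 1 \<and> 0 < s \<and>
      (\<forall>x\<in>\<Omega> \<inter> ball p s. cone_into \<Omega> r \<theta> e x)"
  proof
    fix p assume p: "p \<in> closure \<Omega>"
    show "\<exists>e r \<theta> s. norm e = 1 \<and> 0 < r \<and> 0 < \<theta> \<and> \<theta> \<le> 1 \<and> 0 < s \<and> (\<forall>x\<in>\<Omega> \<inter> ball p s. cone_into \<Omega> r \<theta> e x)"
    proof (cases "p \<in> \<Omega>")
      case True
      then obtain \<epsilon> where \<epsilon>: "\<epsilon> > 0" "ball p \<epsilon> \<subseteq> \<Omega>" using \<Omega>(2) openE by blast
      obtain e :: 'a where e: "e \<in> Basis" using nonempty_Basis by blast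
      have "cone_into \<Omega> (\<epsilon> / 8) 1 e x" if x: "x \<in> ball p (\<epsilon> / 2)" for x
        unfolding cone_into_def
      proof (intro allI impI)
        fix t and z :: 'a assume t: "0 < t" "t \<le> \<epsilon> / 8" and z: "norm z \<le> 1 * t"
        have "norm (x + t *\<^sub>R e + z - p) \<le> norm (x - p) + (norm (t *\<^sub>R e) + norm z)"
          using norm_triangle_ineq[of "x - p" "t *\<^sub>R e + z"] norm_triangle_ineq[of "t *\<^sub>R e" z] by (simp add: algebra_simps)
        also have "\<dots> < \<epsilon>" using x t z e \<epsilon>(1) by (simp add: dist_norm norm_minus_commute)
        finally show "x + t *\<^sub>R e + z \<in> \<Omega>" using \<epsilon>(2) by (auto simp: dist_norm norm_minus_commute)
      qed
      then show ?thesis using \<epsilon>(1) e by (intro exI[of _ e] exI[of _ "\<epsilon>/8"] exI[of _ 1] exI[of _ "\<epsilon>/2"]) auto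
    next
      case False
      with p have "p \<in> frontier \<Omega>" using \<Omega>(2) by (simp add: frontier_def interior_open)
      from bspec[OF \<Omega>(4)[unfolded lipschitz_boundary_def] this]
      obtain \<rho> e L \<gamma> where \<rho>: "\<rho> > 0" "norm e = 1" "L-lipschitz_on {z. z \<bullet> e = 0} (\<gamma> :: 'a \<Rightarrow> real)"
          "\<Omega> \<inter> ball p \<rho> = {y \<in> ball p \<rho>. y \<bullet> e > \<gamma> (y - (y \<bullet> e) *\<^sub>R e)}"
        by (elim exE conjE) (rule that)
      have L: "L \<ge> 0" using \<rho>(3) by (rule lipschitz_on_nonneg)
      show ?thesis
        using cone_into_near_graph[OF \<rho>(2,3,1,4)] \<rho>(1,2) L
        by (intro exI[of _ e] exI[of _ "\<rho>/4"] exI[of _ "1 / (2 * (1 + L))"] exI[of _ "\<rho>/2"]) (auto simp: divide_le_eq)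
    qed
  qed
  then obtain e r \<theta> s where loc: "\<And>p. p \<in> closure \<Omega> \<Longrightarrow> norm (e p) = 1 \<and> 0 < r p \<and> 0 < \<theta> p \<and> \<theta> p \<le> 1 \<and> 0 < s p \<and>
      (\<forall>x\<in>\<Omega> \<inter> ball p (s p). cone_into \<Omega> (r p) (\<theta> p) (e p) x)"
    by metis
  have cpt: "compact (closure \<Omega>)" using \<Omega>(3) by (simp add: compact_closure)
  have cover: "closure \<Omega> \<subseteq> (\<Union>p\<in>closure \<Omega>. ball p (s p))"
  proof
    fix p assume p: "p \<in> closure \<Omega>"
    then have "p \<in> ball p (s p)" using loc[OF p] by simp
    with p show "p \<in> (\<Union>p\<in>closure \<Omega>. ball p (s p))" by (rule UN_I)
  qed
  obtain C where C: "C \<subseteq> closure \<Omega>" "finite C" "closure \<Omega> \<subseteq> (\<Union>p\<in>C. ball p (s p))"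
    by (rule compactE_image[where f = "\<lambda>p. ball p (s p)", OF cpt open_ball cover])
  have "C \<noteq> {}"
  proof
    assume "C = {}"
    with C(3) have "closure \<Omega> = {}" by simp
    with \<Omega>(1) show False by simp
  qed
  define r0 where "r0 = Min (r ` C)"
  define \<theta>0 where "\<theta>0 = Min (\<theta> ` C)"
  have pos: "r0 > 0" "\<theta>0 > 0" and min: "\<And>p. p \<in> C \<Longrightarrow> r0 \<le> r p" "\<And>p. p \<in> C \<Longrightarrow> \<theta>0 \<le> \<theta> p"
    unfolding r0_def \<theta>0_def using C loc \<open>C \<noteq> {}\<close> by (auto simp: subset_iff)
  obtain p0 where "p0 \<in> C" using \<open>C \<noteq> {}\<close> by blast
  then have "\<theta>0 \<le> \<theta> p0" "\<theta> p0 \<le> 1" using min(2) loc[of p0] C(1) by auto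
  then have le1: "\<theta>0 \<le> 1" by linarith
  have cone: "\<exists>e'\<in>e ` C. cone_into \<Omega> r0 \<theta>0 e' x" if x: "x \<in> \<Omega>" for x
  proof -
    obtain p where p: "p \<in> C" "x \<in> ball p (s p)"
      using C(3) x closure_subset by blast
    then have "cone_into \<Omega> (r p) (\<theta> p) (e p) x" using loc[of p] C(1) x by blast
    then have "cone_into \<Omega> r0 \<theta>0 (e p) x" using min[OF p(1)] by (rule cone_into_mono)
    then show ?thesis using p(1) by blast
  qed
  have unit: "\<forall>e'\<in>e ` C. norm e' = 1" using loc C(1) by blast
  show ?thesis
    by (intro exI[of _ "e ` C"] exI[of _ r0] exI[of _ \<theta>0] conjI unit pos le1 ballI cone finite_imageI C(2))
qed

section \<open>Finite differences and sampling\<close>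

text \<open>Functions in this class are bounded and square integrable, and inversion and Plancherel's identity hold
  for them without exceptional points. Trial functions and their differences belong to it.\<close>

definition ft_regular :: "('a::euclidean_space \<Rightarrow> complex) \<Rightarrow> bool" where
  "ft_regular f \<longleftrightarrow> continuous_on UNIV f \<and> integrable lborel f \<and> integrable lborel (ft f)"

lemma ft_regularD:
  assumes "ft_regular f"
  shows "continuous_on UNIV f" "integrable lborel f" "integrable lborel (ft f)"
    "integrable lborel (\<lambda>x. (norm (f x))\<^sup>2)" "f \<in> borel_measurable borel"
  using assms integrable_square_of_integrable_ft[of f] borel_measurable_integrable[of lborel f] by (auto simp: ft_regular_def)

definition fdiff :: "nat \<Rightarrow> 'a::euclidean_space \<Rightarrow> ('a \<Rightarrow> complex) \<Rightarrow> 'a \<Rightarrow> complex" where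
  "fdiff m h f x = (\<Sum>k\<le>m. (-1) ^ k * of_nat (m choose k) * f (x + real k *\<^sub>R h))"

lemma ft_fdiff:
  assumes "integrable lborel f"
  shows "ft (fdiff m h f) \<omega> = (1 - wave \<omega> (- h)) ^ m * ft f \<omega>"
proof -
  have pow: "wave \<omega> (- (real k *\<^sub>R h)) = wave \<omega> (- h) ^ k" for k
    by (simp add: wave_def exp_of_nat_mult[symmetric] algebra_simps)
  have "ft (fdiff m h f) \<omega> = (\<Sum>k\<le>m. (-1) ^ k * of_nat (m choose k) * ft (\<lambda>x. f (x + real k *\<^sub>R h)) \<omega>)"
    unfolding fdiff_def[abs_def]
    by (subst ft_sum) (auto simp: ft_cmult intro!: integrable_mult_right integrable_lborel_shift_iff[THEN iffD2, OF assms])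
  also have "\<dots> = (\<Sum>k\<le>m. of_nat (m choose k) * (- wave \<omega> (- h)) ^ k * 1 ^ (m - k)) * ft f \<omega>"
    unfolding sum_distrib_right ft_shift pow
    by (intro sum.cong refl) (simp add: power_minus[of "wave _ _"])
  also have "\<dots> = (- wave \<omega> (- h) + 1) ^ m * ft f \<omega>"
    by (simp only: binomial_ring)
  finally show ?thesis by simp
qed

lemma norm_one_minus_wave: "norm (1 - wave \<omega> x) \<le> 2" "norm (1 - wave \<omega> x) \<le> norm x * norm \<omega>"
proof -
  show "norm (1 - wave \<omega> x) \<le> 2"
    using norm_triangle_ineq4[of 1 "wave \<omega> x"] by simp
  have "norm (1 - wave \<omega> x) \<le> \<bar>x \<bullet> \<omega>\<bar>"
    using iexp_approx1[of "- (x \<bullet> \<omega>)" 0] by (simp add: wave_def norm_minus_commute)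
  also have "\<dots> \<le> norm x * norm \<omega>"
    by (rule Cauchy_Schwarz_ineq2)
  finally show "norm (1 - wave \<omega> x) \<le> norm x * norm \<omega>" .
qed

lemma ft_regular_fdiff:
  assumes f: "ft_regular f"
  shows "ft_regular (fdiff m h f)"
proof -
  note D = ft_regularD[OF f]
  have "continuous_on UNIV (fdiff m h f)"
    unfolding fdiff_def[abs_def]
    by (intro continuous_intros continuous_on_compose2[OF D(1)]) auto
  moreover have i: "integrable lborel (fdiff m h f)"
    unfolding fdiff_def[abs_def]
    by (intro Bochner_Integration.integrable_sum integrable_mult_right integrable_lborel_shift_iff[THEN iffD2, OF D(2)])
  moreover have "integrable lborel (ft (fdiff m h f))"
  proof (rule Bochner_Integration.integrable_bound)
    show "integrable lborel (\<lambda>\<omega>. 2 ^ m * norm (ft f \<omega>))" using D(3) by simp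
    have [measurable]: "fdiff m h f \<in> borel_measurable borel"
      using borel_measurable_integrable[OF i] by simp
    show "ft (fdiff m h f) \<in> borel_measurable lborel" by simp
    show "AE \<omega> in lborel. norm (ft (fdiff m h f) \<omega>) \<le> norm (2 ^ m * norm (ft f \<omega>))"
      by (intro AE_I2) (simp add: ft_fdiff[OF D(2)] norm_mult norm_power mult_right_mono power_mono norm_one_minus_wave(1))
  qed
  ultimately show ?thesis by (simp add: ft_regular_def)
qed

text \<open>The one-variable inequality behind every use of differences and of the mollifier. There
  \<open>z\<close> is the modulus of \<open>1 - e\<^bsup>i h \<omega>\<^esup>\<close> or its bound \<open>min 2 s\<close>, and \<open>s\<close> is the scaled frequency. The
  factor \<open>z\<^bsup>2m\<^esup>\<close> turns a
  Bessel weight of order \<open>\<tau> \<le> \<sigma>\<close> into the homogeneous weight of order \<open>\<sigma>\<close>: for \<open>s \<le> 1\<close> through the zero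
  of order \<open>m \<ge> \<sigma>\<close>, for \<open>s > 1\<close> because \<open>\<tau> \<le> \<sigma>\<close>.\<close>

lemma difference_symbol_bound:
  fixes s z \<tau> \<sigma> :: real
  assumes \<tau>: "0 \<le> \<tau>" "\<tau> \<le> \<sigma>" and m: "\<sigma> \<le> real m" "1 \<le> m" and z: "0 \<le> z" "z \<le> 2" "z \<le> s"
  shows "(1 + s\<^sup>2) powr \<tau> * z ^ (2 * m) \<le> 2 powr \<tau> * 4 ^ m * s powr (2 * \<sigma>)"
proof (cases "s \<le> 1")
  case True
  have "z ^ (2 * m) \<le> s powr (2 * \<sigma>)"
  proof (cases "s = 0")
    case False
    with z have s: "0 < s" by simp
    have "z ^ (2 * m) \<le> s ^ (2 * m)" using z by (intro power_mono) auto
    also have "\<dots> = s powr (real (2 * m))" using s by (rule powr_realpow[symmetric])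
    also have "\<dots> \<le> s powr (2 * \<sigma>)" using s True m by (intro powr_mono') auto
    finally show ?thesis .
  qed (use z m in \<open>auto simp: power_0_left\<close>)
  moreover have "(1 + s\<^sup>2) powr \<tau> \<le> 2 powr \<tau>"
    using True z \<tau> power_mono[of s 1 2] by (intro powr_mono2) auto
  ultimately have "(1 + s\<^sup>2) powr \<tau> * z ^ (2 * m) \<le> 2 powr \<tau> * s powr (2 * \<sigma>)"
    using z by (intro mult_mono) auto
  also have "\<dots> \<le> 2 powr \<tau> * 4 ^ m * s powr (2 * \<sigma>)"
    using one_le_power[of "4::real" m] by (intro mult_right_mono) (auto simp: mult_le_cancel_left1)
  finally show ?thesis .
next
  case False
  have "(1 + s\<^sup>2) powr \<tau> \<le> (2 * s\<^sup>2) powr \<tau>"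
    using False \<tau> one_le_power[of s 2] by (intro powr_mono2) auto
  also have "\<dots> = 2 powr \<tau> * s powr (2 * \<tau>)"
    using False by (subst powr_powr[symmetric]) (simp add: powr_mult)
  also have "\<dots> \<le> 2 powr \<tau> * s powr (2 * \<sigma>)"
    using False \<tau> by (intro mult_left_mono powr_mono) auto
  finally have 1: "(1 + s\<^sup>2) powr \<tau> \<le> 2 powr \<tau> * s powr (2 * \<sigma>)" .
  have "z ^ (2 * m) \<le> 2 ^ (2 * m)" using z by (intro power_mono) auto
  also have "(2::real) ^ (2 * m) = 4 ^ m" by (simp add: power_mult)
  finally have "(1 + s\<^sup>2) powr \<tau> * z ^ (2 * m) \<le> 2 powr \<tau> * s powr (2 * \<sigma>) * 4 ^ m"
    using 1 z by (intro mult_mono) auto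
  then show ?thesis by (simp add: mult_ac)
qed

text \<open>The integral of this density is the squared homogeneous Sobolev seminorm of order \<open>\<sigma>\<close>, in the unnormalised transform.\<close>

definition energy_density :: "real \<Rightarrow> ('a::euclidean_space \<Rightarrow> complex) \<Rightarrow> 'a \<Rightarrow> real" where
  "energy_density \<sigma> f \<omega> = (norm (ft f \<omega>))\<^sup>2 * norm \<omega> powr (2 * \<sigma>)"

definition energy :: "real \<Rightarrow> ('a::euclidean_space \<Rightarrow> complex) \<Rightarrow> real" where
  "energy \<sigma> f = (LINT \<omega>|lborel. energy_density \<sigma> f \<omega>)"

lemma energy_nonneg: "energy \<sigma> f \<ge> 0"
  unfolding energy_def energy_density_def by (intro integral_nonneg_AE) simp

lemma weight_minus: "weight (- s) \<omega> = 1 / weight s \<omega>"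
  by (simp add: weight_def powr_minus_divide)

lemma weight_0 [simp]: "weight 0 \<omega> = 1"
proof -
  have "1 + (norm \<omega>)\<^sup>2 \<noteq> 0" using one_le_one_plus_square(2)[of "norm \<omega>"] by linarith
  then show ?thesis by (simp add: weight_def)
qed

lemma fdiff_density_le:
  assumes f: "integrable lborel f" and \<tau>: "0 \<le> \<tau>" "\<tau> \<le> \<sigma>" and m: "\<sigma> \<le> real m" "1 \<le> m" and \<rho>: "norm h \<le> \<rho>"
  shows "(norm (ft (fdiff m h f) \<omega>))\<^sup>2 * weight \<tau> (\<rho> *\<^sub>R \<omega>) \<le> 2 powr \<tau> * 4 ^ m * \<rho> powr (2 * \<sigma>) * energy_density \<sigma> f \<omega>"
proof -
  have \<rho>0: "\<rho> \<ge> 0" using \<rho> norm_ge_zero order_trans by blast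
  define z where "z = norm (1 - wave \<omega> (- h))"
  have z: "0 \<le> z" "z \<le> 2" "z \<le> \<rho> * norm \<omega>"
    using norm_one_minus_wave[of \<omega> "- h"] mult_right_mono[OF \<rho>, of "norm \<omega>"] unfolding z_def by auto
  have "(norm (ft (fdiff m h f) \<omega>))\<^sup>2 * weight \<tau> (\<rho> *\<^sub>R \<omega>) = ((1 + (\<rho> * norm \<omega>)\<^sup>2) powr \<tau> * z ^ (2 * m)) * (norm (ft f \<omega>))\<^sup>2"
    unfolding ft_fdiff[OF f] norm_mult norm_power z_def[symmetric] weight_def
    using \<rho>0 by (simp add: power_mult_distrib power_mult[symmetric] mult.commute[of m])
  also have "\<dots> \<le> (2 powr \<tau> * 4 ^ m * (\<rho> * norm \<omega>) powr (2 * \<sigma>)) * (norm (ft f \<omega>))\<^sup>2"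
    by (intro mult_right_mono difference_symbol_bound \<tau> m z) auto
  also have "\<dots> = 2 powr \<tau> * 4 ^ m * \<rho> powr (2 * \<sigma>) * energy_density \<sigma> f \<omega>"
    using \<rho>0 by (simp add: energy_density_def powr_mult)
  finally show ?thesis .
qed

lemma two_pi_power_ge_1: "1 \<le> (2 * pi) ^ n"
  by (rule one_le_power) (use pi_ge_two in simp)

lemma integral_fdiff_square_le:
  fixes f :: "'a::euclidean_space \<Rightarrow> complex"
  assumes f: "ft_regular f" and e: "integrable lborel (energy_density \<sigma> f)" and \<sigma>: "0 \<le> \<sigma>" and m: "\<sigma> \<le> real m" "1 \<le> m"
  shows "(LINT x|lborel. (norm (fdiff m h f x))\<^sup>2) \<le> 4 ^ m * norm h powr (2 * \<sigma>) * energy \<sigma> f"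
proof -
  note D = ft_regularD[OF ft_regular_fdiff[OF f, of m h]]
  have "(LINT x|lborel. (norm (fdiff m h f x))\<^sup>2) = (LINT \<omega>|lborel. (norm (ft (fdiff m h f) \<omega>))\<^sup>2) / (2 * pi) ^ DIM('a)"
    by (rule plancherel_eq[OF D(2,1,3)])
  also have "\<dots> \<le> (LINT \<omega>|lborel. (norm (ft (fdiff m h f) \<omega>))\<^sup>2) / 1"
    by (intro divide_left_mono integral_nonneg_AE two_pi_power_ge_1) auto
  also have "\<dots> \<le> (LINT \<omega>|lborel. 4 ^ m * norm h powr (2 * \<sigma>) * energy_density \<sigma> f \<omega>)"
    unfolding div_by_1
  proof (rule integral_mono)
    show "integrable lborel (\<lambda>\<omega>. (norm (ft (fdiff m h f) \<omega>))\<^sup>2)"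
      by (rule plancherel_integrable[OF D(2,4)])
    show "(norm (ft (fdiff m h f) \<omega>))\<^sup>2 \<le> 4 ^ m * norm h powr (2 * \<sigma>) * energy_density \<sigma> f \<omega>" for \<omega>
      using fdiff_density_le[OF ft_regularD(2)[OF f] order_refl \<sigma> m order_refl, of h \<omega>] by simp
  qed (use e in simp)
  also have "\<dots> = 4 ^ m * norm h powr (2 * \<sigma>) * energy \<sigma> f"
    unfolding energy_def by (rule integral_mult_right_zero)
  finally show ?thesis .
qed

lemma integral_ft_expsum:
  fixes f :: "'a::euclidean_space \<Rightarrow> complex"
  assumes f: "ft_regular f"
  shows "(LINT \<omega>|lborel. ft f \<omega> * cnj (expsum X \<beta> \<omega>)) = (2 * pi) ^ DIM('a) * (\<Sum>x\<in>X. cnj (\<beta> x) * f x)"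
proof -
  note D = ft_regularD[OF f]
  have inv: "(LINT \<omega>|lborel. ft f \<omega> * wave \<omega> (- x)) = (2 * pi) ^ DIM('a) * f x" for x
    using D by (intro fourier_inversion) (simp_all add: continuous_on_eq_continuous_at)
  have "(LINT \<omega>|lborel. ft f \<omega> * cnj (expsum X \<beta> \<omega>)) = (LINT \<omega>|lborel. (\<Sum>x\<in>X. cnj (\<beta> x) * (ft f \<omega> * wave \<omega> (- x))))"
    by (simp add: expsum_def cnj_wave(1) sum_distrib_left mult_ac)
  also have "\<dots> = (\<Sum>x\<in>X. cnj (\<beta> x) * (LINT \<omega>|lborel. ft f \<omega> * wave \<omega> (- x)))"
    using integrable_mult_wave[of "ft f"] D(3)
    by (subst Bochner_Integration.integral_sum) (auto simp: wave_commute[of _ "- _"])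
  finally show ?thesis by (simp add: inv sum_distrib_left mult_ac)
qed

text \<open>Used with a \<open>c\<close> that makes one of the terms absorbable; it replaces the Cauchy-Schwarz inequality for
  integrals and sums.\<close>

lemma weighted_am_gm:
  fixes a b c :: real
  assumes "c > 0"
  shows "a * b \<le> c / 2 * a\<^sup>2 + b\<^sup>2 / (2 * c)"
proof -
  have "2 * c * (a * b) \<le> (c * a)\<^sup>2 + b\<^sup>2"
    using sum_squares_bound[of "c * a" b] by (simp add: mult_ac)
  then show ?thesis
    using assms by (simp add: field_simps power2_eq_square)
qed

text \<open>The dual of \<open>integral_expsum_le_sum\<close>: the sum of squares is the pairing of \<open>ft f\<close> with the exponential
  sum whose coefficients are the samples themselves, and half of the sum is absorbed.\<close>

lemma sampling:
  assumes \<sigma>: "\<sigma> \<ge> 0" and W: "integrable lborel (weight (- \<sigma>) :: 'a::euclidean_space \<Rightarrow> real)"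
  shows "\<exists>C>0. \<forall>\<rho> X f. finite X \<longrightarrow> 0 < \<rho> \<longrightarrow> separated \<rho> X \<longrightarrow> ft_regular f \<longrightarrow>
     integrable lborel (\<lambda>\<omega>::'a. (norm (ft f \<omega>))\<^sup>2 * weight \<sigma> (\<rho> *\<^sub>R \<omega>)) \<longrightarrow>
     (\<Sum>x\<in>X. (norm (f x))\<^sup>2) \<le> C / \<rho> ^ DIM('a) * (LINT \<omega>|lborel. (norm (ft f \<omega>))\<^sup>2 * weight \<sigma> (\<rho> *\<^sub>R \<omega>))"
proof -
  obtain C where C: "C > 0" and bessel: "\<And>s X \<alpha>. finite X \<Longrightarrow> 0 < s \<Longrightarrow> separated s X \<Longrightarrow>
     (LINT \<omega>::'a|lborel. (norm (expsum X \<alpha> \<omega>))\<^sup>2 * weight (- \<sigma>) (s *\<^sub>R \<omega>)) \<le> C / s ^ DIM('a) * (\<Sum>x\<in>X. (norm (\<alpha> x))\<^sup>2)"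
    using integral_expsum_le_sum[OF \<sigma> W] by blast
  have "(\<Sum>x\<in>X. (norm (f x))\<^sup>2) \<le> C / \<rho> ^ DIM('a) * (LINT \<omega>|lborel. (norm (ft f \<omega>))\<^sup>2 * weight \<sigma> (\<rho> *\<^sub>R \<omega>))"
    if X: "finite X" and \<rho>: "0 < \<rho>" and sep: "separated \<rho> X" and f: "ft_regular f"
      and i: "integrable lborel (\<lambda>\<omega>::'a. (norm (ft f \<omega>))\<^sup>2 * weight \<sigma> (\<rho> *\<^sub>R \<omega>))" for \<rho> X f
  proof -
    define S where "S = (\<Sum>x\<in>X. (norm (f x))\<^sup>2)"
    define A where "A = (LINT \<omega>|lborel. (norm (ft f \<omega>))\<^sup>2 * weight \<sigma> (\<rho> *\<^sub>R \<omega>))"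
    define B where "B = (LINT \<omega>|lborel. (norm (expsum X f \<omega>))\<^sup>2 * weight (- \<sigma>) (\<rho> *\<^sub>R \<omega>))"
    define K where "K = C / \<rho> ^ DIM('a)"
    have K: "K > 0" using C \<rho> by (simp add: K_def)
    have BS: "B \<le> K * S" unfolding B_def K_def S_def by (rule bessel[OF X \<rho> sep])
    have A0: "A \<ge> 0" unfolding A_def by (intro integral_nonneg_AE) simp
    have iB: "integrable lborel (\<lambda>\<omega>. (norm (expsum X f \<omega>))\<^sup>2 * weight (- \<sigma>) (\<rho> *\<^sub>R \<omega>))"
      by (intro integrable_expsum_square weight_scaled_integrable W \<rho>)
    note D = ft_regularD[OF f]
    have [measurable]: "f \<in> borel_measurable borel" by (rule D)
    have S0: "S \<ge> 0" unfolding S_def by (intro sum_nonneg) simp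
    have "(2 * pi) ^ DIM('a) * complex_of_real S = (LINT \<omega>|lborel. ft f \<omega> * cnj (expsum X f \<omega>))"
      unfolding integral_ft_expsum[OF f] S_def of_real_sum complex_norm_square by (simp add: mult.commute)
    moreover have "norm ((2 * pi) ^ DIM('a) * complex_of_real S) = (2 * pi) ^ DIM('a) * S"
      using S0 by (simp add: norm_mult norm_power)
    ultimately have "(2 * pi) ^ DIM('a) * S = norm (LINT \<omega>|lborel. ft f \<omega> * cnj (expsum X f \<omega>))"
      by simp
    moreover have "S \<le> (2 * pi) ^ DIM('a) * S"
      using mult_right_mono[OF two_pi_power_ge_1 S0] by simp
    ultimately have "S \<le> norm (LINT \<omega>|lborel. ft f \<omega> * cnj (expsum X f \<omega>))" by simp
    also have "\<dots> \<le> (LINT \<omega>|lborel. K / 2 * ((norm (ft f \<omega>))\<^sup>2 * weight \<sigma> (\<rho> *\<^sub>R \<omega>)) +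
         (norm (expsum X f \<omega>))\<^sup>2 * weight (- \<sigma>) (\<rho> *\<^sub>R \<omega>) / (2 * K))"
    proof (rule Bochner_Integration.integral_norm_bound_integral)
      have "integrable lborel (\<lambda>\<omega>. (\<Sum>x\<in>X. norm (f x)) * norm (ft f \<omega>))" using D(3) by simp
      then show "integrable lborel (\<lambda>\<omega>. ft f \<omega> * cnj (expsum X f \<omega>))"
        by (rule Bochner_Integration.integrable_bound)
           (auto simp: norm_mult abs_mult mult.commute intro!: AE_I2 mult_left_mono order_trans[OF norm_expsum_le])
      show "integrable lborel (\<lambda>\<omega>. K / 2 * ((norm (ft f \<omega>))\<^sup>2 * weight \<sigma> (\<rho> *\<^sub>R \<omega>)) +
         (norm (expsum X f \<omega>))\<^sup>2 * weight (- \<sigma>) (\<rho> *\<^sub>R \<omega>) / (2 * K))"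
        using i iB by simp
      fix \<omega> :: 'a
      define u where "u = weight \<sigma> (\<rho> *\<^sub>R \<omega>)"
      have u: "u > 0" "weight (- \<sigma>) (\<rho> *\<^sub>R \<omega>) = 1 / u" by (simp_all add: u_def weight_minus)
      have "norm (ft f \<omega> * cnj (expsum X f \<omega>)) \<le> (K * u) / 2 * (norm (ft f \<omega>))\<^sup>2 + (norm (expsum X f \<omega>))\<^sup>2 / (2 * (K * u))"
        unfolding norm_mult complex_mod_cnj using K u(1) by (intro weighted_am_gm) simp
      then show "norm (ft f \<omega> * cnj (expsum X f \<omega>)) \<le> K / 2 * ((norm (ft f \<omega>))\<^sup>2 * weight \<sigma> (\<rho> *\<^sub>R \<omega>)) +
         (norm (expsum X f \<omega>))\<^sup>2 * weight (- \<sigma>) (\<rho> *\<^sub>R \<omega>) / (2 * K)"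
        unfolding u(2) u_def[symmetric] by (simp add: mult_ac)
    qed
    also have "\<dots> = K / 2 * A + B / (2 * K)"
      using i iB by (simp add: A_def B_def)
    also have "\<dots> \<le> K / 2 * A + S / 2"
      using BS K by (simp add: field_simps)
    finally show ?thesis by (simp add: S_def A_def K_def)
  qed
  with C show ?thesis by blast
qed

section \<open>Estimates up to the boundary\<close>

text \<open>The term \<open>k = 0\<close> of the difference is \<open>f x\<close> itself, so \<open>f x\<close> is the difference minus the remaining terms.\<close>

lemma square_le_fdiff:
  fixes f :: "'a::euclidean_space \<Rightarrow> complex"
  shows "(norm (f x))\<^sup>2 \<le> 2 * (norm (fdiff m h f x))\<^sup>2 + 2 * real m * 4 ^ m * (\<Sum>k\<in>{1..m}. (norm (f (x + real k *\<^sub>R h)))\<^sup>2)"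
proof -
  define R where "R = (\<Sum>k\<in>{1..m}. (-1) ^ k * of_nat (m choose k) * f (x + real k *\<^sub>R h))"
  have "{..m} = insert 0 {1..m}" by auto
  then have "fdiff m h f x = f x + R" by (simp add: fdiff_def R_def)
  then have fx: "f x = fdiff m h f x + (- R)" by simp
  have "norm R \<le> (\<Sum>k\<in>{1..m}. 2 ^ m * norm (f (x + real k *\<^sub>R h)))"
    unfolding R_def
  proof (rule sum_norm_le)
    fix k assume "k \<in> {1..m}"
    have "real (m choose k) \<le> 2 ^ m" using binomial_le_pow2[of m k] by (metis of_nat_le_iff of_nat_power of_nat_numeral)
    then show "norm ((-1) ^ k * of_nat (m choose k) * f (x + real k *\<^sub>R h)) \<le> 2 ^ m * norm (f (x + real k *\<^sub>R h))"
      by (simp add: norm_mult norm_power mult_right_mono)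
  qed
  then have "(norm R)\<^sup>2 \<le> (\<Sum>k\<in>{1..m}. 2 ^ m * norm (f (x + real k *\<^sub>R h)))\<^sup>2"
    by (intro power_mono) auto
  also have "\<dots> \<le> (\<Sum>k\<in>{1..m}. (2 ^ m * norm (f (x + real k *\<^sub>R h)))\<^sup>2) * real (card {1..m})"
    by (rule sum_squared_le_sum_of_squares)
  also have "\<dots> = real m * 4 ^ m * (\<Sum>k\<in>{1..m}. (norm (f (x + real k *\<^sub>R h)))\<^sup>2)"
    by (simp add: power_mult_distrib sum_distrib_left[symmetric] power_mult[symmetric] mult.commute[of m 2])
       (simp add: power_mult)
  finally have R: "(norm R)\<^sup>2 \<le> real m * 4 ^ m * (\<Sum>k\<in>{1..m}. (norm (f (x + real k *\<^sub>R h)))\<^sup>2)" .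
  have "(norm (f x))\<^sup>2 \<le> 2 * (norm (fdiff m h f x))\<^sup>2 + 2 * (norm R)\<^sup>2"
    unfolding fx using power2_norm_triangle[of "fdiff m h f x" "- R"] by simp
  with R show ?thesis by simp
qed

definition mass_on :: "'a::euclidean_space set \<Rightarrow> ('a \<Rightarrow> complex) \<Rightarrow> real" where
  "mass_on \<Omega> f = (LINT x|lborel. indicator \<Omega> x * (norm (f x))\<^sup>2)"

lemma mass_on_nonneg: "mass_on \<Omega> f \<ge> 0"
  unfolding mass_on_def by (intro integral_nonneg_AE) simp

lemma integrable_mass_on:
  assumes "integrable lborel (\<lambda>x. (norm (f x))\<^sup>2)" "\<Omega> \<in> sets borel"
  shows "integrable lborel (\<lambda>x. indicator \<Omega> x * (norm (f x))\<^sup>2)"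
  using integrable_mult_indicator[OF _ assms(1), of \<Omega>] assms(2) by simp

lemma sum_le_sum_cover:
  fixes g :: "'a \<Rightarrow> real"
  assumes "finite X" "finite E" "\<And>x. x \<in> X \<Longrightarrow> \<exists>e\<in>E. P e x" "\<And>x. x \<in> X \<Longrightarrow> g x \<ge> 0"
  shows "(\<Sum>x\<in>X. g x) \<le> (\<Sum>e\<in>E. \<Sum>x | x \<in> X \<and> P e x. g x)"
proof -
  have "(\<Sum>x\<in>X. g x) \<le> (\<Sum>x\<in>X. \<Sum>e\<in>E. if P e x then g x else 0)"
  proof (rule sum_mono)
    fix x assume x: "x \<in> X"
    then obtain e where e: "e \<in> E" "P e x" using assms(3) by blast
    have "g x = (if P e x then g x else 0)" using e by simp
    also have "\<dots> \<le> (\<Sum>e\<in>E. if P e x then g x else 0)"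
      by (rule member_le_sum[OF e(1)]) (use assms x in auto)
    finally show "g x \<le> (\<Sum>e\<in>E. if P e x then g x else 0)" .
  qed
  also have "\<dots> = (\<Sum>e\<in>E. \<Sum>x\<in>X. if P e x then g x else 0)" by (rule sum.swap)
  also have "\<dots> = (\<Sum>e\<in>E. \<Sum>x | x \<in> X \<and> P e x. g x)"
    using assms(1) by (simp add: sum.inter_filter)
  finally show ?thesis .
qed

lemma separated_mono: "separated s X \<Longrightarrow> s' \<le> s \<Longrightarrow> separated s' X"
  unfolding separated_def by force

lemma separated_subset: "separated s X \<Longrightarrow> Y \<subseteq> X \<Longrightarrow> separated s Y"
  unfolding separated_def by blast

text \<open>Substituting \<open>y = x + k h\<close> maps \<open>D\<close> onto sets around the points of \<open>X\<close> that lie in \<open>\<Omega>\<close> and, by the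
  separation, do not overlap. The Jacobian \<open>k\<^bsup>-d\<^esup>\<close> is at most \<open>1\<close> and is dropped.\<close>

lemma sum_integral_dilated_le_mass_on:
  fixes f :: "'a::euclidean_space \<Rightarrow> complex"
  assumes f2: "integrable lborel (\<lambda>x. (norm (f x))\<^sup>2)" and \<Omega>: "\<Omega> \<in> sets borel" and D: "D \<in> sets borel"
    and X: "finite X" and k: "k \<ge> 1"
    and sub: "\<And>x h. x \<in> X \<Longrightarrow> h \<in> D \<Longrightarrow> x + k *\<^sub>R h \<in> \<Omega>"
    and small: "\<And>h. h \<in> D \<Longrightarrow> norm (k *\<^sub>R h) < s" and sep: "separated (2 * s) X"
  shows "\<And>x. x \<in> X \<Longrightarrow> integrable lborel (\<lambda>h. indicator D h * (norm (f (x + k *\<^sub>R h)))\<^sup>2)"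
    and "(\<Sum>x\<in>X. LINT h|lborel. indicator D h * (norm (f (x + k *\<^sub>R h)))\<^sup>2) \<le> mass_on \<Omega> f"
proof -
  have k0: "k \<noteq> 0" "k > 0" using k by auto
  let ?F = "\<lambda>x y. indicator D ((y - x) /\<^sub>R k) * (norm (f y))\<^sup>2"
  have iF: "integrable lborel (?F x)" for x
  proof -
    have [measurable]: "D \<in> sets borel" by (rule D)
    have "(\<lambda>y. (y - x) /\<^sub>R k) -` D \<inter> space borel \<in> sets borel"
      by (rule measurable_sets[OF _ D]) measurable
    then have "integrable lborel (\<lambda>y. indicator ((\<lambda>y. (y - x) /\<^sub>R k) -` D) y * (norm (f y))\<^sup>2)"
      by (intro integrable_mass_on f2) simp
    then show ?thesis by (simp add: indicator_def of_bool_def)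
  qed
  have eq: "(\<lambda>h. indicator D h * (norm (f (x + k *\<^sub>R h)))\<^sup>2) = (\<lambda>h. ?F x (x + k *\<^sub>R h))" for x
    using k0 by simp
  show "integrable lborel (\<lambda>h. indicator D h * (norm (f (x + k *\<^sub>R h)))\<^sup>2)" for x
    unfolding eq using iF[of x] k0(1) by (subst integrable_lborel_affine_iff)
  have "(LINT h|lborel. indicator D h * (norm (f (x + k *\<^sub>R h)))\<^sup>2) \<le> (LINT y|lborel. ?F x y)" for x
  proof -
    have "(LINT h|lborel. indicator D h * (norm (f (x + k *\<^sub>R h)))\<^sup>2) = (LINT y|lborel. ?F x y) /\<^sub>R \<bar>k\<bar> ^ DIM('a)"
      unfolding eq by (rule integral_lborel_affine[OF k0(1)])
    also have "\<dots> = (LINT y|lborel. ?F x y) / k ^ DIM('a)"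
      using k0 by (simp add: divide_inverse mult.commute)
    also have "\<dots> \<le> (LINT y|lborel. ?F x y) / 1"
      by (intro divide_left_mono integral_nonneg_AE) (use k k0 in \<open>auto intro: one_le_power\<close>)
    finally show ?thesis by simp
  qed
  then have "(\<Sum>x\<in>X. LINT h|lborel. indicator D h * (norm (f (x + k *\<^sub>R h)))\<^sup>2) \<le> (\<Sum>x\<in>X. LINT y|lborel. ?F x y)"
    by (rule sum_mono)
  also have "\<dots> = (LINT y|lborel. (\<Sum>x\<in>X. ?F x y))"
    using iF by (simp add: Bochner_Integration.integral_sum)
  also have "\<dots> \<le> mass_on \<Omega> f"
    unfolding mass_on_def
  proof (rule integral_mono)
    show "integrable lborel (\<lambda>y. \<Sum>x\<in>X. ?F x y)" using iF by simp
    show "integrable lborel (\<lambda>x. indicator \<Omega> x * (norm (f x))\<^sup>2)" by (rule integrable_mass_on[OF f2 \<Omega>])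
    fix y
    \<comment> \<open>The sets \<open>x + k *\<^sub>R D\<close> are pairwise disjoint, so at most one summand is nonzero.\<close>
    have "(\<Sum>x\<in>X. indicator D ((y - x) /\<^sub>R k)) \<le> (indicator \<Omega> y :: real)"
    proof (cases "\<exists>x\<in>X. (y - x) /\<^sub>R k \<in> D")
      case True
      then obtain x0 where x0: "x0 \<in> X" "(y - x0) /\<^sub>R k \<in> D" by blast
      have y: "y \<in> \<Omega>" using sub[OF x0] k0 by simp
      have "(y - x) /\<^sub>R k \<notin> D" if x: "x \<in> X" "x \<noteq> x0" for x
      proof
        assume "(y - x) /\<^sub>R k \<in> D"
        then have "norm (y - x) < s" using small k0 by fastforce
        moreover have "norm (y - x0) < s" using small[OF x0(2)] k0 by simp
        ultimately have "norm (x - x0) < 2 * s"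
          using norm_triangle_ineq4[of "y - x0" "y - x"] by simp
        with sep x x0(1) show False unfolding separated_def by force
      qed
      then have "(\<Sum>x\<in>X. indicator D ((y - x) /\<^sub>R k)) = (\<Sum>x\<in>X. if x = x0 then 1 else (0::real))"
        using x0 by (intro sum.cong) (auto simp: indicator_def)
      then show ?thesis using X x0 y by simp
    next
      case False
      then show ?thesis by (simp add: indicator_def)
    qed
    then show "(\<Sum>x\<in>X. ?F x y) \<le> indicator \<Omega> y * (norm (f y))\<^sup>2"
      unfolding sum_distrib_right[symmetric] by (intro mult_right_mono) auto
  qed
  finally show "(\<Sum>x\<in>X. LINT h|lborel. indicator D h * (norm (f (x + k *\<^sub>R h)))\<^sup>2) \<le> mass_on \<Omega> f" .
qed

lemma cone_intoD:
  "cone_into \<Omega> r \<theta> e x \<Longrightarrow> 0 < t \<Longrightarrow> t \<le> r \<Longrightarrow> norm z \<le> \<theta> * t \<Longrightarrow> x + t *\<^sub>R e + z \<in> \<Omega>"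
  unfolding cone_into_def by blast

text \<open>For one direction \<open>e\<close>, the inequality \<open>square_le_fdiff\<close> is averaged over the steps \<open>h\<close> in the ball
  \<open>D\<close> of radius \<open>\<theta> \<rho> / 2\<close> around \<open>(\<rho> / 2) *\<^sub>R e\<close>. These steps have norm below \<open>\<rho>\<close>, so the differences are
  handled by \<open>sampling\<close> at scale \<open>\<rho>\<close>, uniformly in \<open>h\<close>; the translates stay in \<open>\<Omega>\<close>, and averaging
  turns their point values into integrals over \<open>\<Omega>\<close>.\<close>

lemma sampling_in_cones:
  fixes E :: "'a::euclidean_space set"
  assumes \<sigma>: "\<sigma> \<ge> 0" and W: "integrable lborel (weight (- \<sigma>) :: 'a \<Rightarrow> real)"
    and m: "\<sigma> \<le> real m" "1 \<le> m" and E: "finite E" "\<And>e. e \<in> E \<Longrightarrow> norm e = 1" and \<theta>: "0 < \<theta>" "\<theta> \<le> 1"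
  shows "\<exists>C>0. \<forall>\<rho> X \<Omega> f. finite X \<longrightarrow> 0 < \<rho> \<longrightarrow> real m * \<rho> \<le> r \<longrightarrow> separated (2 * (real m * \<rho>)) X \<longrightarrow> open \<Omega> \<longrightarrow>
     (\<forall>x\<in>X. \<exists>e\<in>E. cone_into \<Omega> r \<theta> e x) \<longrightarrow> ft_regular f \<longrightarrow> integrable lborel (energy_density \<sigma> f) \<longrightarrow>
     (\<Sum>x\<in>X. (norm (f x))\<^sup>2) \<le> C / \<rho> ^ DIM('a) * (\<rho> powr (2 * \<sigma>) * energy \<sigma> f + mass_on \<Omega> f)"
proof -
  obtain C where C: "C > 0" and samp: "\<And>\<rho> X f. finite X \<Longrightarrow> 0 < \<rho> \<Longrightarrow> separated \<rho> X \<Longrightarrow> ft_regular f \<Longrightarrow>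
     integrable lborel (\<lambda>\<omega>::'a. (norm (ft f \<omega>))\<^sup>2 * weight \<sigma> (\<rho> *\<^sub>R \<omega>)) \<Longrightarrow>
     (\<Sum>x\<in>X. (norm (f x))\<^sup>2) \<le> C / \<rho> ^ DIM('a) * (LINT \<omega>|lborel. (norm (ft f \<omega>))\<^sup>2 * weight \<sigma> (\<rho> *\<^sub>R \<omega>))"
    using sampling[OF \<sigma> W] by blast
  define V where "V = measure lborel (ball (0::'a) (\<theta> / 2))"
  have V: "V > 0" using \<theta> by (simp add: V_def content_ball)
  define M where "M = 2 * real m * 4 ^ m"
  have M: "M \<ge> 0" by (simp add: M_def)
  define A where "A = 2 * (C * (2 powr \<sigma> * 4 ^ m))"
  have A: "A > 0" using C by (simp add: A_def)
  define B where "B = M * real m / V"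
  have B: "B \<ge> 0" using M V by (simp add: B_def)
  define K where "K = real (card E) * (A + B) + 1"
  have "K > 0" using A B by (simp add: K_def add_nonneg_pos)
  moreover have "(\<Sum>x\<in>X. (norm (f x))\<^sup>2) \<le> K / \<rho> ^ DIM('a) * (\<rho> powr (2 * \<sigma>) * energy \<sigma> f + mass_on \<Omega> f)"
    if X: "finite X" and \<rho>: "0 < \<rho>" and r: "real m * \<rho> \<le> r" and sep: "separated (2 * (real m * \<rho>)) X"
      and \<Omega>: "open \<Omega>" and cone: "\<And>x. x \<in> X \<Longrightarrow> \<exists>e\<in>E. cone_into \<Omega> r \<theta> e x"
      and f: "ft_regular f" and e: "integrable lborel (energy_density \<sigma> f)" for \<rho> X \<Omega> f
  proof -
    note F = ft_regularD[OF f]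
    let ?en = "\<rho> powr (2 * \<sigma>) * energy \<sigma> f"
    have \<Omega>b: "\<Omega> \<in> sets borel" using \<Omega> by simp
    have \<rho>m: "\<rho> \<le> real m * \<rho>" using m(2) \<rho> by simp
    have one: "(\<Sum>x | x \<in> X \<and> cone_into \<Omega> r \<theta> e x. (norm (f x))\<^sup>2) \<le> (A * ?en + B * mass_on \<Omega> f) / \<rho> ^ DIM('a)"
      if eE: "e \<in> E" for e
    proof -
      define Y where "Y = {x. x \<in> X \<and> cone_into \<Omega> r \<theta> e x}"
      have Y: "finite Y" "Y \<subseteq> X" using X by (auto simp: Y_def)
      define D where "D = ball ((\<rho> / 2) *\<^sub>R e) (\<theta> * (\<rho> / 2))"
      have Db: "D \<in> sets borel" by (simp add: D_def)
      have mD: "measure lborel D = V * \<rho> ^ DIM('a)"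
        unfolding D_def V_def using \<theta> \<rho> by (simp add: content_ball power_mult_distrib[symmetric] mult_ac)
      have Dfin: "emeasure lborel D < \<infinity>"
        unfolding D_def by (rule emeasure_lborel_ball_finite)
      have hD: "norm h < \<rho>" "norm (h - (\<rho> / 2) *\<^sub>R e) \<le> \<theta> * (\<rho> / 2)" if "h \<in> D" for h
      proof -
        show 1: "norm (h - (\<rho> / 2) *\<^sub>R e) \<le> \<theta> * (\<rho> / 2)"
          using that by (simp add: D_def dist_norm norm_minus_commute)
        have "norm (h - (\<rho> / 2) *\<^sub>R e) < \<theta> * (\<rho> / 2)"
          using that by (simp add: D_def dist_norm norm_minus_commute)
        also have "\<dots> \<le> \<rho> / 2" using \<theta> \<rho> by simp
        finally show "norm h < \<rho>"
          using norm_triangle_ineq2[of h "(\<rho> / 2) *\<^sub>R e"] E(2)[OF eE] \<rho> by simp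
      qed
      have inside: "x + real k *\<^sub>R h \<in> \<Omega>" if "x \<in> Y" "h \<in> D" "k \<in> {1..m}" for x h k
      proof -
        have c: "cone_into \<Omega> r \<theta> e x" using that(1) by (simp add: Y_def)
        have k: "1 \<le> real k" "real k \<le> real m" using that(3) by auto
        have "real k * (\<rho> / 2) \<le> real m * \<rho>" using k \<rho> by (intro mult_mono) auto
        from order_trans[OF this r] have t: "real k * (\<rho> / 2) \<le> r" .
        have t0: "0 < real k * (\<rho> / 2)" using k \<rho> by simp
        have "norm (real k *\<^sub>R (h - (\<rho> / 2) *\<^sub>R e)) \<le> \<theta> * (real k * (\<rho> / 2))"
          using mult_left_mono[OF hD(2)[OF that(2)], of "real k"] by (simp add: mult_ac)
        from cone_intoD[OF c t0 t this] have "x + (real k * (\<rho> / 2)) *\<^sub>R e + real k *\<^sub>R (h - (\<rho> / 2) *\<^sub>R e) \<in> \<Omega>" .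
        then show ?thesis by (simp add: algebra_simps)
      qed
      have diff: "2 * (\<Sum>x\<in>Y. (norm (fdiff m h f x))\<^sup>2) \<le> A * ?en / \<rho> ^ DIM('a)" if h: "h \<in> D" for h
      proof -
        have le: "(norm (ft (fdiff m h f) \<omega>))\<^sup>2 * weight \<sigma> (\<rho> *\<^sub>R \<omega>) \<le> 2 powr \<sigma> * 4 ^ m * \<rho> powr (2 * \<sigma>) * energy_density \<sigma> f \<omega>" for \<omega>
          by (rule fdiff_density_le[OF F(2) \<sigma> order_refl m]) (use hD(1)[OF h] in simp)
        have i: "integrable lborel (\<lambda>\<omega>. 2 powr \<sigma> * 4 ^ m * \<rho> powr (2 * \<sigma>) * energy_density \<sigma> f \<omega>)" using e by simp
        have [measurable]: "fdiff m h f \<in> borel_measurable borel" by (rule ft_regularD[OF ft_regular_fdiff[OF f]])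
        have i2: "integrable lborel (\<lambda>\<omega>. (norm (ft (fdiff m h f) \<omega>))\<^sup>2 * weight \<sigma> (\<rho> *\<^sub>R \<omega>))"
          by (rule Bochner_Integration.integrable_bound[OF i]) (use le in \<open>auto intro!: AE_I2 order_trans[OF le abs_ge_self]\<close>)
        have "separated \<rho> Y"
          using sep \<rho>m Y(2) \<rho> by (intro separated_subset[OF separated_mono[OF sep]]) auto
        from samp[OF Y(1) \<rho> this ft_regular_fdiff[OF f] i2]
        have "(\<Sum>x\<in>Y. (norm (fdiff m h f x))\<^sup>2) \<le> C / \<rho> ^ DIM('a) * (LINT \<omega>|lborel. (norm (ft (fdiff m h f) \<omega>))\<^sup>2 * weight \<sigma> (\<rho> *\<^sub>R \<omega>))" .
        also have "\<dots> \<le> C / \<rho> ^ DIM('a) * (LINT \<omega>|lborel. 2 powr \<sigma> * 4 ^ m * \<rho> powr (2 * \<sigma>) * energy_density \<sigma> f \<omega>)"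
          using C \<rho> by (intro mult_left_mono integral_mono i i2 le) auto
        also have "\<dots> = C / \<rho> ^ DIM('a) * (2 powr \<sigma> * 4 ^ m * \<rho> powr (2 * \<sigma>) * energy \<sigma> f)"
          unfolding energy_def integral_mult_right_zero ..
        finally have "2 * (\<Sum>x\<in>Y. (norm (fdiff m h f x))\<^sup>2) \<le> 2 * (C / \<rho> ^ DIM('a) * (2 powr \<sigma> * 4 ^ m * \<rho> powr (2 * \<sigma>) * energy \<sigma> f))"
          by (rule mult_left_mono) simp
        also have "\<dots> = A * ?en / \<rho> ^ DIM('a)" by (simp add: A_def mult_ac)
        finally show ?thesis .
      qed
      let ?S = "\<Sum>x\<in>Y. (norm (f x))\<^sup>2"
      let ?I = "\<lambda>k x h. indicator D h * (norm (f (x + real k *\<^sub>R h)))\<^sup>2"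
      have dil: "\<And>x. x \<in> Y \<Longrightarrow> integrable lborel (?I k x)" "(\<Sum>x\<in>Y. LINT h|lborel. ?I k x h) \<le> mass_on \<Omega> f" if k: "k \<in> {1..m}" for k
      proof -
        have *: "norm (real k *\<^sub>R h) < real m * \<rho>" if "h \<in> D" for h
          using k hD(1)[OF that] \<rho> by (auto intro: mult_le_less_imp_less)
        have sepY: "separated (2 * (real m * \<rho>)) Y" by (rule separated_subset[OF sep Y(2)])
        have k1: "1 \<le> real k" using k by simp
        note S = sum_integral_dilated_le_mass_on[OF F(4) \<Omega>b Db Y(1) k1 inside[OF _ _ k] * sepY]
        show "\<And>x. x \<in> Y \<Longrightarrow> integrable lborel (?I k x)" "(\<Sum>x\<in>Y. LINT h|lborel. ?I k x h) \<le> mass_on \<Omega> f"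
          using S by auto
      qed
      have "?S * (V * \<rho> ^ DIM('a)) = (LINT h|lborel. ?S * indicator D h)"
        using Dfin Db by (simp add: mD)
      also have "\<dots> \<le> (LINT h|lborel. A * ?en / \<rho> ^ DIM('a) * indicator D h + M * (\<Sum>k\<in>{1..m}. \<Sum>x\<in>Y. ?I k x h))"
      proof (rule integral_mono)
        show "integrable lborel (\<lambda>h. ?S * indicator D h)"
          using Dfin Db by (intro integrable_mult_right integrable_real_indicator) auto
        show "integrable lborel (\<lambda>h. A * ?en / \<rho> ^ DIM('a) * indicator D h + M * (\<Sum>k\<in>{1..m}. \<Sum>x\<in>Y. ?I k x h))"
          using Dfin Db dil(1)
          by (intro Bochner_Integration.integrable_add integrable_mult_right integrable_real_indicator Bochner_Integration.integrable_sum) auto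
        show "?S * indicator D h \<le> A * ?en / \<rho> ^ DIM('a) * indicator D h + M * (\<Sum>k\<in>{1..m}. \<Sum>x\<in>Y. ?I k x h)" for h
        proof (cases "h \<in> D")
          case True
          have "?S \<le> (\<Sum>x\<in>Y. 2 * (norm (fdiff m h f x))\<^sup>2 + M * (\<Sum>k\<in>{1..m}. (norm (f (x + real k *\<^sub>R h)))\<^sup>2))"
            unfolding M_def by (intro sum_mono square_le_fdiff)
          also have "\<dots> = 2 * (\<Sum>x\<in>Y. (norm (fdiff m h f x))\<^sup>2) + M * (\<Sum>k\<in>{1..m}. \<Sum>x\<in>Y. (norm (f (x + real k *\<^sub>R h)))\<^sup>2)"
            by (simp only: sum.distrib sum_distrib_left[symmetric] sum.swap[of _ Y])
          also have "\<dots> \<le> A * ?en / \<rho> ^ DIM('a) + M * (\<Sum>k\<in>{1..m}. \<Sum>x\<in>Y. (norm (f (x + real k *\<^sub>R h)))\<^sup>2)"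
            using diff[OF True] by simp
          finally show ?thesis using True by simp
        qed simp
      qed
      also have "\<dots> = A * ?en / \<rho> ^ DIM('a) * (V * \<rho> ^ DIM('a)) + M * (\<Sum>k\<in>{1..m}. \<Sum>x\<in>Y. LINT h|lborel. ?I k x h)"
        using Dfin Db dil(1) by (subst Bochner_Integration.integral_add)
          (auto simp: mD Bochner_Integration.integral_sum intro!: integrable_mult_right integrable_real_indicator Bochner_Integration.integrable_sum)
      also have "\<dots> \<le> A * ?en / \<rho> ^ DIM('a) * (V * \<rho> ^ DIM('a)) + M * (\<Sum>k\<in>{1..m}. mass_on \<Omega> f)"
        using M dil(2) by (intro add_left_mono mult_left_mono sum_mono) auto
      also have "\<dots> = (A * ?en + B * mass_on \<Omega> f) / \<rho> ^ DIM('a) * (V * \<rho> ^ DIM('a))"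
        using V \<rho> by (simp add: B_def field_simps)
      finally show ?thesis
        using V \<rho> unfolding Y_def by (subst (asm) mult_le_cancel_right) auto
    qed
    have "(\<Sum>x\<in>X. (norm (f x))\<^sup>2) \<le> (\<Sum>e\<in>E. \<Sum>x | x \<in> X \<and> cone_into \<Omega> r \<theta> e x. (norm (f x))\<^sup>2)"
      by (rule sum_le_sum_cover[OF X E(1)]) (use cone in auto)
    also have "\<dots> \<le> (\<Sum>e\<in>E. (A * ?en + B * mass_on \<Omega> f) / \<rho> ^ DIM('a))"
      by (intro sum_mono one)
    also have "\<dots> = real (card E) * (A * ?en + B * mass_on \<Omega> f) / \<rho> ^ DIM('a)" by simp
    also have "\<dots> \<le> K * (?en + mass_on \<Omega> f) / \<rho> ^ DIM('a)"
    proof (rule divide_right_mono)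
      have en: "?en \<ge> 0" "mass_on \<Omega> f \<ge> 0" by (simp_all add: energy_nonneg mass_on_nonneg)
      have "A * ?en + B * mass_on \<Omega> f \<le> (A + B) * (?en + mass_on \<Omega> f)"
        using en A B by (simp add: algebra_simps)
      then have "real (card E) * (A * ?en + B * mass_on \<Omega> f) \<le> real (card E) * ((A + B) * (?en + mass_on \<Omega> f))"
        by (rule mult_left_mono) simp
      also have "\<dots> \<le> K * (?en + mass_on \<Omega> f)"
        unfolding K_def using en by (simp add: algebra_simps)
      finally show "real (card E) * (A * ?en + B * mass_on \<Omega> f) \<le> K * (?en + mass_on \<Omega> f)" .
    qed (use \<rho> in simp)
    finally show ?thesis by simp
  qed
  ultimately show ?thesis by (intro exI[of _ K]) blast
qed

lemma integral_lincomb_sum: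
  fixes a :: "'a \<Rightarrow> real"
  assumes a: "integrable N a" and b: "\<And>k::'k. integrable N (b k)"
  shows "(LINT y|N. c * a y + d * (\<Sum>k\<in>I. b k y)) = c * (LINT y|N. a y) + d * (\<Sum>k\<in>I. LINT y|N. b k y)"
  using a b by (subst Bochner_Integration.integral_add) (auto simp: Bochner_Integration.integral_sum)

text \<open>A point \<open>y\<close> at distance at most \<open>\<rho>\<close> from \<open>x \<in> \<Omega>\<close> is moved into \<open>\<Omega>\<close> by steps of length \<open>\<rho> / \<theta>\<close> along
  the axis of the cone at \<open>x\<close>: the offset \<open>y - x\<close> is then within the opening of the cone. So one fixed step
  per direction suffices, and the differences are measured in \<open>L\<^sup>2\<close>.\<close>

lemma mass_on_neighbourhood:
  fixes E :: "'a::euclidean_space set"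
  assumes \<sigma>: "\<sigma> \<ge> 0" and m: "\<sigma> \<le> real m" "1 \<le> m" and E: "finite E" "\<And>e. e \<in> E \<Longrightarrow> norm e = 1" and \<theta>: "0 < \<theta>"
  shows "\<exists>C>0. \<forall>\<rho> \<Omega> S f. 0 < \<rho> \<longrightarrow> real m * (\<rho> / \<theta>) \<le> r \<longrightarrow> open \<Omega> \<longrightarrow> S \<in> sets borel \<longrightarrow>
     (\<forall>y\<in>S. \<exists>x\<in>\<Omega>. norm (y - x) \<le> \<rho>) \<longrightarrow>
     (\<forall>x\<in>\<Omega>. \<exists>e\<in>E. cone_into \<Omega> r \<theta> e x) \<longrightarrow> ft_regular f \<longrightarrow> integrable lborel (energy_density \<sigma> f) \<longrightarrow>
     mass_on S f \<le> C * (\<rho> powr (2 * \<sigma>) * energy \<sigma> f + mass_on \<Omega> f)"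
proof -
  define M where "M = 2 * real m * 4 ^ m"
  have M: "M \<ge> 0" by (simp add: M_def)
  define A where "A = 2 * (4 ^ m * (1 / \<theta>) powr (2 * \<sigma>))"
  have A: "A > 0" using \<theta> by (simp add: A_def)
  define B where "B = M * real m"
  have B: "B \<ge> 0" using M by (simp add: B_def)
  define K where "K = real (card E) * (A + B) + 1"
  have "K > 0" using A B by (simp add: K_def add_nonneg_pos)
  moreover have "mass_on S f \<le> K * (\<rho> powr (2 * \<sigma>) * energy \<sigma> f + mass_on \<Omega> f)"
    if \<rho>: "0 < \<rho>" and r: "real m * (\<rho> / \<theta>) \<le> r" and \<Omega>: "open \<Omega>" and S: "S \<in> sets borel"
      and near: "\<And>y. y \<in> S \<Longrightarrow> \<exists>x\<in>\<Omega>. norm (y - x) \<le> \<rho>"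
      and cone: "\<And>x. x \<in> \<Omega> \<Longrightarrow> \<exists>e\<in>E. cone_into \<Omega> r \<theta> e x"
      and f: "ft_regular f" and e: "integrable lborel (energy_density \<sigma> f)" for \<rho> \<Omega> S f
  proof -
    note F = ft_regularD[OF f]
    let ?en = "\<rho> powr (2 * \<sigma>) * energy \<sigma> f"
    have \<Omega>b: "\<Omega> \<in> sets borel" using \<Omega> by simp
    define T where "T e = {y. \<forall>k\<in>{1..m}. y + (real k * (\<rho> / \<theta>)) *\<^sub>R e \<in> \<Omega>}" for e
    have Tb: "T e \<in> sets borel" for e
    proof -
      have "T e = (\<Inter>k\<in>{1..m}. (\<lambda>y. y + (real k * (\<rho> / \<theta>)) *\<^sub>R e) -` \<Omega>)"
        by (auto simp: T_def)
      moreover have "open \<dots>"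
        by (intro open_INT ballI open_vimage \<Omega> continuous_intros) auto
      ultimately show ?thesis by simp
    qed
    have cover: "\<exists>e\<in>E. y \<in> T e" if y: "y \<in> S" for y
    proof -
      obtain x where x: "x \<in> \<Omega>" "norm (y - x) \<le> \<rho>" using near[OF y] by blast
      obtain e where eE: "e \<in> E" and c: "cone_into \<Omega> r \<theta> e x" using cone[OF x(1)] by blast
      have "y + (real k * (\<rho> / \<theta>)) *\<^sub>R e \<in> \<Omega>" if k: "k \<in> {1..m}" for k
      proof -
        have k1: "1 \<le> real k" "real k \<le> real m" using k by auto
        have "real k * (\<rho> / \<theta>) \<le> real m * (\<rho> / \<theta>)" using k1 \<rho> \<theta> by (intro mult_right_mono) auto
        from order_trans[OF this r] have t: "real k * (\<rho> / \<theta>) \<le> r" .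
        have t0: "0 < real k * (\<rho> / \<theta>)" using k1 \<rho> \<theta> by simp
        have "norm (y - x) \<le> 1 * \<rho>" using x(2) by simp
        also have "\<dots> \<le> real k * \<rho>" using k1(1) \<rho> by (intro mult_right_mono) auto
        also have "\<dots> = \<theta> * (real k * (\<rho> / \<theta>))" using \<theta> by simp
        finally have "norm (y - x) \<le> \<theta> * (real k * (\<rho> / \<theta>))" .
        from cone_intoD[OF c t0 t this] show ?thesis by (simp add: algebra_simps)
      qed
      then show ?thesis using eE unfolding T_def by blast
    qed
    have iT: "integrable lborel (\<lambda>y. indicator (T e) y * (norm (f y))\<^sup>2)" for e
      by (rule integrable_mass_on[OF F(4) Tb])
    have one: "mass_on (T e) f \<le> A * ?en + B * mass_on \<Omega> f" if eE: "e \<in> E" for e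
    proof -
      define h where "h = (\<rho> / \<theta>) *\<^sub>R e"
      have nh: "norm h = 1 / \<theta> * \<rho>" using \<rho> \<theta> E(2)[OF eE] by (simp add: h_def)
      have i\<Omega>: "integrable lborel (\<lambda>y. indicator \<Omega> (y + real k *\<^sub>R h) * (norm (f (y + real k *\<^sub>R h)))\<^sup>2)" for k
        using integrable_mass_on[OF F(4) \<Omega>b] integrable_lborel_shift_iff[of "\<lambda>y. indicator \<Omega> y * (norm (f y))\<^sup>2"] by simp
      have m\<Omega>: "(LINT y|lborel. indicator \<Omega> (y + real k *\<^sub>R h) * (norm (f (y + real k *\<^sub>R h)))\<^sup>2) = mass_on \<Omega> f" for k
        unfolding mass_on_def using integral_lborel_shift[of "\<lambda>y. indicator \<Omega> y * (norm (f y))\<^sup>2"] by simp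
      have id: "integrable lborel (\<lambda>y. (norm (fdiff m h f y))\<^sup>2)"
        by (rule ft_regularD[OF ft_regular_fdiff[OF f]])
      have "mass_on (T e) f \<le> (LINT y|lborel. 2 * (norm (fdiff m h f y))\<^sup>2 +
          M * (\<Sum>k\<in>{1..m}. indicator \<Omega> (y + real k *\<^sub>R h) * (norm (f (y + real k *\<^sub>R h)))\<^sup>2))"
        unfolding mass_on_def
      proof (rule integral_mono)
        show "integrable lborel (\<lambda>y. 2 * (norm (fdiff m h f y))\<^sup>2 +
          M * (\<Sum>k\<in>{1..m}. indicator \<Omega> (y + real k *\<^sub>R h) * (norm (f (y + real k *\<^sub>R h)))\<^sup>2))"
          using id i\<Omega> by (intro Bochner_Integration.integrable_add integrable_mult_right Bochner_Integration.integrable_sum)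
        show "indicator (T e) y * (norm (f y))\<^sup>2 \<le> 2 * (norm (fdiff m h f y))\<^sup>2 +
          M * (\<Sum>k\<in>{1..m}. indicator \<Omega> (y + real k *\<^sub>R h) * (norm (f (y + real k *\<^sub>R h)))\<^sup>2)" for y
        proof (cases "y \<in> T e")
          case True
          then have "y + real k *\<^sub>R h \<in> \<Omega>" if "k \<in> {1..m}" for k
            using that by (simp add: T_def h_def)
          then have "(\<Sum>k\<in>{1..m}. indicator \<Omega> (y + real k *\<^sub>R h) * (norm (f (y + real k *\<^sub>R h)))\<^sup>2) = (\<Sum>k\<in>{1..m}. (norm (f (y + real k *\<^sub>R h)))\<^sup>2)"
            by (intro sum.cong) auto
          then show ?thesis using True square_le_fdiff[of f y m h] by (simp add: M_def)
        next
          case False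
          then show ?thesis using M by (auto intro!: add_nonneg_nonneg mult_nonneg_nonneg sum_nonneg)
        qed
      qed (rule iT)
      also have "\<dots> = 2 * (LINT y|lborel. (norm (fdiff m h f y))\<^sup>2) + M * (\<Sum>k\<in>{1..m}. mass_on \<Omega> f)"
        using integral_lincomb_sum[where c = 2 and d = M and I = "{1..m}", OF id i\<Omega>] unfolding m\<Omega> .
      also have "(LINT y|lborel. (norm (fdiff m h f y))\<^sup>2) \<le> 4 ^ m * norm h powr (2 * \<sigma>) * energy \<sigma> f"
        by (rule integral_fdiff_square_le[OF f e \<sigma> m])
      also have "norm h powr (2 * \<sigma>) = (1 / \<theta>) powr (2 * \<sigma>) * \<rho> powr (2 * \<sigma>)"
        unfolding nh using \<theta> \<rho> by (intro powr_mult)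
      finally show ?thesis by (simp add: A_def B_def mult_ac)
    qed
    have "mass_on S f \<le> (LINT y|lborel. (\<Sum>e\<in>E. indicator (T e) y * (norm (f y))\<^sup>2))"
      unfolding mass_on_def
    proof (rule integral_mono)
      show "integrable lborel (\<lambda>y. indicator S y * (norm (f y))\<^sup>2)" by (rule integrable_mass_on[OF F(4) S])
      show "integrable lborel (\<lambda>y. \<Sum>e\<in>E. indicator (T e) y * (norm (f y))\<^sup>2)" using iT by simp
      show "indicator S y * (norm (f y))\<^sup>2 \<le> (\<Sum>e\<in>E. indicator (T e) y * (norm (f y))\<^sup>2)" for y
      proof (cases "y \<in> S")
        case True
        then obtain e where e: "e \<in> E" "y \<in> T e" using cover by blast
        have "indicator S y * (norm (f y))\<^sup>2 = indicator (T e) y * (norm (f y))\<^sup>2" using True e by simp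
        also have "\<dots> \<le> (\<Sum>e\<in>E. indicator (T e) y * (norm (f y))\<^sup>2)"
          by (rule member_le_sum[OF e(1)]) (use E(1) in auto)
        finally show ?thesis .
      qed (auto intro: sum_nonneg)
    qed
    also have "\<dots> = (\<Sum>e\<in>E. mass_on (T e) f)"
      unfolding mass_on_def using iT by (simp add: Bochner_Integration.integral_sum)
    also have "\<dots> \<le> (\<Sum>e\<in>E. A * ?en + B * mass_on \<Omega> f)"
      by (intro sum_mono one)
    also have "\<dots> = real (card E) * (A * ?en + B * mass_on \<Omega> f)" by simp
    also have "\<dots> \<le> K * (?en + mass_on \<Omega> f)"
    proof -
      have en: "?en \<ge> 0" "mass_on \<Omega> f \<ge> 0" by (simp_all add: energy_nonneg mass_on_nonneg)
      have "A * ?en + B * mass_on \<Omega> f \<le> (A + B) * (?en + mass_on \<Omega> f)"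
        using en A B by (simp add: algebra_simps)
      then have "real (card E) * (A * ?en + B * mass_on \<Omega> f) \<le> real (card E) * ((A + B) * (?en + mass_on \<Omega> f))"
        by (rule mult_left_mono) simp
      also have "\<dots> \<le> K * (?en + mass_on \<Omega> f)"
        unfolding K_def using en by (simp add: algebra_simps)
      finally show ?thesis .
    qed
    finally show ?thesis .
  qed
  ultimately show ?thesis by (intro exI[of _ K]) blast
qed

section \<open>Trial functions of kernels with algebraically decaying transform\<close>

locale sobolev_kernel =
  fixes \<Phi> :: "'a::euclidean_space \<Rightarrow> real" and P :: "'a \<Rightarrow> real" and \<sigma> a b :: real
  assumes continuous_kernel: "continuous_on UNIV \<Phi>" and integrable_kernel: "integrable lborel \<Phi>"
    and ft_kernel: "\<And>\<omega>. ft (\<lambda>x. complex_of_real (\<Phi> x)) \<omega> = complex_of_real (P \<omega>)"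
    and order: "real DIM('a) / 2 < \<sigma>" and a_pos: "0 < a"
    and lower: "\<And>\<omega>. a * weight (- \<sigma>) \<omega> \<le> P \<omega>" and upper: "\<And>\<omega>. P \<omega> \<le> b * weight (- \<sigma>) \<omega>"
begin

definition trial :: "real \<Rightarrow> 'a set \<Rightarrow> ('a \<Rightarrow> real) \<Rightarrow> 'a \<Rightarrow> complex" where
  "trial \<delta> X \<alpha> x = complex_of_real (\<Sum>y\<in>X. \<alpha> y * scaled_kernel \<delta> \<Phi> (x - y))"

lemma sigma_pos: "\<sigma> > 0"
  using order by (smt (verit) divide_nonneg_nonneg of_nat_0_le_iff)

lemma P_pos: "P \<omega> > 0"
  using lower[of \<omega>] mult_pos_pos[OF a_pos weight_pos[of "- \<sigma>" \<omega>]] by linarith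

lemma b_pos: "b > 0"
proof -
  have "0 < b * weight (- \<sigma>) (0::'a)" using P_pos[of 0] upper[of 0] by linarith
  then show ?thesis by (rule zero_less_mult_pos2) (rule weight_pos)
qed

lemma P_measurable [measurable]: "P \<in> borel_measurable borel"
proof -
  have [measurable]: "\<Phi> \<in> borel_measurable borel"
    using borel_measurable_integrable[OF integrable_kernel] by simp
  have "P = (\<lambda>\<omega>. Re (ft (\<lambda>x. complex_of_real (\<Phi> x)) \<omega>))" by (simp add: ft_kernel)
  also have "\<dots> \<in> borel_measurable borel" by measurable
  finally show ?thesis .
qed

lemma integrable_P: "integrable lborel P"
proof (rule integrable_ft_of_nonneg)
  show "integrable lborel (\<lambda>x. complex_of_real (\<Phi> x))" using integrable_kernel by simp
  show "isCont (\<lambda>x. complex_of_real (\<Phi> x)) 0"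
    using continuous_kernel by (intro continuous_intros) (simp add: continuous_on_eq_continuous_at)
  show "P \<omega> \<ge> 0" for \<omega> using P_pos[of \<omega>] by simp
qed (rule ft_kernel)

lemma integrable_weight: "integrable lborel (weight (- \<sigma>) :: 'a \<Rightarrow> real)"
proof (rule Bochner_Integration.integrable_bound)
  show "integrable lborel (\<lambda>\<omega>. P \<omega> / a)" using integrable_P by simp
  show "AE \<omega> in lborel. norm (weight (- \<sigma>) \<omega>) \<le> norm (P \<omega> / a)"
    using lower a_pos less_imp_le[OF P_pos] by (intro AE_I2) (simp add: pos_le_divide_eq mult.commute abs_of_nonneg)
qed simp

lemma scaled_kernel_transform:
  assumes \<delta>: "\<delta> > 0"
  shows "integrable lborel (\<lambda>x. complex_of_real (scaled_kernel \<delta> \<Phi> x))"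
    and "ft (\<lambda>x. complex_of_real (scaled_kernel \<delta> \<Phi> x)) \<omega> = complex_of_real (P (\<delta> *\<^sub>R \<omega>))"
    and "continuous_on UNIV (\<lambda>x. complex_of_real (scaled_kernel \<delta> \<Phi> x))"
proof -
  have "integrable lborel (\<lambda>x. \<Phi> (0 + inverse \<delta> *\<^sub>R x))"
    using \<delta> integrable_kernel by (subst integrable_lborel_affine_iff) auto
  then show "integrable lborel (\<lambda>x. complex_of_real (scaled_kernel \<delta> \<Phi> x))"
    by (simp add: scaled_kernel_def)
  show "ft (\<lambda>x. complex_of_real (scaled_kernel \<delta> \<Phi> x)) \<omega> = complex_of_real (P (\<delta> *\<^sub>R \<omega>))"
    using ft_scale[OF \<delta>, of "\<lambda>x. complex_of_real (\<Phi> x)" \<omega>] by (simp add: scaled_kernel_def ft_kernel)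
  show "continuous_on UNIV (\<lambda>x. complex_of_real (scaled_kernel \<delta> \<Phi> x))"
    unfolding scaled_kernel_def using \<delta>
    by (intro continuous_intros continuous_on_compose2[OF continuous_kernel]) auto
qed

lemma ft_trial:
  assumes \<delta>: "\<delta> > 0"
  shows "ft (trial \<delta> X \<alpha>) \<omega> = complex_of_real (P (\<delta> *\<^sub>R \<omega>)) * expsum X (\<lambda>y. complex_of_real (\<alpha> y)) \<omega>"
proof -
  let ?f = "\<lambda>x. complex_of_real (scaled_kernel \<delta> \<Phi> x)"
  have "trial \<delta> X \<alpha> = (\<lambda>x. \<Sum>y\<in>X. complex_of_real (\<alpha> y) * ?f (x + (- y)))"
    by (simp add: trial_def fun_eq_iff)
  then have eq: "ft (trial \<delta> X \<alpha>) \<omega> = (\<Sum>y\<in>X. complex_of_real (\<alpha> y) * ft (\<lambda>x. ?f (x + (- y))) \<omega>)"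
    using integrable_lborel_shift_iff[THEN iffD2, OF scaled_kernel_transform(1)[OF \<delta>]]
    by (simp only:) (subst ft_sum, auto simp: ft_cmult simp del: add_uminus_conv_diff)
  note eq
  also have "(\<Sum>y\<in>X. complex_of_real (\<alpha> y) * ft (\<lambda>x. ?f (x + (- y))) \<omega>) = (\<Sum>y\<in>X. complex_of_real (\<alpha> y) * (wave \<omega> y * complex_of_real (P (\<delta> *\<^sub>R \<omega>))))"
    unfolding ft_shift[of ?f] scaled_kernel_transform(2)[OF \<delta>] minus_minus ..
  finally show ?thesis
    by (simp add: expsum_def sum_distrib_left mult_ac)
qed

lemma ft_regular_trial:
  assumes \<delta>: "\<delta> > 0"
  shows "ft_regular (trial \<delta> X \<alpha>)"
proof -
  let ?f = "\<lambda>x. complex_of_real (scaled_kernel \<delta> \<Phi> x)"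
  have eq: "trial \<delta> X \<alpha> = (\<lambda>x. \<Sum>y\<in>X. complex_of_real (\<alpha> y) * ?f (x + (- y)))"
    by (simp add: trial_def fun_eq_iff)
  have "continuous_on UNIV (trial \<delta> X \<alpha>)"
    unfolding eq by (intro continuous_intros continuous_on_compose2[OF scaled_kernel_transform(3)[OF \<delta>]]) auto
  moreover have "integrable lborel (trial \<delta> X \<alpha>)"
    unfolding eq
    by (intro Bochner_Integration.integrable_sum integrable_mult_right integrable_lborel_shift_iff[THEN iffD2, OF scaled_kernel_transform(1)[OF \<delta>]])
  moreover have "integrable lborel (ft (trial \<delta> X \<alpha>))"
  proof (rule Bochner_Integration.integrable_bound)
    have "integrable lborel (\<lambda>\<omega>. P (0 + \<delta> *\<^sub>R \<omega>))"
      using \<delta> integrable_P by (subst integrable_lborel_affine_iff) auto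
    then show "integrable lborel (\<lambda>\<omega>. (\<Sum>x\<in>X. norm (complex_of_real (\<alpha> x))) * P (\<delta> *\<^sub>R \<omega>))" by simp
    show "ft (trial \<delta> X \<alpha>) \<in> borel_measurable lborel"
      unfolding ft_trial[OF \<delta>, abs_def] by measurable
    show "AE \<omega> in lborel. norm (ft (trial \<delta> X \<alpha>) \<omega>) \<le> norm ((\<Sum>x\<in>X. norm (complex_of_real (\<alpha> x))) * P (\<delta> *\<^sub>R \<omega>))"
    proof (rule AE_I2)
      fix \<omega>
      have "norm (ft (trial \<delta> X \<alpha>) \<omega>) = norm (expsum X (\<lambda>y. complex_of_real (\<alpha> y)) \<omega>) * P (\<delta> *\<^sub>R \<omega>)"
        using P_pos[of "\<delta> *\<^sub>R \<omega>"] by (simp add: ft_trial[OF \<delta>] norm_mult)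
      also have "\<dots> \<le> (\<Sum>x\<in>X. norm (complex_of_real (\<alpha> x))) * P (\<delta> *\<^sub>R \<omega>)"
        using P_pos[of "\<delta> *\<^sub>R \<omega>"] by (intro mult_right_mono norm_expsum_le) auto
      finally show "norm (ft (trial \<delta> X \<alpha>) \<omega>) \<le> norm ((\<Sum>x\<in>X. norm (complex_of_real (\<alpha> x))) * P (\<delta> *\<^sub>R \<omega>))"
        by simp
    qed
  qed
  ultimately show ?thesis by (simp add: ft_regular_def)
qed

text \<open>Up to a constant, the squared norm of \<open>trial \<delta> X \<alpha>\<close> in the native space of the scaled kernel.\<close>

definition native_energy :: "real \<Rightarrow> 'a set \<Rightarrow> ('a \<Rightarrow> real) \<Rightarrow> real" where
  "native_energy \<delta> X \<alpha> = (LINT \<omega>|lborel. (norm (expsum X (\<lambda>y. complex_of_real (\<alpha> y)) \<omega>))\<^sup>2 * P (\<delta> *\<^sub>R \<omega>))"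

lemma integrable_native_energy:
  assumes "\<delta> > 0"
  shows "integrable lborel (\<lambda>\<omega>. (norm (expsum X \<alpha> \<omega>))\<^sup>2 * P (\<delta> *\<^sub>R \<omega>))"
proof -
  have "integrable lborel (\<lambda>\<omega>. P (0 + \<delta> *\<^sub>R \<omega>))"
    using assms integrable_P by (subst integrable_lborel_affine_iff) auto
  then show ?thesis by (intro integrable_expsum_square) simp
qed

text \<open>The reproducing property on the trial space: the squared native norm is the quadratic form of the kernel
  matrix.\<close>

lemma native_energy_eq_sum:
  assumes \<delta>: "\<delta> > 0"
  shows "native_energy \<delta> X \<alpha> = (2 * pi) ^ DIM('a) * (\<Sum>x\<in>X. \<alpha> x * Re (trial \<delta> X \<alpha> x))"
proof -
  let ?E = "expsum X (\<lambda>y. complex_of_real (\<alpha> y))"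
  have "complex_of_real (native_energy \<delta> X \<alpha>) = (LINT \<omega>|lborel. ft (trial \<delta> X \<alpha>) \<omega> * cnj (?E \<omega>))"
    unfolding native_energy_def integral_complex_of_real[symmetric] of_real_mult complex_norm_square
    by (simp add: ft_trial[OF \<delta>] mult_ac)
  also have "\<dots> = (2 * pi) ^ DIM('a) * (\<Sum>x\<in>X. cnj (complex_of_real (\<alpha> x)) * trial \<delta> X \<alpha> x)"
    by (rule integral_ft_expsum[OF ft_regular_trial[OF \<delta>]])
  also have "\<dots> = complex_of_real ((2 * pi) ^ DIM('a) * (\<Sum>x\<in>X. \<alpha> x * Re (trial \<delta> X \<alpha> x)))"
    by (simp add: trial_def)
  finally show ?thesis by (simp only: of_real_eq_iff)
qed

lemma
  assumes \<delta>: "\<delta> > 0"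
  shows integrable_energy_trial: "integrable lborel (energy_density \<sigma> (trial \<delta> X \<alpha>))"
    and energy_le_native_energy: "energy \<sigma> (trial \<delta> X \<alpha>) \<le> b * \<delta> powr (- 2 * \<sigma>) * native_energy \<delta> X \<alpha>"
proof -
  let ?E = "expsum X (\<lambda>y. complex_of_real (\<alpha> y))"
  have le: "energy_density \<sigma> (trial \<delta> X \<alpha>) \<omega> \<le> b * \<delta> powr (- 2 * \<sigma>) * ((norm (?E \<omega>))\<^sup>2 * P (\<delta> *\<^sub>R \<omega>))" for \<omega>
  proof -
    have p: "P (\<delta> *\<^sub>R \<omega>) > 0" by (rule P_pos)
    have "(\<delta> * norm \<omega>) powr (2 * \<sigma>) \<le> weight \<sigma> (\<delta> *\<^sub>R \<omega>)"
    proof -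
      have "(\<delta> * norm \<omega>) powr (2 * \<sigma>) = ((\<delta> * norm \<omega>)\<^sup>2) powr \<sigma>"
        using \<delta> by (subst powr_powr[symmetric]) simp
      also have "\<dots> \<le> weight \<sigma> (\<delta> *\<^sub>R \<omega>)"
        unfolding weight_def using \<delta> sigma_pos by (intro powr_mono2) auto
      finally show ?thesis .
    qed
    then have "\<delta> powr (2 * \<sigma>) * norm \<omega> powr (2 * \<sigma>) \<le> weight \<sigma> (\<delta> *\<^sub>R \<omega>)"
      using \<delta> by (simp add: powr_mult)
    then have "norm \<omega> powr (2 * \<sigma>) * weight (- \<sigma>) (\<delta> *\<^sub>R \<omega>) \<le> \<delta> powr (- 2 * \<sigma>)"
      using \<delta> weight_pos[of \<sigma> "\<delta> *\<^sub>R \<omega>"] by (simp add: weight_minus powr_minus_divide pos_le_divide_eq mult.commute)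
    then have "P (\<delta> *\<^sub>R \<omega>) * norm \<omega> powr (2 * \<sigma>) \<le> b * \<delta> powr (- 2 * \<sigma>)"
      using order_trans[OF mult_right_mono[OF upper[of "\<delta> *\<^sub>R \<omega>"], of "norm \<omega> powr (2 * \<sigma>)"]]
        mult_left_mono[of _ _ b] b_pos by (simp add: mult_ac)
    then have "((norm (?E \<omega>))\<^sup>2 * P (\<delta> *\<^sub>R \<omega>)) * (P (\<delta> *\<^sub>R \<omega>) * norm \<omega> powr (2 * \<sigma>)) \<le> ((norm (?E \<omega>))\<^sup>2 * P (\<delta> *\<^sub>R \<omega>)) * (b * \<delta> powr (- 2 * \<sigma>))"
      using p by (intro mult_left_mono) auto
    moreover have "energy_density \<sigma> (trial \<delta> X \<alpha>) \<omega> = ((norm (?E \<omega>))\<^sup>2 * P (\<delta> *\<^sub>R \<omega>)) * (P (\<delta> *\<^sub>R \<omega>) * norm \<omega> powr (2 * \<sigma>))"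
      by (simp add: energy_density_def ft_trial[OF \<delta>] norm_mult power_mult_distrib power2_eq_square mult_ac)
    ultimately show ?thesis by (simp add: mult_ac)
  qed
  have i: "integrable lborel (\<lambda>\<omega>. b * \<delta> powr (- 2 * \<sigma>) * ((norm (?E \<omega>))\<^sup>2 * P (\<delta> *\<^sub>R \<omega>)))"
    using integrable_native_energy[OF \<delta>] by (intro integrable_mult_right)
  have [measurable]: "trial \<delta> X \<alpha> \<in> borel_measurable borel" by (rule ft_regularD(5)[OF ft_regular_trial[OF \<delta>]])
  show ie: "integrable lborel (energy_density \<sigma> (trial \<delta> X \<alpha>))"
  proof (rule Bochner_Integration.integrable_bound[OF i])
    show "energy_density \<sigma> (trial \<delta> X \<alpha>) \<in> borel_measurable lborel"
      unfolding energy_density_def[abs_def] by measurable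
    show "AE \<omega> in lborel. norm (energy_density \<sigma> (trial \<delta> X \<alpha>) \<omega>) \<le> norm (b * \<delta> powr (- 2 * \<sigma>) * ((norm (?E \<omega>))\<^sup>2 * P (\<delta> *\<^sub>R \<omega>)))"
    proof (rule AE_I2)
      fix \<omega>
      have "energy_density \<sigma> (trial \<delta> X \<alpha>) \<omega> \<ge> 0" by (simp add: energy_density_def)
      then show "norm (energy_density \<sigma> (trial \<delta> X \<alpha>) \<omega>) \<le> norm (b * \<delta> powr (- 2 * \<sigma>) * ((norm (?E \<omega>))\<^sup>2 * P (\<delta> *\<^sub>R \<omega>)))"
        using le[of \<omega>] unfolding real_norm_def by linarith
    qed
  qed
  have "energy \<sigma> (trial \<delta> X \<alpha>) \<le> (LINT \<omega>|lborel. b * \<delta> powr (- 2 * \<sigma>) * ((norm (?E \<omega>))\<^sup>2 * P (\<delta> *\<^sub>R \<omega>)))"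
    unfolding energy_def by (rule integral_mono[OF ie i le])
  also have "\<dots> = b * \<delta> powr (- 2 * \<sigma>) * native_energy \<delta> X \<alpha>"
    unfolding native_energy_def by (rule integral_mult_right_zero)
  finally show "energy \<sigma> (trial \<delta> X \<alpha>) \<le> b * \<delta> powr (- 2 * \<sigma>) * native_energy \<delta> X \<alpha>" .
qed

text \<open>A trial function is determined by its samples on \<open>X\<close>, stably: the coefficients are bounded by the native
  norm, which is paired with the samples by \<open>native_energy_eq_sum\<close>. Passing from the weight at scale \<open>q\<close> to
  the transform of the kernel at scale \<open>\<delta>\<close> costs \<open>(\<delta> / q)\<^bsup>2\<sigma>\<^esup>\<close>, and this is where \<open>q \<le> c \<delta>\<close> enters; the
  power of \<open>\<delta>\<close> is regained in \<open>energy_le_native_energy\<close>.\<close>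

lemma energy_le_samples:
  "\<exists>C>0. \<forall>\<delta> q X \<alpha>. 0 < \<delta> \<longrightarrow> finite X \<longrightarrow> 0 < q \<longrightarrow> q \<le> c * \<delta> \<longrightarrow> separated q X \<longrightarrow>
     energy \<sigma> (trial \<delta> X \<alpha>) \<le> C * q ^ DIM('a) * q powr (- 2 * \<sigma>) * (\<Sum>x\<in>X. (norm (trial \<delta> X \<alpha> x))\<^sup>2)"
proof -
  obtain C0 where C0: "C0 > 0" and stab: "\<And>s X \<alpha>. finite X \<Longrightarrow> 0 < s \<Longrightarrow> separated s X \<Longrightarrow>
     (\<Sum>x\<in>X. (norm (\<alpha> x))\<^sup>2) \<le> C0 * s ^ DIM('a) * (LINT \<omega>::'a|lborel. (norm (expsum X \<alpha> \<omega>))\<^sup>2 * weight (- \<sigma>) (s *\<^sub>R \<omega>))"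
    using sum_le_integral_expsum[OF less_imp_le[OF sigma_pos] integrable_weight] by blast
  define c' where "c' = max 1 c"
  have c': "c' \<ge> 1" "c \<le> c'" by (auto simp: c'_def)
  define \<pi>d where "\<pi>d = (2 * pi) ^ DIM('a)"
  have \<pi>d: "\<pi>d > 0" by (simp add: \<pi>d_def)
  define C where "C = b * \<pi>d\<^sup>2 * C0 * c' powr (2 * \<sigma>) / a"
  have "C > 0" using b_pos \<pi>d C0 c' a_pos by (simp add: C_def)
  moreover have "energy \<sigma> (trial \<delta> X \<alpha>) \<le> C * q ^ DIM('a) * q powr (- 2 * \<sigma>) * (\<Sum>x\<in>X. (norm (trial \<delta> X \<alpha> x))\<^sup>2)"
    if \<delta>: "0 < \<delta>" and X: "finite X" and q: "0 < q" "q \<le> c * \<delta>" and sep: "separated q X" for \<delta> q X \<alpha>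
  proof -
    let ?E = "expsum X (\<lambda>y. complex_of_real (\<alpha> y))"
    let ?N = "native_energy \<delta> X \<alpha>"
    define S where "S = (\<Sum>x\<in>X. (norm (trial \<delta> X \<alpha> x))\<^sup>2)"
    define K where "K = C0 * q ^ DIM('a) * ((c' * \<delta> / q) powr (2 * \<sigma>) / a)"
    have K: "K > 0" using C0 q c' \<delta> a_pos by (simp add: K_def)
    have qc: "q \<le> c' * \<delta>" using q(2) mult_right_mono[OF c'(2), of \<delta>] \<delta> by linarith
    have w: "weight (- \<sigma>) (q *\<^sub>R \<omega>) \<le> (c' * \<delta> / q) powr (2 * \<sigma>) / a * P (\<delta> *\<^sub>R \<omega>)" for \<omega> :: 'a
    proof -
      have "weight (- \<sigma>) (q *\<^sub>R \<omega>) \<le> (c' * \<delta> / q) powr (2 * \<sigma>) * weight (- \<sigma>) ((c' * \<delta>) *\<^sub>R \<omega>)"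
        using sigma_pos q qc by (intro weight_scale_ge) auto
      also have "\<dots> \<le> (c' * \<delta> / q) powr (2 * \<sigma>) * weight (- \<sigma>) (\<delta> *\<^sub>R \<omega>)"
        using sigma_pos \<delta> c' by (intro mult_left_mono weight_scale_le) auto
      also have "\<dots> \<le> (c' * \<delta> / q) powr (2 * \<sigma>) * (P (\<delta> *\<^sub>R \<omega>) / a)"
        using lower[of "\<delta> *\<^sub>R \<omega>"] a_pos by (intro mult_left_mono) (auto simp: pos_le_divide_eq mult.commute)
      finally show ?thesis by simp
    qed
    have stab': "(\<Sum>x\<in>X. (\<alpha> x)\<^sup>2) \<le> K * ?N"
    proof -
      have "(\<Sum>x\<in>X. (norm (complex_of_real (\<alpha> x)))\<^sup>2) \<le> C0 * q ^ DIM('a) * (LINT \<omega>|lborel. (norm (?E \<omega>))\<^sup>2 * weight (- \<sigma>) (q *\<^sub>R \<omega>))"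
        by (rule stab[OF X q(1) sep])
      also have "\<dots> \<le> C0 * q ^ DIM('a) * (LINT \<omega>|lborel. (c' * \<delta> / q) powr (2 * \<sigma>) / a * ((norm (?E \<omega>))\<^sup>2 * P (\<delta> *\<^sub>R \<omega>)))"
      proof (intro mult_left_mono integral_mono)
        show "integrable lborel (\<lambda>\<omega>. (norm (?E \<omega>))\<^sup>2 * weight (- \<sigma>) (q *\<^sub>R \<omega>))"
          by (intro integrable_expsum_square weight_scaled_integrable integrable_weight q)
        show "integrable lborel (\<lambda>\<omega>. (c' * \<delta> / q) powr (2 * \<sigma>) / a * ((norm (?E \<omega>))\<^sup>2 * P (\<delta> *\<^sub>R \<omega>)))"
          by (intro integrable_mult_right integrable_native_energy \<delta>)
        show "(norm (?E \<omega>))\<^sup>2 * weight (- \<sigma>) (q *\<^sub>R \<omega>) \<le> (c' * \<delta> / q) powr (2 * \<sigma>) / a * ((norm (?E \<omega>))\<^sup>2 * P (\<delta> *\<^sub>R \<omega>))" for \<omega>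
          using mult_left_mono[OF w[of \<omega>], of "(norm (?E \<omega>))\<^sup>2"] by (simp add: mult_ac)
      qed (use C0 q in auto)
      also have "\<dots> = K * ?N"
        unfolding native_energy_def integral_mult_right_zero by (simp add: K_def)
      finally show ?thesis by simp
    qed
    \<comment> \<open>The constant of \<open>weighted_am_gm\<close> is chosen so that, by \<open>stab'\<close>, the coefficients contribute at
        most half of the left-hand side.\<close>
    have "?N \<le> \<pi>d * (\<Sum>x\<in>X. 1 / (\<pi>d * K) / 2 * (\<alpha> x)\<^sup>2 + (norm (trial \<delta> X \<alpha> x))\<^sup>2 / (2 * (1 / (\<pi>d * K))))"
      unfolding native_energy_eq_sum[OF \<delta>] \<pi>d_def[symmetric]
    proof (intro mult_left_mono sum_mono)
      fix x
      have "\<alpha> x * Re (trial \<delta> X \<alpha> x) \<le> 1 / (\<pi>d * K) / 2 * (\<alpha> x)\<^sup>2 + (Re (trial \<delta> X \<alpha> x))\<^sup>2 / (2 * (1 / (\<pi>d * K)))"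
        using \<pi>d K by (intro weighted_am_gm) simp
      also have "(Re (trial \<delta> X \<alpha> x))\<^sup>2 = (norm (trial \<delta> X \<alpha> x))\<^sup>2"
        unfolding trial_def norm_of_real Re_complex_of_real by simp
      finally show "\<alpha> x * Re (trial \<delta> X \<alpha> x) \<le> 1 / (\<pi>d * K) / 2 * (\<alpha> x)\<^sup>2 + (norm (trial \<delta> X \<alpha> x))\<^sup>2 / (2 * (1 / (\<pi>d * K)))" .
    qed (use \<pi>d in simp)
    also have "\<dots> = (\<Sum>x\<in>X. (\<alpha> x)\<^sup>2) / (2 * K) + \<pi>d\<^sup>2 * K / 2 * S"
      using \<pi>d K by (simp add: sum.distrib S_def sum_divide_distrib[symmetric] sum_distrib_left[symmetric] sum_distrib_right[symmetric] distrib_left power2_eq_square mult_ac)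
    also have "\<dots> \<le> ?N / 2 + \<pi>d\<^sup>2 * K / 2 * S"
      using stab' K by (simp add: pos_divide_le_eq mult.commute)
    finally have N: "?N \<le> \<pi>d\<^sup>2 * K * S" by simp
    have "energy \<sigma> (trial \<delta> X \<alpha>) \<le> b * \<delta> powr (- 2 * \<sigma>) * ?N"
      by (rule energy_le_native_energy[OF \<delta>])
    also have "\<dots> \<le> b * \<delta> powr (- 2 * \<sigma>) * (\<pi>d\<^sup>2 * K * S)"
      using b_pos N by (intro mult_left_mono) auto
    also have "\<dots> = C * q ^ DIM('a) * q powr (- 2 * \<sigma>) * S"
    proof -
      have "(c' * \<delta> / q) powr (2 * \<sigma>) = c' powr (2 * \<sigma>) * \<delta> powr (2 * \<sigma>) * q powr (- 2 * \<sigma>)"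
        using c' \<delta> q by (simp add: powr_mult powr_divide powr_minus_divide)
      moreover have "\<delta> powr (- 2 * \<sigma>) * \<delta> powr (2 * \<sigma>) = 1"
        using \<delta> by (simp add: powr_add[symmetric])
      ultimately show ?thesis
        unfolding C_def K_def by (simp add: algebra_simps)
    qed
    finally show ?thesis unfolding S_def .
  qed
  ultimately show ?thesis by blast
qed

end

text \<open>The case \<open>\<tau> = \<sigma>\<close>: samples are replaced by the mass on \<open>\<Omega>\<close> at the cost of a small multiple of the
  energy, which is absorbed.\<close>

lemma (in sobolev_kernel) energy_le_mass:
  assumes E: "finite E" "\<And>e. e \<in> E \<Longrightarrow> norm e = 1" and r: "0 < r" and \<theta>: "0 < \<theta>" "\<theta> \<le> 1"
    and \<Omega>: "open \<Omega>" and cone: "\<And>x. x \<in> \<Omega> \<Longrightarrow> \<exists>e\<in>E. cone_into \<Omega> r \<theta> e x" and c: "c > 0"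
  shows "\<exists>C>0. \<forall>\<delta> q X \<alpha>. 0 < \<delta> \<longrightarrow> \<delta> \<le> 1 \<longrightarrow> finite X \<longrightarrow> 0 < q \<longrightarrow> q \<le> c * \<delta> \<longrightarrow> separated (2 * q) X \<longrightarrow> X \<subseteq> \<Omega> \<longrightarrow>
     energy \<sigma> (trial \<delta> X \<alpha>) \<le> C * q powr (- 2 * \<sigma>) * mass_on \<Omega> (trial \<delta> X \<alpha>)"
proof -
  obtain m :: nat where "real m \<ge> max 1 \<sigma>" using real_arch_simple by blast
  then have m: "\<sigma> \<le> real m" "1 \<le> m" by auto
  obtain C1 where C1: "C1 > 0" and inv: "\<And>\<delta> q X \<alpha>. 0 < \<delta> \<Longrightarrow> finite X \<Longrightarrow> 0 < q \<Longrightarrow> q \<le> c * \<delta> \<Longrightarrow> separated q X \<Longrightarrow>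
     energy \<sigma> (trial \<delta> X \<alpha>) \<le> C1 * q ^ DIM('a) * q powr (- 2 * \<sigma>) * (\<Sum>x\<in>X. (norm (trial \<delta> X \<alpha> x))\<^sup>2)"
    using energy_le_samples[of c] by blast
  obtain C2 where C2: "C2 > 0" and loc: "\<And>\<rho> X \<Omega> f. finite X \<Longrightarrow> 0 < \<rho> \<Longrightarrow> real m * \<rho> \<le> r \<Longrightarrow> separated (2 * (real m * \<rho>)) X \<Longrightarrow> open \<Omega> \<Longrightarrow>
     (\<forall>x\<in>X. \<exists>e\<in>E. cone_into \<Omega> r \<theta> e x) \<Longrightarrow> ft_regular f \<Longrightarrow> integrable lborel (energy_density \<sigma> f) \<Longrightarrow>
     (\<Sum>x\<in>X. (norm (f x))\<^sup>2) \<le> C2 / \<rho> ^ DIM('a) * (\<rho> powr (2 * \<sigma>) * energy \<sigma> f + mass_on \<Omega> f)"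
    using sampling_in_cones[OF less_imp_le[OF sigma_pos] integrable_weight m E \<theta>, of r] by blast
  define g where "g = 2 * \<sigma> - real DIM('a)"
  have g: "g > 0" using order by (simp add: g_def)
  \<comment> \<open>The three bounds make the multiples of a step smaller than the separation, keep them within the height
      of the cones, and make the coefficient of the energy at most \<open>1 / 2\<close>.\<close>
  define \<epsilon> where "\<epsilon> = min (min (1 / real m) (r / (real m * c))) ((1 / (2 * C1 * C2)) powr (1 / g))"
  have \<epsilon>: "\<epsilon> > 0" using m r c C1 C2 by (simp add: \<epsilon>_def)
  have \<epsilon>1: "real m * \<epsilon> \<le> 1"
  proof -
    have "\<epsilon> \<le> 1 / real m" by (simp add: \<epsilon>_def)
    then show ?thesis using m by (simp add: field_simps)
  qed
  have \<epsilon>2: "real m * \<epsilon> * c \<le> r"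
  proof -
    have "\<epsilon> \<le> r / (real m * c)" by (simp add: \<epsilon>_def)
    then show ?thesis using m c by (simp add: field_simps)
  qed
  have \<epsilon>3: "C1 * C2 * \<epsilon> powr g \<le> 1 / 2"
  proof -
    have "\<epsilon> powr g \<le> ((1 / (2 * C1 * C2)) powr (1 / g)) powr g"
      using \<epsilon> g by (intro powr_mono2) (auto simp: \<epsilon>_def)
    also have "\<dots> = 1 / (2 * C1 * C2)" using g C1 C2 by (simp add: powr_powr)
    finally show ?thesis using C1 C2 by (simp add: field_simps)
  qed
  define C where "C = 2 * (C1 * C2 / \<epsilon> ^ DIM('a))"
  have "C > 0" using C1 C2 \<epsilon> by (simp add: C_def)
  moreover have "energy \<sigma> (trial \<delta> X \<alpha>) \<le> C * q powr (- 2 * \<sigma>) * mass_on \<Omega> (trial \<delta> X \<alpha>)"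
    if \<delta>: "0 < \<delta>" "\<delta> \<le> 1" and X: "finite X" and q: "0 < q" "q \<le> c * \<delta>" and sep: "separated (2 * q) X" and sub: "X \<subseteq> \<Omega>"
    for \<delta> q X \<alpha>
  proof -
    let ?f = "trial \<delta> X \<alpha>"
    define \<rho> where "\<rho> = \<epsilon> * q"
    have \<rho>: "\<rho> > 0" using \<epsilon> q by (simp add: \<rho>_def)
    have "c * \<delta> \<le> c * 1" using \<delta>(2) c by (intro mult_left_mono) auto
    with q(2) have qc: "q \<le> c" by linarith
    have "real m * \<rho> \<le> real m * \<epsilon> * c" unfolding \<rho>_def using mult_left_mono[OF qc, of "real m * \<epsilon>"] \<epsilon> by (simp add: mult_ac)
    also note \<epsilon>2
    finally have mr: "real m * \<rho> \<le> r" .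
    have "real m * \<rho> \<le> 1 * q" unfolding \<rho>_def mult.assoc[symmetric] using \<epsilon>1 q by (intro mult_right_mono) auto
    then have sep1: "separated (2 * (real m * \<rho>)) X" by (intro separated_mono[OF sep]) simp
    have sep2: "separated q X" by (rule separated_mono[OF sep]) (use q in simp)
    have conesX: "\<forall>x\<in>X. \<exists>e\<in>E. cone_into \<Omega> r \<theta> e x" using sub cone by blast
    have en: "energy \<sigma> ?f \<ge> 0" "mass_on \<Omega> ?f \<ge> 0" by (simp_all add: energy_nonneg mass_on_nonneg)
    have "energy \<sigma> ?f \<le> C1 * q ^ DIM('a) * q powr (- 2 * \<sigma>) * (\<Sum>x\<in>X. (norm (?f x))\<^sup>2)"
      by (rule inv[OF \<delta>(1) X q sep2])
    also have "\<dots> \<le> C1 * q ^ DIM('a) * q powr (- 2 * \<sigma>) * (C2 / \<rho> ^ DIM('a) * (\<rho> powr (2 * \<sigma>) * energy \<sigma> ?f + mass_on \<Omega> ?f))"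
      using C1 q by (intro mult_left_mono loc[OF X \<rho> mr sep1 \<Omega> conesX ft_regular_trial[OF \<delta>(1)] integrable_energy_trial[OF \<delta>(1)]]) auto
    also have "\<dots> = C1 * C2 * \<epsilon> powr g * energy \<sigma> ?f + C1 * C2 / \<epsilon> ^ DIM('a) * q powr (- 2 * \<sigma>) * mass_on \<Omega> ?f"
    proof -
      have 1: "q ^ DIM('a) / \<rho> ^ DIM('a) = 1 / \<epsilon> ^ DIM('a)" using q \<epsilon> by (simp add: \<rho>_def power_mult_distrib)
      have 2: "q powr (- 2 * \<sigma>) * \<rho> powr (2 * \<sigma>) = \<epsilon> powr (2 * \<sigma>)"
        using q \<epsilon> by (simp add: \<rho>_def powr_mult powr_add[symmetric])
      have 3: "\<epsilon> powr (2 * \<sigma>) / \<epsilon> ^ DIM('a) = \<epsilon> powr g"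
        using \<epsilon> by (simp add: g_def powr_diff powr_realpow)
      have "C1 * q ^ DIM('a) * q powr (- 2 * \<sigma>) * (C2 / \<rho> ^ DIM('a) * (\<rho> powr (2 * \<sigma>) * energy \<sigma> ?f + mass_on \<Omega> ?f))
          = C1 * C2 * (q ^ DIM('a) / \<rho> ^ DIM('a)) * (q powr (- 2 * \<sigma>) * \<rho> powr (2 * \<sigma>)) * energy \<sigma> ?f
            + C1 * C2 * (q ^ DIM('a) / \<rho> ^ DIM('a)) * q powr (- 2 * \<sigma>) * mass_on \<Omega> ?f"
        by (simp add: distrib_left add_divide_distrib mult_ac)
      also have "\<dots> = C1 * C2 * (\<epsilon> powr (2 * \<sigma>) / \<epsilon> ^ DIM('a)) * energy \<sigma> ?f + C1 * C2 / \<epsilon> ^ DIM('a) * q powr (- 2 * \<sigma>) * mass_on \<Omega> ?f"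
        unfolding 1 2 by (simp add: mult_ac)
      finally show ?thesis unfolding 3 .
    qed
    also have "\<dots> \<le> 1 / 2 * energy \<sigma> ?f + C1 * C2 / \<epsilon> ^ DIM('a) * q powr (- 2 * \<sigma>) * mass_on \<Omega> ?f"
      using \<epsilon>3 en by (intro add_right_mono mult_right_mono) auto
    finally show ?thesis by (simp add: C_def)
  qed
  ultimately show ?thesis by blast
qed

section \<open>A local extension operator\<close>

context
  fixes p m :: nat
  assumes p: "1 \<le> p"
begin

text \<open>The combination of dilated splines for which \<open>f - conv (mollifier r) f\<close> is the average of
  \<open>fdiff m (- r u) f\<close> over \<open>u\<close> with density \<open>spline (2 * p - 1) u\<close>. So \<open>1 - ft (mollifier r)\<close> has a zero of
  order \<open>m\<close> at the origin (\<open>one_minus_ft_mollifier\<close>), whereas the transform itself is a combination of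
  dilated spline transforms and decays.\<close>

definition mollifier :: "real \<Rightarrow> 'a::euclidean_space \<Rightarrow> complex" where
  "mollifier r u = (\<Sum>k\<in>{1..m}. - ((-1) ^ k * of_nat (m choose k)) *
     (spline (2 * p - 1) (u /\<^sub>R (real k * r)) / complex_of_real ((real k * r) ^ DIM('a))))"

definition spline_radius :: "'a::euclidean_space itself \<Rightarrow> real" where
  "spline_radius _ = real DIM('a) * (2 * real p)"

lemma spline_radius_ge_1: "spline_radius TYPE('a::euclidean_space) \<ge> 1"
proof -
  have "1 * 1 \<le> real DIM('a) * (2 * real p)" using p by (intro mult_mono) auto
  then show ?thesis by (simp add: spline_radius_def)
qed

lemma spline_zero_outside:
  fixes u :: "'a::euclidean_space"
  assumes "spline (2 * p - 1) u \<noteq> 0"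
  shows "norm u \<le> spline_radius TYPE('a)"
proof -
  obtain b where b: "b \<in> Basis" "norm u \<le> real DIM('a) * \<bar>u \<bullet> b\<bar>"
    using exists_large_coordinate by blast
  have "\<bar>u \<bullet> b\<bar> \<le> 2 * real p"
    using spline_support[OF assms b(1)] p by (simp add: of_nat_diff)
  then have "real DIM('a) * \<bar>u \<bullet> b\<bar> \<le> real DIM('a) * (2 * real p)" by (intro mult_left_mono) auto
  from order_trans[OF b(2) this] show ?thesis unfolding spline_radius_def .
qed

lemma integrable_mollifier:
  assumes r: "r > 0"
  shows "integrable lborel (mollifier r :: 'a::euclidean_space \<Rightarrow> complex)"
proof -
  have "integrable lborel (\<lambda>u::'a. spline (2 * p - 1) (u /\<^sub>R (real k * r)))" if "k \<in> {1..m}" for k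
    using integrable_lborel_affine_iff[of "inverse (real k * r)" "spline (2 * p - 1) :: 'a \<Rightarrow> complex" 0] that r
    by (simp add: integrable_spline)
  then show ?thesis
    unfolding mollifier_def[abs_def]
    by (intro Bochner_Integration.integrable_sum integrable_mult_right integrable_divide_zero) auto
qed

lemma mollifier_zero_outside:
  fixes u :: "'a::euclidean_space"
  assumes r: "r > 0" and u: "mollifier r u \<noteq> 0"
  shows "norm u \<le> real m * (r * spline_radius TYPE('a))"
proof -
  obtain k where k: "k \<in> {1..m}" "spline (2 * p - 1) (u /\<^sub>R (real k * r)) \<noteq> 0"
    using u unfolding mollifier_def by (metis (no_types, lifting) div_0 mult_zero_right sum.neutral)
  have kr: "real k * r > 0" using k(1) r by simp
  have "norm (u /\<^sub>R (real k * r)) \<le> spline_radius TYPE('a)" by (rule spline_zero_outside[OF k(2)])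
  then have "norm u / (real k * r) \<le> spline_radius TYPE('a)"
    using kr by (simp only: norm_scaleR abs_of_pos positive_imp_inverse_positive divide_inverse mult.commute)
  then have "norm u \<le> spline_radius TYPE('a) * (real k * r)"
    unfolding pos_divide_le_eq[OF kr] .
  also have "\<dots> \<le> spline_radius TYPE('a) * (real m * r)"
    using k(1) r spline_radius_ge_1[where 'a='a] by (intro mult_left_mono mult_right_mono) auto
  finally show ?thesis by (simp add: mult_ac)
qed

lemma ft_mollifier:
  fixes \<omega> :: "'a::euclidean_space"
  assumes r: "r > 0"
  shows "ft (mollifier r) \<omega> = (\<Sum>k\<in>{1..m}. - ((-1) ^ k * of_nat (m choose k)) * complex_of_real (sinc_prod ((real k * r) *\<^sub>R \<omega>) ^ (2 * p)))"
proof -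
  let ?s = "\<lambda>k (u::'a). spline (2 * p - 1) (u /\<^sub>R (real k * r)) / complex_of_real ((real k * r) ^ DIM('a))"
  have i: "integrable lborel (?s k)" if "k \<in> {1..m}" for k
    using integrable_lborel_affine_iff[of "inverse (real k * r)" "spline (2 * p - 1) :: 'a \<Rightarrow> complex" 0] that r
    by (intro integrable_divide_zero) (simp add: integrable_spline)
  have s: "ft (?s k) \<omega> = complex_of_real (sinc_prod ((real k * r) *\<^sub>R \<omega>) ^ (2 * p))" if "k \<in> {1..m}" for k
  proof -
    have "real k * r > 0" using that r by simp
    from ft_scale[OF this, of "spline (2 * p - 1)" \<omega>] show ?thesis
      using p by (simp only: ft_spline) simp
  qed
  have "ft (mollifier r) \<omega> = (\<Sum>k\<in>{1..m}. - ((-1) ^ k * of_nat (m choose k)) * ft (?s k) \<omega>)"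
    unfolding mollifier_def[abs_def] using i
    by (subst ft_sum) (auto simp only: ft_cmult intro!: integrable_mult_right)
  also have "\<dots> = (\<Sum>k\<in>{1..m}. - ((-1) ^ k * of_nat (m choose k)) * complex_of_real (sinc_prod ((real k * r) *\<^sub>R \<omega>) ^ (2 * p)))"
    by (intro sum.cong refl) (simp only: s)
  finally show ?thesis .
qed

lemma one_minus_ft_mollifier:
  fixes \<omega> :: "'a::euclidean_space"
  assumes r: "r > 0"
  shows "1 - ft (mollifier r) \<omega> = (LINT u|lborel. spline (2 * p - 1) u * (1 - wave (r *\<^sub>R \<omega>) u) ^ m)"
proof -
  let ?g = "spline (2 * p - 1) :: 'a \<Rightarrow> complex"
  have pow: "wave (real k *\<^sub>R (r *\<^sub>R \<omega>)) u = wave (r *\<^sub>R \<omega>) u ^ k" for k u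
    by (simp add: wave_def exp_of_nat_mult[symmetric] algebra_simps)
  have B: "complex_of_real (sinc_prod ((real k * r) *\<^sub>R \<omega>) ^ (2 * p)) = (LINT u|lborel. ?g u * wave (r *\<^sub>R \<omega>) u ^ k)" for k
  proof -
    have "(LINT u|lborel. ?g u * wave (r *\<^sub>R \<omega>) u ^ k) = ft ?g (real k *\<^sub>R (r *\<^sub>R \<omega>))"
      unfolding ft_def pow ..
    then show ?thesis using p by (simp only: ft_spline) simp
  qed
  have i: "integrable lborel (\<lambda>u. ?g u * wave (r *\<^sub>R \<omega>) u ^ k)" for k
    using integrable_spline[of "2 * p - 1"] unfolding pow[symmetric] by (subst integrable_mult_wave)
  have "{..m} = insert 0 {1..m}" by auto
  then have "1 - ft (mollifier r) \<omega> = (\<Sum>k\<le>m. (-1) ^ k * of_nat (m choose k) * complex_of_real (sinc_prod ((real k * r) *\<^sub>R \<omega>) ^ (2 * p)))"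
    by (simp add: ft_mollifier[OF r] sum_negf sinc_prod_def[of 0])
  also have "\<dots> = (LINT u|lborel. (\<Sum>k\<le>m. (-1) ^ k * of_nat (m choose k) * (?g u * wave (r *\<^sub>R \<omega>) u ^ k)))"
    unfolding B using i by (subst Bochner_Integration.integral_sum) auto
  also have "\<dots> = (LINT u|lborel. ?g u * (1 - wave (r *\<^sub>R \<omega>) u) ^ m)"
  proof (intro Bochner_Integration.integral_cong refl)
    fix u
    have "(\<Sum>k\<le>m. (-1) ^ k * of_nat (m choose k) * (?g u * wave (r *\<^sub>R \<omega>) u ^ k)) = ?g u * (\<Sum>k\<le>m. of_nat (m choose k) * (- wave (r *\<^sub>R \<omega>) u) ^ k * 1 ^ (m - k))"
      unfolding sum_distrib_left by (intro sum.cong refl) (simp add: power_minus[of "wave _ _"])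
    also have "\<dots> = ?g u * (- wave (r *\<^sub>R \<omega>) u + 1) ^ m" by (simp only: binomial_ring)
    finally show "(\<Sum>k\<le>m. (-1) ^ k * of_nat (m choose k) * (?g u * wave (r *\<^sub>R \<omega>) u ^ k)) = ?g u * (1 - wave (r *\<^sub>R \<omega>) u) ^ m"
      by simp
  qed
  finally show ?thesis .
qed

lemma norm_one_minus_ft_mollifier:
  fixes \<omega> :: "'a::euclidean_space"
  assumes r: "r > 0"
  shows "norm (1 - ft (mollifier r) \<omega>) \<le> (LINT u|lborel. norm (spline (2 * p - 1) (u::'a))) * min 2 (r * spline_radius TYPE('a) * norm \<omega>) ^ m"
proof -
  let ?g = "spline (2 * p - 1) :: 'a \<Rightarrow> complex"
  define z where "z = min 2 (r * spline_radius TYPE('a) * norm \<omega>)"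
  have z: "z \<ge> 0" using r spline_radius_ge_1[where 'a='a] by (simp add: z_def)
  have le: "norm (?g u * (1 - wave (r *\<^sub>R \<omega>) u) ^ m) \<le> norm (?g u) * z ^ m" for u
  proof (cases "?g u = 0")
    case False
    from spline_zero_outside[OF False] have "norm u * norm (r *\<^sub>R \<omega>) \<le> spline_radius TYPE('a) * norm (r *\<^sub>R \<omega>)"
      by (rule mult_right_mono) simp
    also have "\<dots> = r * spline_radius TYPE('a) * norm \<omega>" using r by simp
    finally have "norm (1 - wave (r *\<^sub>R \<omega>) u) \<le> z"
      unfolding z_def using norm_one_minus_wave[of "r *\<^sub>R \<omega>" u] by (intro min.boundedI) (auto simp only: order_trans)
    then show ?thesis by (simp add: norm_mult norm_power mult_left_mono power_mono)
  qed simp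
  have ig: "integrable lborel (\<lambda>u. norm (?g u) * z ^ m)"
    using integrable_spline[of "2 * p - 1", where 'a='a] by simp
  have "norm (LINT u|lborel. ?g u * (1 - wave (r *\<^sub>R \<omega>) u) ^ m) \<le> (LINT u|lborel. norm (?g u) * z ^ m)"
  proof (rule Bochner_Integration.integral_norm_bound_integral[OF _ ig le])
    show "integrable lborel (\<lambda>u. ?g u * (1 - wave (r *\<^sub>R \<omega>) u) ^ m)"
    proof (rule Bochner_Integration.integrable_bound[OF ig])
      show "AE u in lborel. norm (?g u * (1 - wave (r *\<^sub>R \<omega>) u) ^ m) \<le> norm (norm (?g u) * z ^ m)"
        unfolding real_norm_def by (intro AE_I2 order_trans[OF le abs_ge_self])
    qed measurable
  qed
  then show ?thesis
    unfolding one_minus_ft_mollifier[OF r] z_def[symmetric] by simp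
qed

lemma norm_ft_mollifier:
  fixes \<omega> :: "'a::euclidean_space"
  assumes r: "r > 0"
  shows "norm (ft (mollifier r) \<omega>) \<le> real m * 2 ^ m * (1 + (real DIM('a))\<^sup>2) ^ p * weight (- real p) (r *\<^sub>R \<omega>)"
proof -
  have "norm (ft (mollifier r) \<omega>) \<le> (\<Sum>k\<in>{1..m}. 2 ^ m * ((1 + (real DIM('a))\<^sup>2) ^ p * weight (- real p) (r *\<^sub>R \<omega>)))"
    unfolding ft_mollifier[OF r]
  proof (rule sum_norm_le)
    fix k assume k: "k \<in> {1..m}"
    have c: "real (m choose k) \<le> 2 ^ m" using binomial_le_pow2[of m k] by (metis of_nat_le_iff of_nat_power of_nat_numeral)
    have nn: "sinc_prod ((real k * r) *\<^sub>R \<omega>) ^ (2 * p) \<ge> 0" by (simp add: power_mult)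
    have "sinc_prod ((real k * r) *\<^sub>R \<omega>) ^ (2 * p) \<le> (1 + (real DIM('a))\<^sup>2) ^ p * weight (- real p) ((real k * r) *\<^sub>R \<omega>)"
      by (rule sinc_prod_decay) simp
    also have "\<dots> \<le> (1 + (real DIM('a))\<^sup>2) ^ p * weight (- real p) (r *\<^sub>R \<omega>)"
      using k r by (intro mult_left_mono weight_scale_le) auto
    finally have "real (m choose k) * sinc_prod ((real k * r) *\<^sub>R \<omega>) ^ (2 * p) \<le> 2 ^ m * ((1 + (real DIM('a))\<^sup>2) ^ p * weight (- real p) (r *\<^sub>R \<omega>))"
      using c nn by (intro mult_mono) auto
    then show "norm (- ((-1) ^ k * of_nat (m choose k)) * complex_of_real (sinc_prod ((real k * r) *\<^sub>R \<omega>) ^ (2 * p))) \<le> 2 ^ m * ((1 + (real DIM('a))\<^sup>2) ^ p * weight (- real p) (r *\<^sub>R \<omega>))"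
      using nn by (simp only: norm_mult norm_minus_cancel norm_power norm_of_real norm_of_nat norm_one power_one abs_of_nonneg mult_1)
  qed
  then show ?thesis by (simp add: mult_ac)
qed

lemma weight_le_scaled:
  assumes \<tau>: "0 \<le> \<tau>" and \<eta>: "0 < \<eta>" "\<eta> \<le> 1"
  shows "weight \<tau> \<omega> \<le> \<eta> powr (- 2 * \<tau>) * weight \<tau> (\<eta> *\<^sub>R \<omega>)"
proof -
  have "weight (- \<tau>) (\<eta> *\<^sub>R \<omega>) \<le> (1 / \<eta>) powr (2 * \<tau>) * weight (- \<tau>) (1 *\<^sub>R \<omega>)"
    by (rule weight_scale_ge[OF \<tau> \<eta>])
  moreover have "(1 / \<eta>) powr (2 * \<tau>) = \<eta> powr (- 2 * \<tau>)"
    using \<eta> by (simp add: powr_divide powr_minus_divide)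
  ultimately show ?thesis
    using weight_pos[of \<tau> \<omega>] weight_pos[of \<tau> "\<eta> *\<^sub>R \<omega>"] by (simp add: weight_minus field_simps)
qed

text \<open>The factor in front of the transform of \<open>f\<close>: it converts a Bessel weight of order \<open>\<tau>\<close> into the weight of
  the energy.\<close>

lemma mollifier_low_frequencies:
  fixes \<omega> :: "'a::euclidean_space"
  assumes \<tau>: "0 \<le> \<tau>" "\<tau> \<le> \<sigma>" and m: "\<sigma> \<le> real m" "1 \<le> m" and \<eta>: "0 < \<eta>" "\<eta> \<le> 1"
    and r: "r * spline_radius TYPE('a) = \<eta>" "r > 0"
  shows "weight \<tau> \<omega> * (norm (1 - ft (mollifier r) \<omega>))\<^sup>2
     \<le> (LINT u|lborel. norm (spline (2 * p - 1) (u::'a)))\<^sup>2 * (2 powr \<tau> * 4 ^ m) * \<eta> powr (2 * \<sigma> - 2 * \<tau>) * norm \<omega> powr (2 * \<sigma>)"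
proof -
  define G where "G = (LINT u|lborel. norm (spline (2 * p - 1) (u::'a)))"
  define z where "z = min 2 (\<eta> * norm \<omega>)"
  have z: "0 \<le> z" "z \<le> 2" "z \<le> \<eta> * norm \<omega>" using \<eta> by (auto simp: z_def)
  have "norm (1 - ft (mollifier r) \<omega>) \<le> G * z ^ m"
    using norm_one_minus_ft_mollifier[OF r(2), of \<omega>] unfolding r(1) G_def z_def .
  then have "(norm (1 - ft (mollifier r) \<omega>))\<^sup>2 \<le> (G * z ^ m)\<^sup>2" by (intro power_mono) auto
  also have "\<dots> = G\<^sup>2 * z ^ (2 * m)" by (simp add: power_mult_distrib power_mult[symmetric] mult.commute[of m])
  finally have 1: "(norm (1 - ft (mollifier r) \<omega>))\<^sup>2 \<le> G\<^sup>2 * z ^ (2 * m)" .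
  have "weight \<tau> \<omega> * (norm (1 - ft (mollifier r) \<omega>))\<^sup>2 \<le> (\<eta> powr (- 2 * \<tau>) * weight \<tau> (\<eta> *\<^sub>R \<omega>)) * (G\<^sup>2 * z ^ (2 * m))"
    by (intro mult_mono weight_le_scaled \<tau> \<eta> 1) auto
  also have "\<dots> = \<eta> powr (- 2 * \<tau>) * G\<^sup>2 * ((1 + (\<eta> * norm \<omega>)\<^sup>2) powr \<tau> * z ^ (2 * m))"
    using \<eta> by (simp add: weight_def mult_ac)
  also have "\<dots> \<le> \<eta> powr (- 2 * \<tau>) * G\<^sup>2 * (2 powr \<tau> * 4 ^ m * (\<eta> * norm \<omega>) powr (2 * \<sigma>))"
    by (intro mult_left_mono difference_symbol_bound \<tau> m z) auto
  also have "\<dots> = G\<^sup>2 * (2 powr \<tau> * 4 ^ m) * (\<eta> powr (- 2 * \<tau>) * \<eta> powr (2 * \<sigma>)) * norm \<omega> powr (2 * \<sigma>)"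
    using \<eta> by (simp add: powr_mult mult_ac)
  also have "\<eta> powr (- 2 * \<tau>) * \<eta> powr (2 * \<sigma>) = \<eta> powr (2 * \<sigma> - 2 * \<tau>)"
    by (simp add: powr_add[symmetric])
  finally show ?thesis unfolding G_def .
qed

text \<open>The factor in front of the transform of the restriction to the neighbourhood: decay of order \<open>p \<ge> \<tau>\<close>
  compensates the Bessel weight.\<close>

lemma mollifier_high_frequencies:
  fixes \<omega> :: "'a::euclidean_space"
  assumes \<tau>: "0 \<le> \<tau>" "\<tau> \<le> real p" and \<eta>: "0 < \<eta>" "\<eta> \<le> 1"
    and r: "r * spline_radius TYPE('a) = \<eta>" "r > 0"
  shows "weight \<tau> \<omega> * (norm (ft (mollifier r) \<omega>))\<^sup>2
     \<le> spline_radius TYPE('a) powr (2 * \<tau>) * (real m * 2 ^ m * (1 + (real DIM('a))\<^sup>2) ^ p)\<^sup>2 * \<eta> powr (- 2 * \<tau>)"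
proof -
  define R where "R = spline_radius TYPE('a)"
  have R: "R \<ge> 1" unfolding R_def by (rule spline_radius_ge_1)
  define K where "K = real m * 2 ^ m * (1 + (real DIM('a))\<^sup>2) ^ p"
  have "weight (- \<tau>) (r *\<^sub>R \<omega>) \<le> (\<eta> / r) powr (2 * \<tau>) * weight (- \<tau>) (\<eta> *\<^sub>R \<omega>)"
    using r(1)[symmetric] r(2) R by (intro weight_scale_ge \<tau>) (auto simp: R_def[symmetric])
  moreover have "\<eta> / r = R" using r by (simp add: R_def field_simps)
  ultimately have w: "weight \<tau> (\<eta> *\<^sub>R \<omega>) \<le> R powr (2 * \<tau>) * weight \<tau> (r *\<^sub>R \<omega>)"
    using weight_pos[of \<tau> "r *\<^sub>R \<omega>"] weight_pos[of \<tau> "\<eta> *\<^sub>R \<omega>"] by (simp add: weight_minus field_simps)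
  define W where "W = weight (real p) (r *\<^sub>R \<omega>)"
  have W: "W \<ge> 1" unfolding W_def weight_def by (intro ge_one_powr_ge_zero) auto
  have \<tau>W: "weight \<tau> (r *\<^sub>R \<omega>) \<le> W"
    unfolding W_def weight_def using \<tau> by (intro powr_mono) auto
  have "(norm (ft (mollifier r) \<omega>))\<^sup>2 \<le> (K * (1 / W))\<^sup>2"
    using norm_ft_mollifier[OF r(2), of \<omega>] unfolding K_def W_def weight_minus by (intro power_mono) auto
  then have "weight \<tau> \<omega> * (norm (ft (mollifier r) \<omega>))\<^sup>2 \<le> (\<eta> powr (- 2 * \<tau>) * (R powr (2 * \<tau>) * W)) * (K * (1 / W))\<^sup>2"
  proof (intro mult_mono)
    have "weight \<tau> (\<eta> *\<^sub>R \<omega>) \<le> R powr (2 * \<tau>) * W"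
      by (rule order_trans[OF w mult_left_mono[OF \<tau>W]]) simp
    then show "weight \<tau> \<omega> \<le> \<eta> powr (- 2 * \<tau>) * (R powr (2 * \<tau>) * W)"
      by (intro order_trans[OF weight_le_scaled[OF \<tau>(1) \<eta>, of \<omega>] mult_left_mono]) simp_all
  qed (use W in auto)
  also have "\<dots> = \<eta> powr (- 2 * \<tau>) * R powr (2 * \<tau>) * K\<^sup>2 * (1 / W)"
    using W by (simp add: power2_eq_square)
  also have "\<dots> \<le> \<eta> powr (- 2 * \<tau>) * R powr (2 * \<tau>) * K\<^sup>2 * 1"
    using W by (intro mult_left_mono) auto
  finally show ?thesis by (simp add: R_def K_def mult_ac)
qed

end

lemma
  fixes \<kappa> f :: "'a::euclidean_space \<Rightarrow> complex"
  assumes \<kappa>: "integrable lborel \<kappa>" and f: "integrable lborel f" and M: "\<And>x. norm (f x) \<le> M"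
  shows square_integrable_conv: "integrable lborel (\<lambda>x. (norm (conv \<kappa> f x))\<^sup>2)"
proof -
  have [measurable]: "\<kappa> \<in> borel_measurable borel" "f \<in> borel_measurable borel"
    using borel_measurable_integrable[OF \<kappa>] borel_measurable_integrable[OF f] by auto
  define B where "B = (LINT u|lborel. M * norm (\<kappa> u))"
  have iM: "integrable lborel (\<lambda>u. M * norm (\<kappa> u))" using \<kappa> by simp
  have le: "norm (\<kappa> u * f (x - u)) \<le> M * norm (\<kappa> u)" for u x
    using mult_left_mono[OF M[of "x - u"], of "norm (\<kappa> u)"] by (simp add: norm_mult mult.commute)
  have B: "norm (conv \<kappa> f x) \<le> B" for x
    unfolding conv_def B_def
  proof (rule Bochner_Integration.integral_norm_bound_integral[OF _ iM le])
    show "integrable lborel (\<lambda>u. \<kappa> u * f (x - u))"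
    proof (rule Bochner_Integration.integrable_bound[OF iM])
      show "AE u in lborel. norm (\<kappa> u * f (x - u)) \<le> norm (M * norm (\<kappa> u))"
        unfolding real_norm_def by (intro AE_I2 order_trans[OF le abs_ge_self])
    qed measurable
  qed
  have "integrable lborel (\<lambda>x. B * norm (conv \<kappa> f x))"
    using integrable_conv[OF \<kappa> f] by simp
  then show ?thesis
  proof (rule Bochner_Integration.integrable_bound)
    show "AE x in lborel. norm ((norm (conv \<kappa> f x))\<^sup>2) \<le> norm (B * norm (conv \<kappa> f x))"
    proof (rule AE_I2)
      fix x
      have "(norm (conv \<kappa> f x))\<^sup>2 \<le> B * norm (conv \<kappa> f x)"
        unfolding power2_eq_square by (intro mult_right_mono B) simp
      then show "norm ((norm (conv \<kappa> f x))\<^sup>2) \<le> norm (B * norm (conv \<kappa> f x))" by simp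
    qed
  qed measurable
qed

text \<open>The extension is \<open>w = f - conv \<kappa> f1\<close>, where \<open>f1\<close> is \<open>f\<close> outside \<open>S\<close> and \<open>0\<close> on \<open>S\<close>. The support of \<open>\<kappa>\<close>
  lies in the ball of radius \<open>m \<eta>\<close>, so the convolution vanishes on \<open>\<Omega>\<close>. Its transform involves \<open>f\<close> itself only through the
  factor \<open>1 - ft \<kappa>\<close>; in this way the size of \<open>f\<close> far away from \<open>\<Omega>\<close> enters through the energy alone.\<close>

lemma local_extension:
  assumes \<tau>: "0 \<le> \<tau>" "\<tau> \<le> \<sigma>"
  shows "\<exists>C>0. \<exists>L>0. \<forall>\<eta> \<Omega> S (f :: 'a::euclidean_space \<Rightarrow> complex). 0 < \<eta> \<longrightarrow> \<eta> \<le> 1 \<longrightarrow> S \<in> sets borel \<longrightarrow>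
     (\<forall>x\<in>\<Omega>. \<forall>y. norm (y - x) \<le> L * \<eta> \<longrightarrow> y \<in> S) \<longrightarrow> ft_regular f \<longrightarrow> integrable lborel (energy_density \<sigma> f) \<longrightarrow>
     (\<exists>w. integrable lborel w \<and> integrable lborel (\<lambda>x. (norm (w x))\<^sup>2) \<and> (\<forall>x\<in>\<Omega>. w x = f x) \<and>
        integrable lborel (\<lambda>\<omega>. weight \<tau> \<omega> * (norm (ft w \<omega>))\<^sup>2) \<and>
        (LINT \<omega>|lborel. weight \<tau> \<omega> * (norm (ft w \<omega>))\<^sup>2) \<le> C * (\<eta> powr (2 * \<sigma> - 2 * \<tau>) * energy \<sigma> f + \<eta> powr (- 2 * \<tau>) * mass_on S f))"
proof -
  obtain m :: nat where "real m \<ge> max 1 \<sigma>" using real_arch_simple by blast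
  then have m: "\<sigma> \<le> real m" "1 \<le> m" by auto
  note p = m(2)
  let ?\<pi> = "(2 * pi) ^ DIM('a)"
  define R where "R = spline_radius m TYPE('a)"
  have R: "R \<ge> 1" unfolding R_def by (rule spline_radius_ge_1[OF p])
  define A where "A = (LINT u|lborel. norm (spline (2 * m - 1) (u::'a)))\<^sup>2 * (2 powr \<tau> * 4 ^ m)"
  define B where "B = R powr (2 * \<tau>) * (real m * 2 ^ m * (1 + (real DIM('a))\<^sup>2) ^ m)\<^sup>2"
  have AB: "A \<ge> 0" "B \<ge> 0" by (auto simp: A_def B_def)
  define C where "C = 2 * A + 2 * B * ?\<pi> + 1"
  have C: "C > 0" using AB by (simp add: C_def add_nonneg_pos)
  have L: "real m > 0" using m by simp
  have "\<exists>w. integrable lborel w \<and> integrable lborel (\<lambda>x. (norm (w x))\<^sup>2) \<and> (\<forall>x\<in>\<Omega>. w x = f x) \<and>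
        integrable lborel (\<lambda>\<omega>. weight \<tau> \<omega> * (norm (ft w \<omega>))\<^sup>2) \<and>
        (LINT \<omega>|lborel. weight \<tau> \<omega> * (norm (ft w \<omega>))\<^sup>2) \<le> C * (\<eta> powr (2 * \<sigma> - 2 * \<tau>) * energy \<sigma> f + \<eta> powr (- 2 * \<tau>) * mass_on S f)"
    if \<eta>: "0 < \<eta>" "\<eta> \<le> 1" and S: "S \<in> sets borel" and near: "\<And>x y. x \<in> \<Omega> \<Longrightarrow> norm (y - x) \<le> real m * \<eta> \<Longrightarrow> y \<in> S"
      and f: "ft_regular f" and e: "integrable lborel (energy_density \<sigma> f)" for \<eta> \<Omega> S and f :: "'a \<Rightarrow> complex"
  proof -
    note F = ft_regularD[OF f]
    have [measurable]: "f \<in> borel_measurable borel" by (rule F)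
    have [measurable]: "S \<in> sets borel" by (rule S)
    define r where "r = \<eta> / R"
    have r: "r * spline_radius m TYPE('a) = \<eta>" "r > 0" using \<eta> R by (auto simp: r_def R_def[symmetric])
    define \<kappa> where "\<kappa> = (mollifier m m r :: 'a \<Rightarrow> complex)"
    have \<kappa>: "integrable lborel \<kappa>" unfolding \<kappa>_def by (rule integrable_mollifier[OF p r(2)])
    define f0 where "f0 x = indicator S x * f x" for x
    define f1 where "f1 x = f x - f0 x" for x
    have f0m [measurable]: "f0 \<in> borel_measurable borel" unfolding f0_def[abs_def] by measurable
    have f0_le: "norm (f0 x) \<le> norm (f x)" for x by (simp add: f0_def norm_mult indicator_def)
    have f0: "integrable lborel f0"
      by (rule Bochner_Integration.integrable_bound[OF F(2)]) (auto intro!: AE_I2 f0_le)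
    have f0_sq: "(\<lambda>x. (norm (f0 x))\<^sup>2) = (\<lambda>x. indicator S x * (norm (f x))\<^sup>2)"
      by (auto simp: f0_def norm_mult indicator_def)
    have f0_2: "integrable lborel (\<lambda>x. (norm (f0 x))\<^sup>2)"
      unfolding f0_sq by (rule integrable_mass_on[OF F(4) S])
    have f1: "integrable lborel f1" unfolding f1_def[abs_def] using F(2) f0 by simp
    define M where "M = (LINT \<omega>|lborel. norm (ft f \<omega>))"
    have fM: "norm (f x) \<le> M" for x
    proof -
      have "1 * norm (f x) \<le> ?\<pi> * norm (f x)"
        by (rule mult_right_mono[OF two_pi_power_ge_1]) simp
      with norm_le_integral_ft[OF F(2,1,3), of x] show ?thesis unfolding M_def by linarith
    qed
    have f1M: "norm (f1 x) \<le> M" for x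
      using fM[of x] order_trans[OF norm_ge_zero fM[of x]] by (simp add: f1_def f0_def indicator_def)
    define w where "w x = f x - conv \<kappa> f1 x" for x
    have cv: "integrable lborel (conv \<kappa> f1)" by (rule integrable_conv[OF \<kappa> f1])
    have [measurable]: "conv \<kappa> f1 \<in> borel_measurable borel" using borel_measurable_integrable[OF cv] by simp
    have w: "integrable lborel w" unfolding w_def[abs_def] using F(2) cv by simp
    have [measurable]: "w \<in> borel_measurable borel" using borel_measurable_integrable[OF w] by simp
    have w2: "integrable lborel (\<lambda>x. (norm (w x))\<^sup>2)"
    proof (rule Bochner_Integration.integrable_bound)
      show "integrable lborel (\<lambda>x. 2 * (norm (f x))\<^sup>2 + 2 * (norm (conv \<kappa> f1 x))\<^sup>2)"
        using F(4) square_integrable_conv[OF \<kappa> f1 f1M] by simp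
      show "AE x in lborel. norm ((norm (w x))\<^sup>2) \<le> norm (2 * (norm (f x))\<^sup>2 + 2 * (norm (conv \<kappa> f1 x))\<^sup>2)"
        using power2_norm_triangle[of "f x" "- conv \<kappa> f1 x" for x] by (intro AE_I2) (simp add: w_def)
    qed measurable
    have wf: "w x = f x" if x: "x \<in> \<Omega>" for x
    proof -
      have "(\<lambda>u. \<kappa> u * f1 (x - u)) = (\<lambda>_. 0)"
      proof (rule ext)
        fix u
        show "\<kappa> u * f1 (x - u) = 0"
        proof (cases "\<kappa> u = 0")
          case False
          then have "norm u \<le> real m * \<eta>"
            using mollifier_zero_outside[OF p r(2), of m u] unfolding \<kappa>_def r(1) by blast
          then have "x - u \<in> S" using near[OF x, of "x - u"] by simp
          then show ?thesis by (simp add: f1_def f0_def)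
        qed simp
      qed
      then show ?thesis by (simp add: w_def conv_def)
    qed
    have ftw: "ft w \<omega> = (1 - ft \<kappa> \<omega>) * ft f \<omega> + ft \<kappa> \<omega> * ft f0 \<omega>" for \<omega>
    proof -
      have "ft w \<omega> = ft f \<omega> - ft \<kappa> \<omega> * ft f1 \<omega>"
        unfolding w_def[abs_def] using ft_diff[OF F(2) cv] ft_conv[OF \<kappa> f1] by simp
      moreover have "ft f1 \<omega> = ft f \<omega> - ft f0 \<omega>"
        unfolding f1_def[abs_def] by (rule ft_diff[OF F(2) f0])
      ultimately show ?thesis by (simp add: algebra_simps)
    qed
    let ?b = "\<lambda>\<omega>. 2 * A * \<eta> powr (2 * \<sigma> - 2 * \<tau>) * energy_density \<sigma> f \<omega> + 2 * B * \<eta> powr (- 2 * \<tau>) * (norm (ft f0 \<omega>))\<^sup>2"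
    have le: "weight \<tau> \<omega> * (norm (ft w \<omega>))\<^sup>2 \<le> ?b \<omega>" for \<omega>
    proof -
      have "weight \<tau> \<omega> * (norm (1 - ft \<kappa> \<omega>))\<^sup>2 \<le> A * \<eta> powr (2 * \<sigma> - 2 * \<tau>) * norm \<omega> powr (2 * \<sigma>)"
        unfolding A_def \<kappa>_def by (rule mollifier_low_frequencies[OF p \<tau> m \<eta> r])
      from mult_right_mono[OF this, of "(norm (ft f \<omega>))\<^sup>2"]
      have 1: "weight \<tau> \<omega> * (norm ((1 - ft \<kappa> \<omega>) * ft f \<omega>))\<^sup>2 \<le> A * \<eta> powr (2 * \<sigma> - 2 * \<tau>) * energy_density \<sigma> f \<omega>"
        by (simp add: energy_density_def norm_mult power_mult_distrib mult_ac)
      have \<tau>m: "\<tau> \<le> real m" using \<tau>(2) m(1) by linarith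
      have "weight \<tau> \<omega> * (norm (ft \<kappa> \<omega>))\<^sup>2 \<le> B * \<eta> powr (- 2 * \<tau>)"
        unfolding B_def \<kappa>_def R_def by (rule mollifier_high_frequencies[OF p \<tau>(1) \<tau>m \<eta> r])
      from mult_right_mono[OF this, of "(norm (ft f0 \<omega>))\<^sup>2"]
      have 2: "weight \<tau> \<omega> * (norm (ft \<kappa> \<omega> * ft f0 \<omega>))\<^sup>2 \<le> B * \<eta> powr (- 2 * \<tau>) * (norm (ft f0 \<omega>))\<^sup>2"
        by (simp add: norm_mult power_mult_distrib mult_ac)
      have "weight \<tau> \<omega> * (norm (ft w \<omega>))\<^sup>2 \<le> weight \<tau> \<omega> * (2 * (norm ((1 - ft \<kappa> \<omega>) * ft f \<omega>))\<^sup>2 + 2 * (norm (ft \<kappa> \<omega> * ft f0 \<omega>))\<^sup>2)"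
        unfolding ftw by (intro mult_left_mono power2_norm_triangle) simp
      also have "\<dots> = 2 * (weight \<tau> \<omega> * (norm ((1 - ft \<kappa> \<omega>) * ft f \<omega>))\<^sup>2) + 2 * (weight \<tau> \<omega> * (norm (ft \<kappa> \<omega> * ft f0 \<omega>))\<^sup>2)"
        by (simp only: distrib_left mult.left_commute)
      also have "\<dots> \<le> 2 * (A * \<eta> powr (2 * \<sigma> - 2 * \<tau>) * energy_density \<sigma> f \<omega>) + 2 * (B * \<eta> powr (- 2 * \<tau>) * (norm (ft f0 \<omega>))\<^sup>2)"
        by (intro add_mono mult_left_mono 1 2) auto
      finally show ?thesis by (simp only: mult.assoc)
    qed
    have ib: "integrable lborel ?b"
      using e plancherel_integrable[OF f0 f0_2] by (intro Bochner_Integration.integrable_add integrable_mult_right)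
    have iw: "integrable lborel (\<lambda>\<omega>. weight \<tau> \<omega> * (norm (ft w \<omega>))\<^sup>2)"
    proof (rule Bochner_Integration.integrable_bound[OF ib])
      show "AE \<omega> in lborel. norm (weight \<tau> \<omega> * (norm (ft w \<omega>))\<^sup>2) \<le> norm (?b \<omega>)"
      proof (rule AE_I2)
        fix \<omega>
        have "norm (weight \<tau> \<omega> * (norm (ft w \<omega>))\<^sup>2) = weight \<tau> \<omega> * (norm (ft w \<omega>))\<^sup>2" by (simp add: abs_mult)
        with le[of \<omega>] show "norm (weight \<tau> \<omega> * (norm (ft w \<omega>))\<^sup>2) \<le> norm (?b \<omega>)"
          unfolding real_norm_def[of "?b \<omega>"] by linarith
      qed
    qed measurable
    have "(LINT \<omega>|lborel. weight \<tau> \<omega> * (norm (ft w \<omega>))\<^sup>2) \<le> (LINT \<omega>|lborel. ?b \<omega>)"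
      by (rule integral_mono[OF iw ib le])
    also have "\<dots> = 2 * A * \<eta> powr (2 * \<sigma> - 2 * \<tau>) * energy \<sigma> f + 2 * B * \<eta> powr (- 2 * \<tau>) * (LINT \<omega>|lborel. (norm (ft f0 \<omega>))\<^sup>2)"
      unfolding energy_def using e plancherel_integrable[OF f0 f0_2]
      by (subst Bochner_Integration.integral_add) (auto intro!: integrable_mult_right simp del: mult.assoc)
    also have "\<dots> \<le> 2 * A * \<eta> powr (2 * \<sigma> - 2 * \<tau>) * energy \<sigma> f + 2 * B * \<eta> powr (- 2 * \<tau>) * (?\<pi> * mass_on S f)"
      using plancherel_le[OF f0 f0_2] AB unfolding f0_sq mass_on_def[symmetric] by (intro add_left_mono mult_left_mono) auto
    also have "\<dots> \<le> C * (\<eta> powr (2 * \<sigma> - 2 * \<tau>) * energy \<sigma> f + \<eta> powr (- 2 * \<tau>) * mass_on S f)"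
    proof -
      define x where "x = \<eta> powr (2 * \<sigma> - 2 * \<tau>) * energy \<sigma> f"
      define y where "y = \<eta> powr (- 2 * \<tau>) * mass_on S f"
      have xy: "x \<ge> 0" "y \<ge> 0" by (simp_all add: x_def y_def energy_nonneg mass_on_nonneg)
      have BP: "2 * B * ?\<pi> \<ge> 0" using AB by simp
      have "2 * A \<le> C" "2 * B * ?\<pi> \<le> C" using AB BP unfolding C_def by linarith+
      then have "2 * A * x + 2 * B * ?\<pi> * y \<le> C * x + C * y"
        using xy by (intro add_mono mult_right_mono)
      then show ?thesis by (simp add: x_def y_def distrib_left mult_ac)
    qed
    finally show ?thesis using w w2 wf iw by blast
  qed
  note main = this
  show ?thesis
    by (intro exI[of _ C] exI[of _ "real m"] conjI C L allI impI) (rule main, auto)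
qed

section \<open>The Bernstein inequality\<close>

lemma
  fixes w :: "'a::euclidean_space \<Rightarrow> complex"
  assumes w: "integrable lborel w" and w2: "integrable lborel (\<lambda>x. (norm (w x))\<^sup>2)"
    and i: "integrable lborel (\<lambda>\<omega>. weight \<tau> \<omega> * (norm (ft w \<omega>))\<^sup>2)"
  shows sobolev_spaceI: "w \<in> sobolev_space \<tau>"
    and sobolev_norm_eq: "sobolev_norm \<tau> w = sqrt ((2 * pi) powr (- real DIM('a) / 2) / (2 * pi) ^ DIM('a)
          * (LINT \<omega>|lborel. weight \<tau> \<omega> * (norm (ft w \<omega>))\<^sup>2))"
proof -
  have [measurable]: "w \<in> borel_measurable borel" using borel_measurable_integrable[OF w] by simp
  have [measurable]: "fourier_L2 w \<in> borel_measurable borel" by (rule fourier_L2_eq_fourier(2)[OF w w2])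
  have eq: "AE \<omega> in lborel. (1 + (norm \<omega>)\<^sup>2) powr \<tau> * (norm (fourier_L2 w \<omega>))\<^sup>2 = weight \<tau> \<omega> * (norm (ft w \<omega>))\<^sup>2 / (2 * pi) ^ DIM('a)"
    using fourier_L2_eq_fourier(1)[OF w w2] by eventually_elim (simp add: norm_fourier_square weight_def)
  have m1: "(\<lambda>\<omega>. (1 + (norm \<omega>)\<^sup>2) powr \<tau> * (norm (fourier_L2 w \<omega>))\<^sup>2) \<in> borel_measurable lborel" by measurable
  have m2: "(\<lambda>\<omega>. weight \<tau> \<omega> * (norm (ft w \<omega>))\<^sup>2 / (2 * pi) ^ DIM('a)) \<in> borel_measurable lborel" by measurable
  have "integrable lborel (\<lambda>\<omega>. (1 + (norm \<omega>)\<^sup>2) powr \<tau> * (norm (fourier_L2 w \<omega>))\<^sup>2)"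
    using integrable_cong_AE[OF m1 m2 eq] i by simp
  then show "w \<in> sobolev_space \<tau>"
    using w2 by (simp add: sobolev_space_def L2_def)
  show "sobolev_norm \<tau> w = sqrt ((2 * pi) powr (- real DIM('a) / 2) / (2 * pi) ^ DIM('a)
          * (LINT \<omega>|lborel. weight \<tau> \<omega> * (norm (ft w \<omega>))\<^sup>2))"
    unfolding sobolev_norm_def integral_cong_AE[OF m1 m2 eq] by simp
qed

lemma sobolev_norm_on_le:
  assumes "w \<in> sobolev_space \<tau>" "\<And>x. x \<in> \<Omega> \<Longrightarrow> w x = v x"
  shows "v \<in> sobolev_space_on \<Omega> \<tau>" and "sobolev_norm_on \<Omega> \<tau> v \<le> sobolev_norm \<tau> w"
proof -
  have w: "w \<in> sobolev_extensions \<Omega> \<tau> v" using assms by (simp add: sobolev_extensions_def)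
  then show "v \<in> sobolev_space_on \<Omega> \<tau>" by (auto simp: sobolev_space_on_def)
  have "bdd_below (sobolev_norm \<tau> ` sobolev_extensions \<Omega> \<tau> v)"
    by (intro bdd_belowI[of _ 0]) (auto simp: sobolev_norm_def intro!: mult_nonneg_nonneg integral_nonneg_AE)
  then show "sobolev_norm_on \<Omega> \<tau> v \<le> sobolev_norm \<tau> w"
    unfolding sobolev_norm_on_def by (rule cINF_lower[OF _ w])
qed

lemma L2_norm_on_eq_mass_on: "L2_norm_on \<Omega> v = sqrt (mass_on \<Omega> v)"
  by (simp add: L2_norm_on_def mass_on_def set_lebesgue_integral_def)

lemma
  fixes X :: "'a::euclidean_space set"
  assumes X: "finite X" "card X \<ge> 2"
  shows separation_distance_pos: "separation_distance X > 0"
    and separated_separation_distance: "separated (2 * separation_distance X) X"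
proof -
  let ?D = "{norm (x - y) | x y. x \<in> X \<and> y \<in> X \<and> x \<noteq> y}"
  have "?D \<subseteq> (\<lambda>(x, y). norm (x - y)) ` (X \<times> X)" by auto
  then have fin: "finite ?D" by (rule finite_subset) (use X in auto)
  have "\<not> is_singleton X" "X \<noteq> {}" using X by (auto simp: is_singleton_altdef)
  then obtain x y where "x \<in> X" "y \<in> X" "x \<noteq> y" by (metis ex_in_conv is_singletonI')
  then have "?D \<noteq> {}" by blast
  then have "Min ?D \<in> ?D" using fin by (rule Min_in[rotated])
  then show "separation_distance X > 0" unfolding separation_distance_def by auto
  show "separated (2 * separation_distance X) X"
    unfolding separated_def separation_distance_def
    by (auto intro!: Min_le[OF fin])
qed

lemma trial_space_imp_sum:
  fixes v :: "'a::euclidean_space \<Rightarrow> real"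
  assumes X: "finite X" and v: "v \<in> trial_space \<Psi> X"
  shows "\<exists>\<alpha>. \<forall>x. v x = (\<Sum>y\<in>X. \<alpha> y * \<Psi> (x - y))"
proof -
  interpret fs: module "\<lambda>(c::real) (f :: 'a \<Rightarrow> real) x. c * f x"
    by standard (auto simp: fun_eq_iff algebra_simps)
  let ?T = "{v. \<exists>\<alpha>. \<forall>x. v x = (\<Sum>y\<in>X. \<alpha> y * \<Psi> (x - y))}"
  have "fs.subspace ?T"
  proof (rule fs.subspaceI)
    show "0 \<in> ?T" by (auto intro: exI[of _ "\<lambda>_. 0"])
    show "f + g \<in> ?T" if "f \<in> ?T" "g \<in> ?T" for f g
    proof -
      obtain \<alpha> \<beta> where "\<forall>x. f x = (\<Sum>y\<in>X. \<alpha> y * \<Psi> (x - y))" "\<forall>x. g x = (\<Sum>y\<in>X. \<beta> y * \<Psi> (x - y))"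
        using \<open>f \<in> ?T\<close> \<open>g \<in> ?T\<close> by blast
      then have "\<forall>x. (f + g) x = (\<Sum>y\<in>X. (\<alpha> y + \<beta> y) * \<Psi> (x - y))"
        by (simp add: distrib_right sum.distrib)
      then show ?thesis by (intro CollectI exI)
    qed
    show "(\<lambda>x. c * f x) \<in> ?T" if "f \<in> ?T" for c f
    proof -
      obtain \<alpha> where "\<forall>x. f x = (\<Sum>y\<in>X. \<alpha> y * \<Psi> (x - y))" using \<open>f \<in> ?T\<close> by blast
      then have "\<forall>x. c * f x = (\<Sum>y\<in>X. (c * \<alpha> y) * \<Psi> (x - y))"
        by (simp add: sum_distrib_left mult.assoc)
      then show ?thesis by (intro CollectI exI[of _ "\<lambda>y. c * \<alpha> y"]) simp
    qed
  qed
  moreover have "(\<lambda>y x. \<Psi> (x - y)) ` X \<subseteq> ?T"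
  proof safe
    fix y assume y: "y \<in> X"
    have "(\<Sum>z\<in>X. of_bool (z = y) * \<Psi> (x - z)) = (\<Sum>z\<in>X. if z = y then \<Psi> (x - z) else 0)" for x
      by (rule sum.cong) auto
    then have "\<forall>x. \<Psi> (x - y) = (\<Sum>z\<in>X. of_bool (z = y) * \<Psi> (x - z))" using X y by simp
    then show "\<exists>\<alpha>. \<forall>x. \<Psi> (x - y) = (\<Sum>y\<in>X. \<alpha> y * \<Psi> (x - y))"
      by (rule exI[of _ "\<lambda>z. of_bool (z = y)"])
  qed
  ultimately have "fs.span ((\<lambda>y x. \<Psi> (x - y)) ` X) \<subseteq> ?T" by (rule fs.span_minimal[rotated])
  with v show ?thesis unfolding trial_space_def by blast
qed

text \<open>The extension is taken at scale \<open>\<eta> = \<epsilon> q\<close>, with the neighbourhood \<open>S\<close> of width \<open>\<rho> = 2 L \<eta>\<close>. The upper bound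
  \<open>q \<le> c\<close> allows a choice of \<open>\<epsilon>\<close> that does not depend on \<open>X\<close> and for which \<open>\<eta> \<le> 1\<close> and the steps of length
  \<open>\<rho> / \<theta>\<close> stay within the height of the cones.\<close>

theorem (in sobolev_kernel) bernstein_bounded_domain:
  assumes dom: "bounded_lipschitz_domain \<Omega>" and \<tau>: "0 \<le> \<tau>" "\<tau> \<le> \<sigma>" and c: "c > 0"
  shows "\<exists>C>0. \<forall>\<delta> X v. 0 < \<delta> \<longrightarrow> \<delta> \<le> 1 \<longrightarrow> finite X \<longrightarrow> card X \<ge> 2 \<longrightarrow> X \<subseteq> \<Omega> \<longrightarrow>
           separation_distance X \<le> c * \<delta> \<longrightarrow> v \<in> trial_space (scaled_kernel \<delta> \<Phi>) X \<longrightarrow>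
           (\<lambda>x. complex_of_real (v x)) \<in> sobolev_space_on \<Omega> \<tau> \<and>
           sobolev_norm_on \<Omega> \<tau> (\<lambda>x. complex_of_real (v x))
             \<le> C * separation_distance X powr (- \<tau>) * L2_norm_on \<Omega> (\<lambda>x. complex_of_real (v x))"
proof -
  have \<Omega>: "open \<Omega>" using dom by (simp add: bounded_lipschitz_domain_def)
  obtain E r \<theta> where E: "finite E" "\<And>e. e \<in> E \<Longrightarrow> norm e = 1" and r: "0 < r" and \<theta>: "0 < \<theta>" "\<theta> \<le> 1"
      and cone: "\<And>x. x \<in> \<Omega> \<Longrightarrow> \<exists>e\<in>E. cone_into \<Omega> r \<theta> e x"
    using uniform_cone[OF dom] by blast
  obtain C1 where C1: "C1 > 0" and bern: "\<And>\<delta> q X \<alpha>. 0 < \<delta> \<Longrightarrow> \<delta> \<le> 1 \<Longrightarrow> finite X \<Longrightarrow> 0 < q \<Longrightarrow> q \<le> c * \<delta> \<Longrightarrow> separated (2 * q) X \<Longrightarrow> X \<subseteq> \<Omega> \<Longrightarrow>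
     energy \<sigma> (trial \<delta> X \<alpha>) \<le> C1 * q powr (- 2 * \<sigma>) * mass_on \<Omega> (trial \<delta> X \<alpha>)"
    using energy_le_mass[OF E r \<theta> \<Omega> cone c] by blast
  obtain m :: nat where "real m \<ge> max 1 \<sigma>" using real_arch_simple by blast
  then have m: "\<sigma> \<le> real m" "1 \<le> m" by auto
  have \<sigma>0: "0 \<le> \<sigma>" using sigma_pos by simp
  obtain C2 where C2: "C2 > 0" and nbhd: "\<And>\<rho> \<Omega> S f. 0 < \<rho> \<Longrightarrow> real m * (\<rho> / \<theta>) \<le> r \<Longrightarrow> open \<Omega> \<Longrightarrow> S \<in> sets borel \<Longrightarrow>
     (\<forall>y\<in>S. \<exists>x\<in>\<Omega>. norm (y - x) \<le> \<rho>) \<Longrightarrow> (\<forall>x\<in>\<Omega>. \<exists>e\<in>E. cone_into \<Omega> r \<theta> e x) \<Longrightarrow> ft_regular f \<Longrightarrow> integrable lborel (energy_density \<sigma> f) \<Longrightarrow>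
     mass_on S f \<le> C2 * (\<rho> powr (2 * \<sigma>) * energy \<sigma> f + mass_on \<Omega> f)"
    using mass_on_neighbourhood[OF \<sigma>0 m E \<theta>(1), of r] by blast
  obtain C3 L where C3: "C3 > 0" and L: "L > 0" and ext: "\<forall>\<eta> \<Omega> S (f :: 'a \<Rightarrow> complex). 0 < \<eta> \<longrightarrow> \<eta> \<le> 1 \<longrightarrow> S \<in> sets borel \<longrightarrow>
     (\<forall>x\<in>\<Omega>. \<forall>y. norm (y - x) \<le> L * \<eta> \<longrightarrow> y \<in> S) \<longrightarrow> ft_regular f \<longrightarrow> integrable lborel (energy_density \<sigma> f) \<longrightarrow>
     (\<exists>w. integrable lborel w \<and> integrable lborel (\<lambda>x. (norm (w x))\<^sup>2) \<and> (\<forall>x\<in>\<Omega>. w x = f x) \<and>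
        integrable lborel (\<lambda>\<omega>. weight \<tau> \<omega> * (norm (ft w \<omega>))\<^sup>2) \<and>
        (LINT \<omega>|lborel. weight \<tau> \<omega> * (norm (ft w \<omega>))\<^sup>2) \<le> C3 * (\<eta> powr (2 * \<sigma> - 2 * \<tau>) * energy \<sigma> f + \<eta> powr (- 2 * \<tau>) * mass_on S f))"
    using local_extension[OF \<tau>, where 'a='a] by blast
  define \<epsilon> where "\<epsilon> = min (1 / c) (r * \<theta> / (2 * real m * L * c))"
  have \<epsilon>: "\<epsilon> > 0" using c r \<theta> m L by (simp add: \<epsilon>_def)
  have \<epsilon>1: "\<epsilon> * c \<le> 1"
  proof -
    have "\<epsilon> \<le> 1 / c" by (simp add: \<epsilon>_def)
    then show ?thesis using c by (simp add: field_simps)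
  qed
  have \<epsilon>2: "real m * (2 * L * (\<epsilon> * c) / \<theta>) \<le> r"
  proof -
    have "\<epsilon> \<le> r * \<theta> / (2 * real m * L * c)" by (simp add: \<epsilon>_def)
    then show ?thesis using c \<theta> m L by (simp add: field_simps)
  qed
  define D where "D = C2 * ((2 * L * \<epsilon>) powr (2 * \<sigma>) * C1 + 1)"
  have D: "D > 0" using C1 C2 by (simp add: D_def add_nonneg_pos)
  define K where "K = (2 * pi) powr (- real DIM('a) / 2) / (2 * pi) ^ DIM('a) * (C3 * (\<epsilon> powr (2 * \<sigma> - 2 * \<tau>) * C1 + \<epsilon> powr (- 2 * \<tau>) * D))"
  have K: "K > 0" using C1 C3 D \<epsilon> by (simp add: K_def add_pos_pos)
  have main: "(\<lambda>x. complex_of_real (v x)) \<in> sobolev_space_on \<Omega> \<tau> \<and>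
           sobolev_norm_on \<Omega> \<tau> (\<lambda>x. complex_of_real (v x))
             \<le> sqrt K * separation_distance X powr (- \<tau>) * L2_norm_on \<Omega> (\<lambda>x. complex_of_real (v x))"
    if \<delta>: "0 < \<delta>" "\<delta> \<le> 1" and X: "finite X" "card X \<ge> 2" "X \<subseteq> \<Omega>" and qc: "separation_distance X \<le> c * \<delta>"
      and v: "v \<in> trial_space (scaled_kernel \<delta> \<Phi>) X" for \<delta> X v
  proof -
    obtain \<alpha> where \<alpha>: "\<And>x. v x = (\<Sum>y\<in>X. \<alpha> y * scaled_kernel \<delta> \<Phi> (x - y))"
      using trial_space_imp_sum[OF X(1) v] by blast
    define f where "f = trial \<delta> X \<alpha>"
    have vf: "(\<lambda>x. complex_of_real (v x)) = f" by (simp add: f_def trial_def \<alpha> fun_eq_iff)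
    have f: "ft_regular f" "integrable lborel (energy_density \<sigma> f)"
      unfolding f_def by (rule ft_regular_trial[OF \<delta>(1)], rule integrable_energy_trial[OF \<delta>(1)])
    define q where "q = separation_distance X"
    have q: "q > 0" unfolding q_def by (rule separation_distance_pos[OF X(1,2)])
    have "c * \<delta> \<le> c * 1" using \<delta>(2) c by (intro mult_left_mono) auto
    then have q1: "q \<le> c" using qc unfolding q_def by linarith
    define \<mu> where "\<mu> = mass_on \<Omega> f"
    have \<mu>: "\<mu> \<ge> 0" unfolding \<mu>_def by (rule mass_on_nonneg)
    have en: "energy \<sigma> f \<le> C1 * q powr (- 2 * \<sigma>) * \<mu>"
      unfolding f_def \<mu>_def q_def
      by (rule bern[OF \<delta> X(1) separation_distance_pos[OF X(1,2)] qc separated_separation_distance[OF X(1,2)] X(3)])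
    define \<eta> where "\<eta> = \<epsilon> * q"
    have \<eta>3: "\<eta> \<le> \<epsilon> * c" unfolding \<eta>_def using q1 \<epsilon> by (intro mult_left_mono) auto
    have "0 < \<eta>" using \<epsilon> q by (simp add: \<eta>_def)
    note \<eta> = this order_trans[OF \<eta>3 \<epsilon>1] \<eta>3
    define \<rho> where "\<rho> = 2 * L * \<eta>"
    have \<rho>: "\<rho> > 0" using L \<eta> by (simp add: \<rho>_def)
    have "real m * (\<rho> / \<theta>) \<le> real m * (2 * L * (\<epsilon> * c) / \<theta>)"
      unfolding \<rho>_def using \<eta> L \<theta> by (intro mult_left_mono divide_right_mono) auto
    also note \<epsilon>2
    finally have \<rho>r: "real m * (\<rho> / \<theta>) \<le> r" .
    define S where "S = (\<Union>x\<in>\<Omega>. ball x \<rho>)"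
    have S: "S \<in> sets borel" unfolding S_def by (intro borel_open open_UN) auto
    have "\<forall>y\<in>S. \<exists>x\<in>\<Omega>. norm (y - x) \<le> \<rho>"
      unfolding S_def by (force simp: dist_norm norm_minus_commute)
    from nbhd[OF \<rho> \<rho>r \<Omega> S this _ f] cone
    have "mass_on S f \<le> C2 * (\<rho> powr (2 * \<sigma>) * energy \<sigma> f + \<mu>)" unfolding \<mu>_def by blast
    also have "\<dots> \<le> C2 * (\<rho> powr (2 * \<sigma>) * (C1 * q powr (- 2 * \<sigma>) * \<mu>) + \<mu>)"
      using C2 en by (intro mult_left_mono add_right_mono) auto
    also have "\<dots> = D * \<mu>"
    proof -
      have "\<rho> powr (2 * \<sigma>) * q powr (- 2 * \<sigma>) = (2 * L * \<epsilon>) powr (2 * \<sigma>)"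
      proof -
        have "\<rho> = (2 * L * \<epsilon>) * q" by (simp add: \<rho>_def \<eta>_def)
        then have "\<rho> powr (2 * \<sigma>) = (2 * L * \<epsilon>) powr (2 * \<sigma>) * q powr (2 * \<sigma>)" by (simp only: powr_mult)
        moreover have "q powr (2 * \<sigma>) * q powr (- 2 * \<sigma>) = 1" using q by (simp add: powr_add[symmetric])
        ultimately show ?thesis by simp
      qed
      then have "\<rho> powr (2 * \<sigma>) * (C1 * q powr (- 2 * \<sigma>) * \<mu>) = (2 * L * \<epsilon>) powr (2 * \<sigma>) * (C1 * \<mu>)"
        by (metis mult.assoc mult.left_commute)
      then show ?thesis by (simp only: D_def) (simp add: algebra_simps)
    qed
    finally have massS: "mass_on S f \<le> D * \<mu>" .
    have inS: "y \<in> S" if "x \<in> \<Omega>" "norm (y - x) \<le> L * \<eta>" for x y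
    proof -
      note that
      moreover have "L * \<eta> < \<rho>" using L \<eta> by (simp add: \<rho>_def)
      ultimately have "y \<in> ball x \<rho>" by (simp add: dist_norm norm_minus_commute)
      with \<open>x \<in> \<Omega>\<close> show "y \<in> S" unfolding S_def by blast
    qed
    then have near: "\<forall>x\<in>\<Omega>. \<forall>y. norm (y - x) \<le> L * \<eta> \<longrightarrow> y \<in> S" by blast
    from ext[THEN spec[of _ \<eta>], THEN spec[of _ \<Omega>], THEN spec[of _ S], THEN spec[of _ f],
        THEN mp, OF \<eta>(1), THEN mp, OF \<eta>(2), THEN mp, OF S, THEN mp, OF near, THEN mp, OF f(1), THEN mp, OF f(2)]
    obtain w where w: "integrable lborel w" "integrable lborel (\<lambda>x. (norm (w x))\<^sup>2)" "\<forall>x\<in>\<Omega>. w x = f x"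
        "integrable lborel (\<lambda>\<omega>. weight \<tau> \<omega> * (norm (ft w \<omega>))\<^sup>2)"
        and bound: "(LINT \<omega>|lborel. weight \<tau> \<omega> * (norm (ft w \<omega>))\<^sup>2) \<le> C3 * (\<eta> powr (2 * \<sigma> - 2 * \<tau>) * energy \<sigma> f + \<eta> powr (- 2 * \<tau>) * mass_on S f)"
      by (elim exE conjE) (rule that)
    have "C3 * (\<eta> powr (2 * \<sigma> - 2 * \<tau>) * energy \<sigma> f + \<eta> powr (- 2 * \<tau>) * mass_on S f)
        \<le> C3 * (\<eta> powr (2 * \<sigma> - 2 * \<tau>) * (C1 * q powr (- 2 * \<sigma>) * \<mu>) + \<eta> powr (- 2 * \<tau>) * (D * \<mu>))"
      using C3 en massS by (intro mult_left_mono add_mono) auto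
    also have "\<dots> = C3 * (\<epsilon> powr (2 * \<sigma> - 2 * \<tau>) * C1 + \<epsilon> powr (- 2 * \<tau>) * D) * (q powr (- 2 * \<tau>) * \<mu>)"
    proof -
      have 1: "\<eta> powr (2 * \<sigma> - 2 * \<tau>) * q powr (- 2 * \<sigma>) = \<epsilon> powr (2 * \<sigma> - 2 * \<tau>) * q powr (- 2 * \<tau>)"
      proof -
        have "q powr (2 * \<sigma> - 2 * \<tau>) * q powr (- 2 * \<sigma>) = q powr (- 2 * \<tau>)" by (simp add: powr_add[symmetric])
        then show ?thesis unfolding \<eta>_def powr_mult by (simp only: mult.assoc)
      qed
      have 2: "\<eta> powr (- 2 * \<tau>) = \<epsilon> powr (- 2 * \<tau>) * q powr (- 2 * \<tau>)"
        unfolding \<eta>_def by (rule powr_mult)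
      have "\<eta> powr (2 * \<sigma> - 2 * \<tau>) * (C1 * q powr (- 2 * \<sigma>) * \<mu>) = (\<eta> powr (2 * \<sigma> - 2 * \<tau>) * q powr (- 2 * \<sigma>)) * (C1 * \<mu>)"
        by (simp only: mult_ac)
      then show ?thesis unfolding 1 2 by (simp only: distrib_left distrib_right mult_ac)
    qed
    finally have "(LINT \<omega>|lborel. weight \<tau> \<omega> * (norm (ft w \<omega>))\<^sup>2) \<le> C3 * (\<epsilon> powr (2 * \<sigma> - 2 * \<tau>) * C1 + \<epsilon> powr (- 2 * \<tau>) * D) * (q powr (- 2 * \<tau>) * \<mu>)"
      using bound by linarith
    then have "(2 * pi) powr (- real DIM('a) / 2) / (2 * pi) ^ DIM('a) * (LINT \<omega>|lborel. weight \<tau> \<omega> * (norm (ft w \<omega>))\<^sup>2) \<le> K * (q powr (- 2 * \<tau>) * \<mu>)"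
      unfolding K_def mult.assoc by (intro mult_left_mono) auto
    then have "sobolev_norm \<tau> w \<le> sqrt (K * (q powr (- 2 * \<tau>) * \<mu>))"
      unfolding sobolev_norm_eq[OF w(1,2,4)] by (rule real_sqrt_le_mono)
    also have "\<dots> = sqrt K * q powr (- \<tau>) * sqrt \<mu>"
    proof -
      have "q powr (- 2 * \<tau>) = (q powr (- \<tau>))\<^sup>2" by (simp add: power2_eq_square powr_add[symmetric])
      then show ?thesis by (simp add: real_sqrt_mult)
    qed
    finally have norm_w: "sobolev_norm \<tau> w \<le> sqrt K * q powr (- \<tau>) * L2_norm_on \<Omega> f"
      unfolding L2_norm_on_eq_mass_on \<mu>_def .
    note on = sobolev_norm_on_le[OF sobolev_spaceI[OF w(1,2,4)] bspec[OF w(3)]]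
    show ?thesis
      unfolding vf q_def[symmetric] using on(1) order_trans[OF on(2) norm_w] by (rule conjI)
  qed
  show ?thesis
    by (intro exI[of _ "sqrt K"] conjI allI impI main) (use K in auto)
qed

theorem corollary3p1:
  fixes \<Omega> :: "(real ^ 'n) set" and \<Phi> :: "real ^ 'n \<Rightarrow> real"
    and \<sigma> \<tau> c\<^sub>\<Phi> C\<^sub>\<Phi> c\<^sub>0 :: real
  assumes "bounded_lipschitz_domain \<Omega>"
    and "continuous_on UNIV \<Phi>"
    and "integrable lborel \<Phi>"
    and "strictly_positive_definite \<Phi>"
    and "\<sigma> > real CARD('n) / 2"
    and "0 < c\<^sub>\<Phi>" and "c\<^sub>\<Phi> \<le> C\<^sub>\<Phi>"
    and "\<And>\<omega>. fourier (\<lambda>x. complex_of_real (\<Phi> x)) \<omega> \<in> \<real>"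
    and "\<And>\<omega>. c\<^sub>\<Phi> * (1 + (norm \<omega>)\<^sup>2) powr (- \<sigma>)
                \<le> Re (fourier (\<lambda>x. complex_of_real (\<Phi> x)) \<omega>)"
    and "\<And>\<omega>. Re (fourier (\<lambda>x. complex_of_real (\<Phi> x)) \<omega>)
                \<le> C\<^sub>\<Phi> * (1 + (norm \<omega>)\<^sup>2) powr (- \<sigma>)"
    and "0 \<le> \<tau>" and "\<tau> \<le> \<sigma>"
    and "c\<^sub>0 > 0"
  shows "\<exists>C>0. \<forall>\<delta> X v.
           0 < \<delta> \<longrightarrow> \<delta> \<le> 1 \<longrightarrow>
           finite X \<longrightarrow> card X \<ge> 2 \<longrightarrow> X \<subseteq> \<Omega> \<longrightarrow>
           separation_distance X \<le> c\<^sub>0 * \<delta> \<longrightarrow>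
           v \<in> trial_space (scaled_kernel \<delta> \<Phi>) X \<longrightarrow>
           (\<lambda>x. complex_of_real (v x)) \<in> sobolev_space_on \<Omega> \<tau> \<and>
           sobolev_norm_on \<Omega> \<tau> (\<lambda>x. complex_of_real (v x))
             \<le> C * separation_distance X powr (- \<tau>)
                  * L2_norm_on \<Omega> (\<lambda>x. complex_of_real (v x))"
proof -
  \<comment> \<open>The factor between the normalised and the unnormalised transform.\<close>
  define s where "s = (2 * pi) powr (real DIM(real ^ 'n) / 2)"
  define P where "P \<omega> = s * Re (fourier (\<lambda>x. complex_of_real (\<Phi> x)) \<omega>)" for \<omega>
  have s: "s > 0" by (simp add: s_def)
  interpret sobolev_kernel \<Phi> P \<sigma> "s * c\<^sub>\<Phi>" "s * C\<^sub>\<Phi>"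
  proof
    fix \<omega> :: "real ^ 'n"
    have "complex_of_real s * fourier (\<lambda>x. complex_of_real (\<Phi> x)) \<omega> = ft (\<lambda>x. complex_of_real (\<Phi> x)) \<omega>"
      using two_pi_powr_half_minus[of "DIM(real ^ 'n)"]
      by (simp only: fourier_eq_ft mult.assoc[symmetric] of_real_mult[symmetric] s_def) simp
    moreover have "fourier (\<lambda>x. complex_of_real (\<Phi> x)) \<omega> = complex_of_real (Re (fourier (\<lambda>x. complex_of_real (\<Phi> x)) \<omega>))"
      using assms(8) by (simp add: complex_is_Real_iff complex_eq_iff)
    ultimately show "ft (\<lambda>x. complex_of_real (\<Phi> x)) \<omega> = complex_of_real (P \<omega>)"
      by (metis P_def of_real_mult)
    show "s * c\<^sub>\<Phi> * weight (- \<sigma>) \<omega> \<le> P \<omega>" "P \<omega> \<le> s * C\<^sub>\<Phi> * weight (- \<sigma>) \<omega>"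
      using assms(9,10)[of \<omega>] s by (simp_all add: P_def weight_def mult.assoc)
  qed (use assms s in simp_all)
  show ?thesis
    by (rule bernstein_bounded_domain[OF assms(1,11,12,13)])
qed

end
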